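(* Let $T$ denote the class of typically real functions and $S$ the class of schlicht functions. Then $$\max_{f\in S\cap T}\Big\{|\gamma_1|^2-1+2|\gamma_2|^2-\tfrac12\Big\}=2\lambda_0^4e^{-4\lambda_0}+(3\lambda_0^2+2\lambda_0+1)e^{-2\lambda_0}-1\approx 0.03485611,$$ where $\gamma_1,\gamma_2$ are the first two logarithmic coefficients of $f$ and $\lambda_0$ is the zero of the equation $0=4e^{-2\lambda}(\lambda^2-\lambda^3)-3\lambda+1$ in $[0,\infty)$, i.e. $\lambda_0=0.39004568\ldots$.
   Context: $\mathbb{D}$ is the open unit disk. $S$ is the class of schlicht functions: injective analytic $f:\mathbb{D}\to\mathbb{C}$ with $f(0)=0$, $f'(0)=1$. $T$ is the class of typically real functions: analytic $f:\mathbb{D}\to\mathbb{C}$ with $f(0)=0$, $f'(0)=1$, real-valued at real points of $\mathbb{D}$ and with $\operatorname{Im} f(z)\cdot\operatorname{Im} z>0$ for all non-real $z\in\mathbb{D}$. The logarithmic coefficients $\gamma_k=\gamma_k(f)$ of $f\in S$ are defined by $\log\frac{f(z)}{z}=2\sum_{k=1}^\infty\gamma_kz^k$, $z\in\mathbb{D}$, with the branch of the logarithm vanishing at $z=0$. *)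

theory Defs
  imports "HOL-Complex_Analysis.Complex_Analysis"
begin

text \<open>Functions on the unit disk are total functions of which only the values on
  \<^term>\<open>ball (0::complex) 1\<close> matter.\<close>

definition schlicht :: "(complex \<Rightarrow> complex) set" where
  "schlicht = {f. f holomorphic_on ball 0 1 \<and> inj_on f (ball 0 1) \<and> f 0 = 0 \<and> deriv f 0 = 1}"

definition typically_real :: "(complex \<Rightarrow> complex) set" where
  "typically_real = {f. f holomorphic_on ball 0 1 \<and> f 0 = 0 \<and> deriv f 0 = 1 \<and>
     (\<forall>z\<in>ball 0 1. z \<in> \<real> \<longrightarrow> f z \<in> \<real>) \<and>
     (\<forall>z\<in>ball 0 1. z \<notin> \<real> \<longrightarrow> Im (f z) * Im z > 0)}"

text \<open>\<open>g\<close> is the branch of $\log (f(z)/z)$ on the unit disk that vanishes at the origin.\<close>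

definition is_log_branch :: "(complex \<Rightarrow> complex) \<Rightarrow> (complex \<Rightarrow> complex) \<Rightarrow> bool" where
  "is_log_branch f g \<longleftrightarrow> g holomorphic_on ball 0 1 \<and> g 0 = 0 \<and>
     (\<forall>z\<in>ball 0 1 - {0}. exp (g z) = f z / z)"

text \<open>The branch is unique only on the disk, hence \<open>SOME\<close> rather than \<open>THE\<close>; the
  coefficients do not depend on the choice (\<open>log_coeff_eq\<close> and \<open>log_coeff_sums\<close>).\<close>

definition log_quotient :: "(complex \<Rightarrow> complex) \<Rightarrow> complex \<Rightarrow> complex" where
  "log_quotient f = (SOME g. is_log_branch f g)"

definition log_coeff :: "(complex \<Rightarrow> complex) \<Rightarrow> nat \<Rightarrow> complex" where
  "log_coeff f k = (deriv ^^ k) (log_quotient f) 0 / (2 * fact k)"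

lemma is_log_branch_exists:
  assumes "f \<in> schlicht"
  shows "\<exists>g. is_log_branch f g"
proof -
  have f: "f holomorphic_on ball 0 1" "inj_on f (ball 0 1)" "f 0 = 0" "deriv f 0 = 1"
    using assms by (auto simp: schlicht_def)
  define h where "h = (\<lambda>z. if z = 0 then deriv f 0 else f z / z)"
  have hol: "h holomorphic_on ball 0 1"
    by (rule pole_theorem_open_0[OF f(1), of 0]) (auto simp: h_def f(3))
  have nz: "h z \<noteq> 0" if "z \<in> ball 0 1" for z
  proof (cases "z = 0")
    case False
    then have "f z \<noteq> f 0"
      using f(2) that by (metis centre_in_ball inj_onD zero_less_one)
    with False f(3) show ?thesis by (simp add: h_def)
  qed (simp add: h_def f(4))
  obtain g where g: "g holomorphic_on ball 0 1" "\<And>z. z \<in> ball 0 1 \<Longrightarrow> h z = exp (g z)"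
    using contractible_imp_holomorphic_log[OF hol _ nz]
    by (metis convex_ball convex_imp_contractible)
  have g0: "exp (g 0) = 1"
    using g(2)[of 0] f(4) by (simp add: h_def)
  have "is_log_branch f (\<lambda>z. g z - g 0)"
    unfolding is_log_branch_def
  proof (intro conjI ballI)
    show "(\<lambda>z. g z - g 0) holomorphic_on ball 0 1"
      by (intro holomorphic_intros g(1))
    fix z :: complex assume "z \<in> ball 0 1 - {0}"
    then show "exp (g z - g 0) = f z / z"
      using g(2)[of z] g0 by (simp add: exp_diff h_def)
  qed simp
  then show ?thesis by blast
qed

lemma is_log_branch_log_quotient:
  "f \<in> schlicht \<Longrightarrow> is_log_branch f (log_quotient f)"
  unfolding log_quotient_def by (rule someI_ex[OF is_log_branch_exists])

lemma is_log_branch_unique: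
  assumes g: "is_log_branch f g" and h: "is_log_branch f h" and z: "z \<in> ball 0 1"
  shows "g z = h z"
proof -
  define d where "d = (\<lambda>z. g z - h z)"
  have hol: "d holomorphic_on ball 0 1"
    using g h by (auto simp: d_def is_log_branch_def intro!: holomorphic_intros)
  have exp1: "exp (d w) = 1" if "w \<in> ball 0 1" for w
  proof (cases "w = 0")
    case False
    then have "exp (g w) = exp (h w)"
      using g h that by (simp add: is_log_branch_def)
    then show ?thesis by (simp add: d_def exp_diff)
  qed (use g h in \<open>simp add: d_def is_log_branch_def\<close>)
  have "deriv d w = 0" if w: "w \<in> ball 0 1" for w
  proof -
    have "(d has_field_derivative deriv d w) (at w)"
      using hol w by (simp add: holomorphic_derivI)
    then have "((\<lambda>x. exp (d x)) has_field_derivative exp (d w) * deriv d w) (at w)"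
      by (rule DERIV_chain2[OF DERIV_exp])
    moreover have "((\<lambda>x. exp (d x)) has_field_derivative 0) (at w)"
      by (rule has_field_derivative_transform_within_open[where S = "ball 0 1" and f = "\<lambda>_. 1"])
        (use exp1 w in auto)
    ultimately show ?thesis
      using DERIV_unique by fastforce
  qed
  then have "(d has_field_derivative 0) (at w within ball 0 1)" if "w \<in> ball 0 1" for w
    using hol that by (metis holomorphic_derivI open_ball)
  then obtain c where "\<And>w. w \<in> ball 0 1 \<Longrightarrow> d w = c"
    using has_field_derivative_zero_constant[of "ball 0 1" d] by auto
  then have "d z = d 0"
    using z by simp
  then show ?thesis
    using g h by (simp add: d_def is_log_branch_def)
qed

lemma log_coeff_eq:
  assumes "f \<in> schlicht" "is_log_branch f g"
  shows "log_coeff f k = (deriv ^^ k) g 0 / (2 * fact k)"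
proof -
  have "eventually (\<lambda>z. log_quotient f z = g z) (nhds 0)"
    by (rule eventually_mono[OF eventually_nhds_in_open[of "ball 0 1"]])
      (auto intro: is_log_branch_unique[OF is_log_branch_log_quotient[OF assms(1)] assms(2)])
  then show ?thesis
    unfolding log_coeff_def using higher_deriv_cong_ev[OF _ refl] by metis
qed

lemma log_coeff_sums:
  assumes "f \<in> schlicht" "z \<in> ball 0 1"
  shows "(\<lambda>k. 2 * log_coeff f (Suc k) * z ^ Suc k) sums log_quotient f z"
proof -
  have q: "log_quotient f holomorphic_on ball 0 1" "log_quotient f 0 = 0"
    using is_log_branch_log_quotient[OF assms(1)] by (auto simp: is_log_branch_def)
  have "(\<lambda>k. (deriv ^^ k) (log_quotient f) 0 / fact k * (z - 0) ^ k) sums log_quotient f z"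
    by (rule holomorphic_power_series[OF q(1) assms(2)])
  then have "(\<lambda>k. 2 * log_coeff f k * z ^ k) sums log_quotient f z"
    by (simp add: log_coeff_def)
  moreover have "log_coeff f 0 = 0"
    by (simp add: log_coeff_def q(2))
  ultimately show ?thesis
    by (subst sums_Suc_iff) simp
qed

end

theory Submission
  imports Defs
begin

text \<open>
  For \<open>f\<close> in $S\cap T$ write $1/z-1/f(z)=A+Dz+\dots$ with real $A$, $D$. The functional equals
  $A^2/4+y^2/2-3/2$ with $y=D+A^2/2$, so the sharp region of the pairs $(A,D)$ is needed. The maximum
  principle gives $D\ge -1$. The upper bound is the family of inequalities
  $D+2b|A|\le 1+\frac32b^2-b^2\ln(b/2)$, $0<b\le 2$; optimising over $b=2e^{-\lambda}$ leaves the
  maximum of one function of $\lambda$, whose derivative is $2\lambda e^{-2\lambda}$ times the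
  equation that defines $\lambda_0$.

  Each inequality is an area comparison in the natural parameters of a quadratic differential.
  Put $z=e^{iq}$ with \<open>q\<close> in the half-strip $0<\mathrm{Re}\,q<\pi$, $\mathrm{Im}\,q>0$, and $\cos p=1+1/(bf(z))$.
  Since \<open>f\<close> is real on the diameter and preserves the upper half-plane, the map
  $2\sin q+bq\mapsto b(\sin p+p)$ is univalent, it respects a step domain with a step of width $b\pi$,
  and it is $w-ic_0+c_1/w+o(1/w)$ at infinity, with $c_0=A-b+b\ln(b/2)$ and $c_1=D+bA-b^2/2-1$. Comparing
  the area of the image of a large rectangle with the area available to it gives
  $\pi c_1\le -b\pi c_0$, which is the inequality. Equality holds if the map is the identity, and
  solving $2\sin q+bq=b(\sin p+p)$ for \<open>p\<close> produces the extremal \<open>f\<close>.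
\<close>

text \<open>Why the area count gives exactly pi c1 <= -m c0, where m = b pi: cut the domain at Re w
  = T and |Im w| = L. The area available in the target is about T(L - c0) + (T - m)(L + c0): the
  translation by -i c0 takes height from the wide upper half and gives it to the lower half, which
  is narrower by m, a net change of -m c0. The term c1/w moves the right side by c1 T/(y^2 + T^2);
  bending that side so that its image becomes straight leaves a surplus of 2 c1 arctan(L/T) in the
  lower bound for the image area. The other errors vanish as L/T grows.

  The restriction b <= 2 comes from the right edge: 2 sin q + bq sends pi + is to height bs - 2 sinh
  s, which is negative for all s > 0 precisely when b <= 2. The target map b(sin p + p) is b/2 times
  the case b = 2 of the same function, hence has the same step b pi. For b < 2 the source folds part
  of the base of the half-strip along a real segment that starts at the step, and the target does
  not; this is why the extremal functions are slit maps.\<close>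

unbundle no fps_syntax

section \<open>Area of holomorphic images\<close>

text \<open>Areas are taken in \<open>real^2\<close>, where change of variables is expressed by the
  determinant of the derivative matrix.\<close>

definition vec_of_complex :: "complex \<Rightarrow> real^2" where
  "vec_of_complex w = vector [Re w, Im w]"

lemma vec_of_complex_nth [simp]:
  "vec_of_complex w $ 1 = Re w" "vec_of_complex w $ 2 = Im w"
  by (simp_all add: vec_of_complex_def)

lemma bounded_linear_vec_of_complex: "bounded_linear vec_of_complex"
proof (rule bounded_linear_intro[where K = 2])
  fix w show "norm (vec_of_complex w) \<le> norm w * 2"
    using norm_le_l1_cart[of "vec_of_complex w"] abs_Re_le_cmod[of w] abs_Im_le_cmod[of w]
    by (simp add: UNIV_2)
qed (simp_all add: vec_eq_iff forall_2)

lemma inj_vec_of_complex: "inj vec_of_complex"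
  by (rule injI) (metis complex_eqI vec_of_complex_nth)

text \<open>The pairs are (y, x), so that Fubini makes x the inner variable and integrates along
  horizontal lines first.\<close>

lemma lborel_distr_vec2: "distr (lborel \<Otimes>\<^sub>M lborel) borel (\<lambda>(y, x). vec_of_complex (Complex x y)) = lborel"
proof -
  have "continuous_on UNIV (\<lambda>p. vec_of_complex (Complex (snd p) (fst p)))"
    by (intro bounded_linear.continuous_on[OF bounded_linear_vec_of_complex] continuous_on_Complex
        continuous_on_fst continuous_on_snd continuous_on_id)
  then have m: "(\<lambda>p. vec_of_complex (Complex (snd p) (fst p))) \<in> borel_measurable (lborel \<Otimes>\<^sub>M lborel)"
    using borel_measurable_continuous_onI by (simp add: lborel_prod)
  have "lborel = distr (lborel \<Otimes>\<^sub>M lborel) borel (\<lambda>p. vec_of_complex (Complex (snd p) (fst p)))"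
  proof (rule lborel_eqI)
    fix l u :: "real^2" assume *: "\<And>b. b \<in> Basis \<Longrightarrow> l \<bullet> b \<le> u \<bullet> b"
    have le: "l $ i \<le> u $ i" for i
      using *[of "axis i 1"] by (auto simp: inner_axis Basis_vec_def)
    have eq: "(\<lambda>p. vec_of_complex (Complex (snd p) (fst p))) -` box l u = box (l$2) (u$2) \<times> box (l$1) (u$1)"
      by (auto simp: mem_box_cart forall_2)
    have "emeasure (distr (lborel \<Otimes>\<^sub>M lborel) borel (\<lambda>p. vec_of_complex (Complex (snd p) (fst p)))) (box l u)
      = emeasure (lborel \<Otimes>\<^sub>M lborel) (box (l$2) (u$2) \<times> box (l$1) (u$1))"
      using emeasure_distr[OF m, of "box l u"] by (simp add: eq space_pair_measure)
    also have "\<dots> = emeasure lborel (box (l$2) (u$2)) * emeasure lborel (box (l$1) (u$1))"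
      by (rule lborel.emeasure_pair_measure_Times) auto
    also have "\<dots> = ennreal ((u$2 - l$2) * (u$1 - l$1))"
      using le by (simp add: ennreal_mult')
    also have "(u$2 - l$2) * (u$1 - l$1) = (\<Prod>b\<in>Basis. (u - l) \<bullet> b)"
    proof -
      have bas: "(Basis :: (real^2) set) = {axis 1 1, axis 2 1}"
        by (auto simp: Basis_vec_def UNIV_2)
      show ?thesis
        unfolding bas by (simp add: axis_eq_axis inner_axis)
    qed
    finally show "emeasure (distr (lborel \<Otimes>\<^sub>M lborel) borel (\<lambda>p. vec_of_complex (Complex (snd p) (fst p)))) (box l u)
      = ennreal (\<Prod>b\<in>Basis. (u - l) \<bullet> b)" by simp
  qed simp
  then show ?thesis by (simp add: case_prod_unfold)
qed

lemma image_area_eq: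
  assumes H: "H holomorphic_on U" "open U" and B: "compact B" "B \<subseteq> U" and inj: "inj_on H B"
  shows "measure lebesgue (vec_of_complex ` H ` B)
     = (LINT v|lborel. indicator (vec_of_complex ` B) v *\<^sub>R (cmod (deriv H (Complex (v$1) (v$2))))\<^sup>2)"
proof -
  define g where "g = (\<lambda>v::real^2. vec_of_complex (H (Complex (v$1) (v$2))))"
  define z where "z = (\<lambda>v::real^2. Complex (v$1) (v$2))"
  define g' where "g' = (\<lambda>v h::real^2. vec_of_complex (deriv H (z v) * z h))"
  have zlin: "bounded_linear z"
  proof (rule bounded_linear_intro[where K = 2])
    fix v show "norm (z v) \<le> norm v * 2"
      using cmod_le[of "z v"] component_le_norm_cart[of v 1] component_le_norm_cart[of v 2]
      by (simp add: z_def)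
  qed (simp_all add: z_def complex_eq_iff)
  have [simp]: "z (vec_of_complex w) = w" "vec_of_complex (z v) = v" for w v
    by (simp_all add: z_def vec_eq_iff forall_2)
  define S where "S = vec_of_complex ` B"
  have cS: "compact S"
    unfolding S_def by (intro compact_continuous_image B linear_continuous_on bounded_linear_vec_of_complex)
  have zS: "z v \<in> B" if "v \<in> S" for v using that by (auto simp: S_def)
  have img: "g ` S = vec_of_complex ` H ` B"
    by (auto simp: S_def g_def image_iff)
  have der: "(g has_derivative g' v) (at v within S)" if "v \<in> S" for v
  proof -
    have "(H has_field_derivative deriv H (z v)) (at (z v))"
      using H B zS[OF that] by (meson holomorphic_derivI subsetD)
    then have "(H has_derivative (\<lambda>h. deriv H (z v) * h)) (at (z v))"
      by (simp add: has_field_derivative_def)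
    then have "((\<lambda>v. H (z v)) has_derivative (\<lambda>h. deriv H (z v) * z h)) (at v within S)"
      by (rule has_derivative_compose[rotated]) (simp add: bounded_linear_imp_has_derivative zlin)
    from bounded_linear.has_derivative[OF bounded_linear_vec_of_complex this]
    show ?thesis
      by (simp add: g_def g'_def z_def)
  qed
  have det: "\<bar>det (matrix (g' v))\<bar> = (cmod (deriv H (z v)))\<^sup>2" for v
  proof -
    \<comment> \<open>Multiplication by a complex number a acts on the plane with determinant (Re
      a)^2 + (Im a)^2.\<close>
    have "det (matrix (g' v)) = (cmod (deriv H (z v)))\<^sup>2"
      unfolding cmod_power2
      by (simp add: det_2 matrix_def g'_def z_def axis_def power2_eq_square)
    then show ?thesis by simp
  qed
  have injg: "inj_on g S"
    unfolding S_def g_def z_def[symmetric] using inj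
    by (auto simp: inj_on_def inj_eq[OF inj_vec_of_complex])
  have cont: "continuous_on S (\<lambda>v. (cmod (deriv H (z v)))\<^sup>2)"
    by (intro continuous_intros continuous_on_compose2[where f = z and g = "deriv H" and t = B] linear_continuous_on zlin
      holomorphic_on_imp_continuous_on holomorphic_on_subset[OF holomorphic_deriv[OF H] B(2)]) (use zS in auto)
  have int: "set_integrable lborel S (\<lambda>v. (cmod (deriv H (z v)))\<^sup>2)"
    unfolding set_integrable_def by (rule borel_integrable_compact[OF cS cont])
  have intS: "(\<lambda>v. \<bar>det (matrix (g' v))\<bar>) integrable_on S"
    unfolding det using set_borel_integral_eq_integral(1)[OF int] .
  have "measure lebesgue (g ` S) = integral S (\<lambda>v. \<bar>det (matrix (g' v))\<bar>)"
    by (rule measure_differentiable_image_eq[OF _ der injg intS])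
       (use cS in \<open>auto intro: lmeasurable_compact fmeasurableD\<close>)
  also have "\<dots> = (LINT v:S|lborel. (cmod (deriv H (z v)))\<^sup>2)"
    unfolding det using set_borel_integral_eq_integral(2)[OF int] by simp
  finally show ?thesis
    unfolding img by (simp add: set_lebesgue_integral_def S_def z_def)
qed

text \<open>Uses $|H'|^2\ge 2\,\mathrm{Re}\,H'-1$, whose right-hand side integrates along horizontal lines.\<close>

lemma image_area_ge:
  fixes r :: "real \<Rightarrow> real"
  assumes H: "H holomorphic_on U" "open U"
    and r: "continuous_on {c..d} r" "\<And>y. y \<in> {c..d} \<Longrightarrow> l \<le> r y"
    and B: "B = {w. Im w \<in> {c..d} \<and> l \<le> Re w \<and> Re w \<le> r (Im w)}" "B \<subseteq> U" and inj: "inj_on H B"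
  shows "vec_of_complex ` H ` B \<in> lmeasurable" (is ?meas)
    and "(LINT y|lborel. indicator {c..d} y *\<^sub>R
           (2 * (Re (H (Complex (r y) y)) - Re (H (Complex l y))) - (r y - l)))
         \<le> measure lebesgue (vec_of_complex ` H ` B)" (is ?le)
proof -
  have cB: "compact B"
  proof -
    have "bounded (r ` {c..d})"
      by (intro compact_imp_bounded compact_continuous_image r) auto
    then obtain M where M: "\<And>y. y \<in> {c..d} \<Longrightarrow> \<bar>r y\<bar> \<le> M"
      unfolding bounded_iff real_norm_def by blast
    have "bounded B"
      unfolding bounded_iff
    proof (intro exI ballI)
      fix w assume "w \<in> B"
      then have "c \<le> Im w" "Im w \<le> d" "l \<le> Re w" "Re w \<le> r (Im w)" "\<bar>r (Im w)\<bar> \<le> M"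
        using M[of "Im w"] by (simp_all add: B)
      with cmod_le[of w] show "norm w \<le> \<bar>l\<bar> + M + \<bar>c\<bar> + \<bar>d\<bar>"
        by linarith
    qed
    moreover have "closed B"
    proof -
      have 1: "closed {w. Im w \<in> {c..d}}" 
        using closed_vimage[OF closed_atLeastAtMost[of c d], of Im] by (simp add: continuous_intros vimage_def)
      have "continuous_on {w. Im w \<in> {c..d}} (\<lambda>w. r (Im w))"
        by (rule continuous_on_compose2[OF r(1)]) (auto intro!: continuous_intros)
      then have "closed {w \<in> {w. Im w \<in> {c..d}}. Re w \<le> r (Im w)}"
        by (intro continuous_on_closed_Collect_le 1 continuous_intros)
      then have "closed {w. Im w \<in> {c..d} \<and> Re w \<le> r (Im w)}"
        by (simp only: mem_Collect_eq)
      moreover have "B = {w. Im w \<in> {c..d} \<and> Re w \<le> r (Im w)} \<inter> {w. l \<le> Re w}"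
        by (auto simp: B)
      ultimately show ?thesis
        by (simp add: closed_Int closed_halfspace_Re_ge)
    qed
    ultimately show ?thesis by (simp add: compact_eq_bounded_closed)
  qed
  have "compact (vec_of_complex ` H ` B)"
    by (rule compact_continuous_image[OF linear_continuous_on[OF bounded_linear_vec_of_complex]
          compact_continuous_image[OF holomorphic_on_imp_continuous_on[OF holomorphic_on_subset[OF H(1) B(2)]] cB]])
  then show ?meas by (rule lmeasurable_compact)
  define D where "D = deriv H"
  have contD: "continuous_on B D"
    unfolding D_def using H B by (meson holomorphic_deriv holomorphic_on_imp_continuous_on holomorphic_on_subset)
  define B2 where "B2 = (\<lambda>w. (Im w, Re w)) ` B"
  have cB2: "compact B2" unfolding B2_def by (intro compact_continuous_image continuous_intros cB)
  have inB2: "(y, x) \<in> B2 \<longleftrightarrow> Complex x y \<in> B" for x y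
    by (auto simp: B2_def intro: rev_image_eqI)
  define \<psi> where "\<psi> = (\<lambda>(y, x). 2 * Re (D (Complex x y)) - 1)"
  have cont\<psi>: "continuous_on B2 \<psi>"
    unfolding \<psi>_def case_prod_unfold
    by (intro continuous_intros continuous_on_compose2[OF contD] continuous_on_Complex)
       (auto simp: inB2)
  have int\<psi>: "integrable (lborel \<Otimes>\<^sub>M lborel) (\<lambda>p. indicator B2 p *\<^sub>R \<psi> p)"
    unfolding lborel_prod by (rule borel_integrable_compact[OF cB2 cont\<psi>])
  have cv: "compact (vec_of_complex ` B)"
    by (intro compact_continuous_image cB linear_continuous_on bounded_linear_vec_of_complex)
  have c1: "continuous_on (vec_of_complex ` B) (\<lambda>v. D (Complex (v$1) (v$2)))"
    by (rule continuous_on_compose2[OF contD]) (auto intro!: continuous_intros continuous_on_Complex)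
  have c2: "continuous_on (vec_of_complex ` B) (\<lambda>v. 2 * Re (D (Complex (v$1) (v$2))) - 1)"
    "continuous_on (vec_of_complex ` B) (\<lambda>v. (cmod (D (Complex (v$1) (v$2))))\<^sup>2)"
    using c1 by (auto intro!: continuous_on_diff continuous_on_mult continuous_on_Re continuous_on_power continuous_on_norm)
  have "(LINT v|lborel. indicator (vec_of_complex ` B) v *\<^sub>R (2 * Re (D (Complex (v$1) (v$2))) - 1))
     \<le> (LINT v|lborel. indicator (vec_of_complex ` B) v *\<^sub>R (cmod (D (Complex (v$1) (v$2))))\<^sup>2)"
  proof (rule integral_mono)
    fix v :: "real^2"
    \<comment> \<open>This is |u - 1|^2 >= 0. Equality holds only at u = 1, so no area is lost for a
      map with derivative 1.\<close>
    have "2 * Re u - 1 \<le> (cmod u)\<^sup>2" for u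
    proof -
      have "(Re u - 1)\<^sup>2 = (Re u)\<^sup>2 - 2 * Re u + 1" by (simp add: power2_diff)
      then show ?thesis
        using zero_le_power2[of "Re u - 1"] zero_le_power2[of "Im u"] cmod_power2[of u] by linarith
    qed
    then show "indicator (vec_of_complex ` B) v *\<^sub>R (2 * Re (D (Complex (v $ 1) (v $ 2))) - 1)
         \<le> indicator (vec_of_complex ` B) v *\<^sub>R (cmod (D (Complex (v $ 1) (v $ 2))))\<^sup>2"
      by (intro scaleR_left_mono) auto
  qed (rule borel_integrable_compact[OF cv c2(1)] borel_integrable_compact[OF cv c2(2)])+
  also have "\<dots> = measure lebesgue (vec_of_complex ` H ` B)"
    using image_area_eq[OF H cB B(2) inj] by (simp add: D_def)
  finally have 1: "(LINT v|lborel. indicator (vec_of_complex ` B) v *\<^sub>R (2 * Re (D (Complex (v$1) (v$2))) - 1))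
     \<le> measure lebesgue (vec_of_complex ` H ` B)" .
  have meas: "(\<lambda>v. indicator (vec_of_complex ` B) v *\<^sub>R (2 * Re (D (Complex (v$1) (v$2))) - 1)) \<in> borel_measurable borel"
    using borel_measurable_integrable[OF borel_integrable_compact[OF cv c2(1)]] by simp
  have "continuous_on UNIV (\<lambda>p. vec_of_complex (Complex (snd p) (fst p)))"
    by (intro bounded_linear.continuous_on[OF bounded_linear_vec_of_complex] continuous_on_Complex
        continuous_on_fst continuous_on_snd continuous_on_id)
  then have mv: "(\<lambda>p. vec_of_complex (Complex (snd p) (fst p))) \<in> borel_measurable (lborel \<Otimes>\<^sub>M lborel)"
    using borel_measurable_continuous_onI by (simp add: lborel_prod)
  have "(LINT v|lborel. indicator (vec_of_complex ` B) v *\<^sub>R (2 * Re (D (Complex (v$1) (v$2))) - 1))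
     = (LINT p|(lborel \<Otimes>\<^sub>M lborel). indicator B2 p *\<^sub>R \<psi> p)"
  proof -
    let ?\<phi> = "\<lambda>v. indicator (vec_of_complex ` B) v *\<^sub>R (2 * Re (D (Complex (v$1) (v$2))) - 1)"
    have "integral\<^sup>L lborel ?\<phi> = integral\<^sup>L (distr (lborel \<Otimes>\<^sub>M lborel) borel (\<lambda>(y, x). vec_of_complex (Complex x y))) ?\<phi>"
      by (simp only: lborel_distr_vec2)
    also have "\<dots> = (LINT p|(lborel \<Otimes>\<^sub>M lborel). ?\<phi> (vec_of_complex (Complex (snd p) (fst p))))"
      unfolding case_prod_unfold by (rule integral_distr[OF mv meas])
    also have "\<dots> = (LINT p|(lborel \<Otimes>\<^sub>M lborel). indicator B2 p *\<^sub>R \<psi> p)"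
    proof (intro Bochner_Integration.integral_cong refl)
      fix p :: "real \<times> real"
      show "?\<phi> (vec_of_complex (Complex (snd p) (fst p))) = indicator B2 p *\<^sub>R \<psi> p"
        using inB2[of "fst p" "snd p"]
        by (cases p) (simp add: \<psi>_def indicator_def inj_image_mem_iff[OF inj_vec_of_complex])
    qed
    finally show ?thesis .
  qed
  also have "\<dots> = (LINT y|lborel. LINT x|lborel. indicator B2 (y, x) *\<^sub>R \<psi> (y, x))"
    using lborel_pair.integral_fst'[OF int\<psi>] by simp
  also have "\<dots> = (LINT y|lborel. indicator {c..d} y *\<^sub>R
           (2 * (Re (H (Complex (r y) y)) - Re (H (Complex l y))) - (r y - l)))"
  proof (intro Bochner_Integration.integral_cong refl)
    fix y
    show "(LINT x|lborel. indicator B2 (y, x) *\<^sub>R \<psi> (y, x)) = indicator {c..d} y *\<^sub>R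
           (2 * (Re (H (Complex (r y) y)) - Re (H (Complex l y))) - (r y - l))"
    proof (cases "y \<in> {c..d}")
      case False
      then have "(y, x) \<notin> B2" for x by (auto simp: inB2 B)
      with False show ?thesis by simp
    next
      case True
      have inB: "Complex x y \<in> B" if "l \<le> x" "x \<le> r y" for x
        using that True by (simp add: B)
      have "(LINT x|lborel. indicator B2 (y, x) *\<^sub>R \<psi> (y, x)) = (LINT x|lborel. indicator {l..r y} x *\<^sub>R (2 * Re (D (Complex x y)) - 1))"
        
      proof (intro Bochner_Integration.integral_cong refl)
        fix x
        have "(y, x) \<in> B2 \<longleftrightarrow> x \<in> {l..r y}"
          using True by (simp add: inB2 B)
        then show "indicator B2 (y, x) *\<^sub>R \<psi> (y, x) = indicator {l..r y} x *\<^sub>R (2 * Re (D (Complex x y)) - 1)"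
          by (simp add: \<psi>_def indicator_def)
      qed
      also have "\<dots> = (2 * Re (H (Complex (r y) y)) - r y) - (2 * Re (H (Complex l y)) - l)"
      proof (rule integral_FTC_atLeastAtMost)
        show "l \<le> r y" using r True by simp
        have "continuous_on {l..r y} (\<lambda>x. D (Complex x y))"
          by (rule continuous_on_compose2[OF contD continuous_on_Complex[OF continuous_on_id continuous_on_const]])
             (use inB in auto)
        then show "continuous_on {l..r y} (\<lambda>x. 2 * Re (D (Complex x y)) - 1)"
          by (intro continuous_on_diff continuous_on_mult continuous_on_Re continuous_on_const)
        fix x assume x: "l \<le> x" "x \<le> r y"
        have "(H has_field_derivative D (Complex x y)) (at (Complex x y))"
          unfolding D_def using H B inB[OF x] by (meson holomorphic_derivI subsetD)
        then have fd: "(H has_field_derivative D (Complex x y)) (at (Complex x y) within (\<lambda>x. Complex x y) ` {l..r y})"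
          by (rule has_field_derivative_at_within)
        have "((\<lambda>x. Complex x y) has_vector_derivative 1) (at x within {l..r y})"
          unfolding Complex_eq by (auto intro!: derivative_eq_intros)
        from field_vector_diff_chain_within[OF this fd]
        have "((\<lambda>x. H (Complex x y)) has_vector_derivative D (Complex x y)) (at x within {l..r y})"
          by (simp add: o_def)
        from bounded_linear.has_vector_derivative[OF bounded_linear_Re this]
        have "((\<lambda>x. Re (H (Complex x y))) has_real_derivative Re (D (Complex x y))) (at x within {l..r y})"
          by (simp add: has_real_derivative_iff_has_vector_derivative)
        then have "((\<lambda>x. 2 * Re (H (Complex x y)) - x) has_real_derivative (2 * Re (D (Complex x y)) - 1)) (at x within {l..r y})"
          by (rule DERIV_diff[OF DERIV_cmult DERIV_ident])
        then show "((\<lambda>x. 2 * Re (H (Complex x y)) - x) has_vector_derivative (2 * Re (D (Complex x y)) - 1)) (at x within {l..r y})"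
          by (simp add: has_real_derivative_iff_has_vector_derivative)
      qed
      finally show ?thesis using True by (simp add: algebra_simps)
    qed
  qed
  finally show ?le using 1 by simp
qed

section \<open>Univalent maps of step domains\<close>

text \<open>The correction term is the real part of \<kappa>/(T + iy). Its integral over the whole
  line is pi \<kappa>, the source of the factor pi in the final inequality.\<close>

lemma integral_profile:
  fixes a b K \<kappa> T :: real
  assumes "a \<le> b" "T > 0"
  shows "(LINT y|lborel. indicator {a..b} y *\<^sub>R (K + \<kappa> * T / (y\<^sup>2 + T\<^sup>2)))
    = (b - a) * K + \<kappa> * (arctan (b / T) - arctan (a / T))"
proof -
  have pos: "y\<^sup>2 + T\<^sup>2 > 0" for y using assms(2) by (simp add: add_nonneg_pos)
  have "(LINT y|lborel. indicator {a..b} y *\<^sub>R (K + \<kappa> * T / (y\<^sup>2 + T\<^sup>2)))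
    = (K * b + \<kappa> * arctan (b / T)) - (K * a + \<kappa> * arctan (a / T))"
  proof (rule integral_FTC_atLeastAtMost[OF assms(1)])
    fix y
    have "((\<lambda>y. K * y + \<kappa> * arctan (y / T)) has_real_derivative (K + \<kappa> * (inverse (1 + (y/T)\<^sup>2) * (1 / T)))) (at y within {a..b})"
      using assms(2) by (auto intro!: derivative_eq_intros)
    moreover have "inverse (1 + (y/T)\<^sup>2) * (1 / T) = T / (y\<^sup>2 + T\<^sup>2)"
      using assms(2) pos[of y] by (simp add: field_simps power2_eq_square)
    then have "K + \<kappa> * (inverse (1 + (y/T)\<^sup>2) * (1 / T)) = K + \<kappa> * T / (y\<^sup>2 + T\<^sup>2)"
      by (simp only: times_divide_eq_right)
    ultimately show "((\<lambda>y. K * y + \<kappa> * arctan (y / T)) has_vector_derivative (K + \<kappa> * T / (y\<^sup>2 + T\<^sup>2))) (at y within {a..b})"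
      by (simp only: has_real_derivative_iff_has_vector_derivative)
  next
    show "continuous_on {a..b} (\<lambda>y. K + \<kappa> * T / (y\<^sup>2 + T\<^sup>2))"
      using pos by (intro continuous_intros) (metis less_irrefl)
  qed
  then show ?thesis by (simp add: algebra_simps)
qed

lemma vec_of_complex_mem_cbox:
  "vec_of_complex w \<in> cbox (vector [a, b]) (vector [c, d]) \<longleftrightarrow> a \<le> Re w \<and> Re w \<le> c \<and> b \<le> Im w \<and> Im w \<le> d"
  by (auto simp: mem_box_cart forall_2)

lemma measure_cbox_vec2:
  assumes "a \<le> c" "b \<le> d"
  shows "measure lebesgue (cbox (vector [a, b]) (vector [c, d] :: real^2)) = (c - a) * (d - b)"
proof -
  have "vec_of_complex (Complex a b) \<in> cbox (vector [a, b]) (vector [c, d])"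
    using assms by (simp add: vec_of_complex_mem_cbox)
  then show ?thesis
    using content_cbox_cart[of "vector [a, b]" "vector [c, d] :: real^2"]
    by (auto simp: UNIV_2)
qed

text \<open>The right-hand boundary \<open>r\<close> is chosen so that a map which is close to $w-ic_0+\kappa/w$
  for large \<open>w\<close> sends it to the vertical line $\mathrm{Re}\,w=T$ up to $o(1/T)$.\<close>

lemma step_domain_area_estimate:
  fixes T \<kappa> m \<eta> \<delta> L :: real
  assumes r_def: "r = (\<lambda>y. T - \<kappa> * T / (y\<^sup>2 + T\<^sup>2))"
  defines "B1 \<equiv> {w. Im w \<in> {\<eta>..L} \<and> \<delta> \<le> Re w \<and> Re w \<le> r (Im w)}"
    and "B2 \<equiv> {w. Im w \<in> {-L..-\<eta>} \<and> m + \<delta> \<le> Re w \<and> Re w \<le> r (Im w)}"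
  assumes H: "H holomorphic_on D" "open D" "inj_on H D"
    and par: "0 < \<eta>" "\<eta> \<le> L" "0 < T" "0 \<le> m" "0 \<le> \<delta>" "m \<le> T'" "0 \<le> L1" "0 \<le> L2"
    and r: "\<And>y. m + \<delta> \<le> r y"
    and B: "B1 \<subseteq> D" "B2 \<subseteq> D"
    and target: "\<And>w. w \<in> B1 \<union> B2 \<Longrightarrow> 0 \<le> Re (H w) \<and> Re (H w) \<le> T' \<and> - L2 \<le> Im (H w) \<and> Im (H w) \<le> L1
                   \<and> (Im (H w) \<le> 0 \<longrightarrow> m \<le> Re (H w))"
    and ends: "\<And>y. \<eta> \<le> \<bar>y\<bar> \<Longrightarrow> \<bar>y\<bar> \<le> L \<Longrightarrow> e \<le> Re (H (Complex (r y) y))"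
    and starts: "\<And>y. \<eta> \<le> y \<Longrightarrow> y \<le> L \<Longrightarrow> Re (H (Complex \<delta> y)) \<le> \<epsilon>"
      "\<And>y. \<eta> \<le> y \<Longrightarrow> y \<le> L \<Longrightarrow> Re (H (Complex (m + \<delta>) (-y))) \<le> m + \<epsilon>"
  shows "(L - \<eta>) * (4 * e - m - 4 * \<epsilon> - 2 * T) + 2 * \<kappa> * (arctan (L / T) - arctan (\<eta> / T))
           \<le> T' * L1 + (T' - m) * L2"
proof -
  have pos: "y\<^sup>2 + T\<^sup>2 > 0" for y using par by (simp add: add_nonneg_pos)
  have rc: "continuous_on S r" for S
    unfolding r_def using pos by (intro continuous_intros) (metis less_irrefl)
  have contH: "continuous_on B H" if "B \<subseteq> D" for B
    using H(1) that holomorphic_on_imp_continuous_on holomorphic_on_subset by blast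
  have lower: "(b - a) * (2 * (e - l') - T + l) + \<kappa> * (arctan (b / T) - arctan (a / T))
      \<le> measure lebesgue (vec_of_complex ` H ` {w. Im w \<in> {a..b} \<and> l \<le> Re w \<and> Re w \<le> r (Im w)})"
    and meas: "vec_of_complex ` H ` {w. Im w \<in> {a..b} \<and> l \<le> Re w \<and> Re w \<le> r (Im w)} \<in> lmeasurable"
    if ab: "a \<le> b" "\<And>y. a \<le> y \<Longrightarrow> y \<le> b \<Longrightarrow> \<eta> \<le> \<bar>y\<bar> \<and> \<bar>y\<bar> \<le> L"
      and l: "\<And>y. l \<le> r y" "\<And>y. a \<le> y \<Longrightarrow> y \<le> b \<Longrightarrow> Re (H (Complex l y)) \<le> l'"
      and sub: "{w. Im w \<in> {a..b} \<and> l \<le> Re w \<and> Re w \<le> r (Im w)} \<subseteq> D" for a b l l'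
  proof -
    let ?B = "{w. Im w \<in> {a..b} \<and> l \<le> Re w \<and> Re w \<le> r (Im w)}"
    have inj: "inj_on H ?B" using H(3) sub inj_on_subset by blast
    note A = image_area_ge[OF H(1,2) rc l(1) refl sub inj]
    show "vec_of_complex ` H ` ?B \<in> lmeasurable" by (rule A(1))
    \<comment> \<open>The width r y - l is subtracted in the area bound, so the correction in
      \<open>r\<close> enters with a positive sign.\<close>
    have "(b - a) * (2 * (e - l') - T + l) + \<kappa> * (arctan (b / T) - arctan (a / T))
       = (LINT y|lborel. indicator {a..b} y *\<^sub>R ((2 * (e - l') - T + l) + \<kappa> * T / (y\<^sup>2 + T\<^sup>2)))"
      by (rule integral_profile[OF ab(1) par(3), symmetric])
    also have "\<dots> \<le> (LINT y|lborel. indicator {a..b} y *\<^sub>R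
           (2 * (Re (H (Complex (r y) y)) - Re (H (Complex l y))) - (r y - l)))"
    proof (rule integral_mono)
      show "integrable lborel (\<lambda>y. indicator {a..b} y *\<^sub>R ((2 * (e - l') - T + l) + \<kappa> * T / (y\<^sup>2 + T\<^sup>2)))"
        using pos by (intro borel_integrable_compact continuous_intros compact_Icc) (metis less_irrefl)
      have "continuous_on {a..b} (\<lambda>y. H (Complex (r y) y))"
        by (rule continuous_on_compose2[OF contH[OF sub] continuous_on_Complex[OF rc continuous_on_id]]) (use l in auto)
      moreover have "continuous_on {a..b} (\<lambda>y. H (Complex l y))"
        by (rule continuous_on_compose2[OF contH[OF sub] continuous_on_Complex[OF continuous_on_const continuous_on_id]]) (use l in auto)
      ultimately show "integrable lborel (\<lambda>y. indicator {a..b} y *\<^sub>R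
           (2 * (Re (H (Complex (r y) y)) - Re (H (Complex l y))) - (r y - l)))"
        by (intro borel_integrable_compact continuous_on_diff continuous_on_mult continuous_on_Re continuous_on_const rc) auto
      fix y
      show "indicator {a..b} y *\<^sub>R ((2 * (e - l') - T + l) + \<kappa> * T / (y\<^sup>2 + T\<^sup>2))
         \<le> indicator {a..b} y *\<^sub>R (2 * (Re (H (Complex (r y) y)) - Re (H (Complex l y))) - (r y - l))"
      proof (cases "y \<in> {a..b}")
        case True
        then have "e \<le> Re (H (Complex (r y) y))" "Re (H (Complex l y)) \<le> l'"
          using ab(2) ends l(2) by auto
        then show ?thesis using True by (simp add: r_def)
      qed simp
    qed
    also have "\<dots> \<le> measure lebesgue (vec_of_complex ` H ` ?B)" by (rule A(2))
    finally show "(b - a) * (2 * (e - l') - T + l) + \<kappa> * (arctan (b / T) - arctan (a / T))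
      \<le> measure lebesgue (vec_of_complex ` H ` ?B)" .
  qed
  have r0: "\<delta> \<le> r y" for y using r[of y] par by linarith
  let ?V1 = "vec_of_complex ` H ` B1" and ?V2 = "vec_of_complex ` H ` B2"
  have 1: "(L - \<eta>) * (2 * (e - \<epsilon>) - T + \<delta>) + \<kappa> * (arctan (L / T) - arctan (\<eta> / T)) \<le> measure lebesgue ?V1"
    and m1: "?V1 \<in> lmeasurable"
    unfolding B1_def using par starts(1) B(1)[unfolded B1_def]
    by (intro lower meas r0; force)+
  have 2: "((-\<eta>) - (-L)) * (2 * (e - (m + \<epsilon>)) - T + (m + \<delta>)) + \<kappa> * (arctan ((-\<eta>) / T) - arctan ((-L) / T)) \<le> measure lebesgue ?V2"
    and m2: "?V2 \<in> lmeasurable"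
  proof -
    have s: "Re (H (Complex (m + \<delta>) y)) \<le> m + \<epsilon>" if "-L \<le> y" "y \<le> -\<eta>" for y
      using starts(2)[of "-y"] that by simp
    show "((-\<eta>) - (-L)) * (2 * (e - (m + \<epsilon>)) - T + (m + \<delta>)) + \<kappa> * (arctan ((-\<eta>) / T) - arctan ((-L) / T)) \<le> measure lebesgue ?V2"
      "?V2 \<in> lmeasurable"
      unfolding B2_def using par s B(2)[unfolded B2_def]
      by (intro lower meas r; force)+
  qed
  \<comment> \<open>Injectivity across both pieces lets the two image areas be added.\<close>
  have disj: "?V1 \<inter> ?V2 = {}"
  proof -
    have "B1 \<inter> B2 = {}" using par by (auto simp: B1_def B2_def)
    then have "H ` B1 \<inter> H ` B2 = {}" using inj_on_image_Int[OF H(3) B] by simp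
    then show ?thesis by (simp add: image_Int[OF inj_vec_of_complex, symmetric])
  qed
  \<comment> \<open>The lower box begins at \<open>m\<close>: below the real axis the image cannot
    enter the region left of the step.\<close>
  let ?C1 = "cbox (vector [0, 0]) (vector [T', L1] :: real^2)" and ?C2 = "cbox (vector [m, -L2]) (vector [T', 0] :: real^2)"
  have "measure lebesgue ?V1 + measure lebesgue ?V2 = measure lebesgue (?V1 \<union> ?V2)"
    using measure_Un3[OF m1 m2] disj by simp
  also have "\<dots> \<le> measure lebesgue (?C1 \<union> ?C2)"
  proof (rule measure_mono_fmeasurable)
    show "?V1 \<union> ?V2 \<subseteq> ?C1 \<union> ?C2"
    proof
      fix v assume "v \<in> ?V1 \<union> ?V2"
      then obtain w where w: "w \<in> B1 \<union> B2" "v = vec_of_complex (H w)" by blast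
      then show "v \<in> ?C1 \<union> ?C2"
        using target[OF w(1)] by (auto simp: vec_of_complex_mem_cbox)
    qed
    show "?V1 \<union> ?V2 \<in> sets lebesgue" using m1 m2 by (auto intro: fmeasurableD)
    show "?C1 \<union> ?C2 \<in> lmeasurable" by (auto intro!: fmeasurable.Un)
  qed
  also have "\<dots> \<le> measure lebesgue ?C1 + measure lebesgue ?C2"
    by (rule measure_Un_le) auto
  also have "\<dots> = T' * L1 + (T' - m) * L2"
  proof -
    have "0 \<le> T'" "- L2 \<le> 0" using par by linarith+
    from measure_cbox_vec2[OF this(1) par(7)] measure_cbox_vec2[OF par(6) this(2)]
    show ?thesis by simp
  qed
  finally have 3: "measure lebesgue ?V1 + measure lebesgue ?V2 \<le> T' * L1 + (T' - m) * L2" .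
  \<comment> \<open>Starting \<delta> to the right of the edges only increases the lower bound, so
    \<delta> disappears from the conclusion.\<close>
  have "0 \<le> (L - \<eta>) * \<delta>" using par by simp
  moreover have "arctan (-\<eta> / T) = - arctan (\<eta> / T)" "arctan (-L / T) = - arctan (L / T)"
    by (simp_all add: arctan_minus)
  ultimately show ?thesis using 1 2 3 by (simp add: algebra_simps)
qed

text \<open>Turns pointwise limits along a vertical edge into one distance that works for a whole
  compact segment of it. Disjointness of \<open>A\<close> and \<open>D\<close> makes the puncture in
  \<open>at a within D\<close> harmless.\<close>

lemma compact_eventually_within_uniform:
  fixes A D :: "'a::metric_space set"
  assumes "compact A" "A \<inter> D = {}" "\<And>a. a \<in> A \<Longrightarrow> eventually P (at a within D)"
  obtains e where "e > 0" "\<And>a w. a \<in> A \<Longrightarrow> w \<in> D \<Longrightarrow> dist a w < e \<Longrightarrow> P w"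
proof -
  have "\<forall>a\<in>A. \<exists>d>0. \<forall>w\<in>D. dist a w < d \<longrightarrow> P w"
  proof
    fix a assume a: "a \<in> A"
    then obtain d where d: "d > 0" "\<forall>w\<in>D. w \<noteq> a \<and> dist w a < d \<longrightarrow> P w"
      using assms(3)[OF a] unfolding eventually_at by auto
    have "w \<noteq> a" if "w \<in> D" for w using assms(2) a that by auto
    with d show "\<exists>d>0. \<forall>w\<in>D. dist a w < d \<longrightarrow> P w" by (auto simp: dist_commute)
  qed
  from bchoice[OF this] obtain d where d: "\<forall>a\<in>A. d a > 0 \<and> (\<forall>w\<in>D. dist a w < d a \<longrightarrow> P w)" ..
  have "A \<subseteq> (\<Union>a\<in>A. ball a (d a))"
  proof
    fix a assume "a \<in> A"
    then show "a \<in> (\<Union>a\<in>A. ball a (d a))" using d by (intro UN_I[of a]) auto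
  qed
  moreover have "open (\<Union>a\<in>A. ball a (d a))" by blast
  ultimately obtain e where e: "e > 0" "(\<Union>a\<in>A. ball a e) \<subseteq> (\<Union>a\<in>A. ball a (d a))"
    using compact_subset_open_imp_ball_epsilon_subset[OF assms(1), of "\<Union>a\<in>A. ball a (d a)"] by auto
  show ?thesis
  proof (rule that[OF e(1)])
    fix a w assume *: "a \<in> A" "w \<in> D" "dist a w < e"
    then have "w \<in> (\<Union>a\<in>A. ball a e)" by auto
    then have "w \<in> (\<Union>a\<in>A. ball a (d a))" using e(2) by (rule subsetD[rotated])
    then obtain a' where "a' \<in> A" "dist a' w < d a'" by auto
    then show "P w" using d *(2) by blast
  qed
qed

text \<open>The real ray that joins the two quadrants is left out: for b < 2 the image of the
  half-strip contains only its far part, the rest being covered by the folded base. The set is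
  therefore disconnected.\<close>

definition step_domain :: "real \<Rightarrow> complex set" where
  "step_domain m = {w. 0 < Re w \<and> 0 < Im w} \<union> {w. m < Re w \<and> Im w < 0}"

lemma open_step_domain: "open (step_domain m)"
  unfolding step_domain_def
  by (intro open_Un open_Collect_conj open_Collect_less continuous_intros)

lemma Re_inverse_diff_le:
  assumes "w \<noteq> 0" "w' \<noteq> 0"
  shows "\<bar>Re (1 / w) - Re (1 / w')\<bar> \<le> cmod (w - w') / (cmod w * cmod w')"
proof -
  have "1 / w - 1 / w' = (w' - w) / (w * w')" using assms by (simp add: field_simps)
  then have "cmod (1 / w - 1 / w') = cmod (w - w') / (cmod w * cmod w')"
    by (simp add: norm_divide norm_mult norm_minus_commute)
  then show ?thesis using abs_Re_le_cmod[of "1 / w - 1 / w'"] by simp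
qed

text \<open>\<open>K\<close> is the aspect ratio L/T of the test rectangle. For fixed
  \<open>K\<close> a large \<open>T\<close> pushes all errors down to a constant multiple of 1/K,
  while the main term stays at 2 c1 arctan K.\<close>

lemma step_domain_inequality_finite:
  fixes m c0 c1 K :: real and H :: "complex \<Rightarrow> complex"
  assumes H: "H holomorphic_on step_domain m" "inj_on H (step_domain m)" and m: "0 \<le> m" and K: "1 \<le> K"
    and image: "\<And>w. w \<in> step_domain m \<Longrightarrow> 0 < Re (H w)"
      "\<And>w. w \<in> step_domain m \<Longrightarrow> Im (H w) \<le> 0 \<Longrightarrow> m < Re (H w)"
    and asym: "\<And>e. e > 0 \<Longrightarrow> \<exists>R. \<forall>w\<in>step_domain m. R \<le> cmod w \<longrightarrow> cmod (w * (H w - w + \<i> * c0) - c1) \<le> e"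
    and bdd: "\<And>R. \<exists>R'. \<forall>w\<in>step_domain m. cmod w < R \<longrightarrow> cmod (H w) \<le> R'"
    and start1: "\<And>y e. y > 0 \<Longrightarrow> e > 0 \<Longrightarrow> eventually (\<lambda>w. Re (H w) < e) (at (Complex 0 y) within step_domain m)"
    and start2: "\<And>y e. y < 0 \<Longrightarrow> e > 0 \<Longrightarrow> eventually (\<lambda>w. Re (H w) < m + e) (at (Complex m y) within step_domain m)"
  shows "2 * c1 * arctan K \<le> (18 + 16 * (\<bar>c1\<bar> + 1)) / K - m * c0"
proof -
  define C where "C = \<bar>c1\<bar> + 1"
  \<comment> \<open>An error of order \<epsilon>/T along a vertical side of length L = K T costs
    area of order K \<epsilon>, which is 1/K for this choice.\<close>
  define \<epsilon> where "\<epsilon> = 1 / K\<^sup>2"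
  have C: "1 \<le> C" "\<bar>c1\<bar> \<le> C" by (simp_all add: C_def)
  have \<epsilon>: "0 < \<epsilon>" "\<epsilon> \<le> 1" using K by (auto simp: \<epsilon>_def)
  let ?D = "step_domain m"
  obtain R0 where R0: "\<And>w. w \<in> ?D \<Longrightarrow> R0 \<le> cmod w \<Longrightarrow> cmod (w * (H w - w + \<i> * c0) - c1) \<le> \<epsilon>"
    using asym[OF \<epsilon>(1)] by blast
  define R where "R = max 1 R0"
  obtain R' where R': "\<And>w. w \<in> ?D \<Longrightarrow> cmod w < R \<Longrightarrow> cmod (H w) \<le> R'"
    using bdd[of R] by blast
  have approx: "cmod (H w - (w - \<i> * c0 + c1 / w)) \<le> \<epsilon> / cmod w" if "w \<in> ?D" "R \<le> cmod w" for w :: complex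
  proof -
    have w0: "w \<noteq> 0" using that by (auto simp: R_def)
    then have "H w - (w - \<i> * c0 + c1 / w) = (w * (H w - w + \<i> * c0) - c1) / w"
      by (simp add: field_simps)
    then show ?thesis
      using R0[OF that(1)] that(2) w0 by (simp add: norm_divide R_def divide_right_mono)
  qed
  have approx': "cmod (H w - (w - \<i> * c0)) \<le> C / cmod w" if "w \<in> ?D" "R \<le> cmod w" for w :: complex
  proof -
    have "cmod (H w - (w - \<i> * c0)) \<le> cmod (H w - (w - \<i> * c0 + c1 / w)) + cmod (c1 / w)"
      using norm_triangle_ineq[of "H w - (w - \<i> * c0 + c1 / w)" "c1 / w"] by (simp add: algebra_simps)
    also have "\<dots> \<le> \<epsilon> / cmod w + \<bar>c1\<bar> / cmod w"
      using approx[OF that] by (simp add: norm_divide)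
    also have "\<dots> \<le> C / cmod w"
      unfolding C_def add_divide_distrib[symmetric] using \<epsilon> by (intro divide_right_mono) auto
    finally show ?thesis .
  qed
  \<comment> \<open>\<open>T\<close> exceeds every threshold needed below: \<open>R'\<close> bounds
    \<open>H\<close> near the origin, so that part cannot reach the right side, and the last summand
    serves \<open>end_approx\<close>.\<close>
  define T where "T = 4 + 4 * m + 2 * R + \<bar>R'\<bar> + 4 * C + 4 * \<bar>c0\<bar> + 2 * C\<^sup>2 / \<epsilon>"
  have R1: "1 \<le> R" by (simp add: R_def)
  have C2\<epsilon>: "0 \<le> 2 * C\<^sup>2 / \<epsilon>" using \<epsilon> by simp
  have T: "4 \<le> T" "4 * m + 4 \<le> T" "2 * R \<le> T" "R' + \<bar>c0\<bar> \<le> T" "4 * C \<le> T" "2 * C\<^sup>2 / \<epsilon> \<le> T" "R' \<le> T" "4 * \<bar>c0\<bar> + 2 * C \<le> T"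
    unfolding T_def using m R1 C C2\<epsilon> abs_ge_self[of R'] abs_ge_zero[of R'] abs_ge_zero[of c0] by (simp_all add: algebra_simps)
  define L where "L = K * T"
  have LT: "T \<le> L" using K T(1) by (simp add: L_def)
  define r where "r = (\<lambda>y. T - c1 * T / (y\<^sup>2 + T\<^sup>2))"
  have Tpos: "0 < T" using T by simp
  have r_eq: "r y = T - c1 * Re (1 / Complex T y)" for y
    by (simp add: r_def Re_divide add.commute)
  have rT: "\<bar>r y - T\<bar> \<le> C / T" for y
  proof -
    have "\<bar>Re (1 / Complex T y)\<bar> \<le> cmod (1 / Complex T y)" by (rule abs_Re_le_cmod)
    also have "\<dots> = 1 / cmod (Complex T y)" by (simp add: norm_divide)
    also have "\<dots> \<le> 1 / T" using abs_Re_le_cmod[of "Complex T y"] Tpos by (intro frac_le) auto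
    finally have "\<bar>c1\<bar> * \<bar>Re (1 / Complex T y)\<bar> \<le> C * (1 / T)" using C by (intro mult_mono) auto
    then show ?thesis by (simp add: r_eq abs_mult)
  qed
  have CT: "C / T \<le> 1 / 4" using T Tpos by (simp add: divide_simps)
  have r_ge: "T / 2 \<le> r y" "m + 1 \<le> r y" for y
  proof -
    show "T / 2 \<le> r y" using rT[of y] CT T(1) by linarith
    then show "m + 1 \<le> r y" using T(2) m by linarith
  qed
  \<comment> \<open>\<open>r\<close> is defined with Re(1/(T + iy)). Passing to Re(1/(r y + iy))
    costs at most 2 C^2/T^3, which T >= 2 C^2/\<epsilon> makes at most \<epsilon>/T.\<close>
  have end_approx: "\<bar>r y + c1 * Re (1 / Complex (r y) y) - T\<bar> \<le> \<epsilon> / T" for y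
  proof -
    have n1: "T / 2 \<le> cmod (Complex (r y) y)" using abs_Re_le_cmod[of "Complex (r y) y"] r_ge[of y] by simp
    have n2: "T \<le> cmod (Complex T y)" using abs_Re_le_cmod[of "Complex T y"] by simp
    have nz: "Complex (r y) y \<noteq> 0" "Complex T y \<noteq> 0" using n1 n2 Tpos by (auto simp del: complex_norm)
    have "cmod (Complex (r y) y - Complex T y) = \<bar>r y - T\<bar>"
      by (simp add: complex_diff complex_norm)
    then have "\<bar>Re (1 / Complex (r y) y) - Re (1 / Complex T y)\<bar>
       \<le> \<bar>r y - T\<bar> / (cmod (Complex (r y) y) * cmod (Complex T y))"
      using Re_inverse_diff_le[OF nz] by simp
    also have "\<dots> \<le> (C / T) / ((T / 2) * T)"
      using rT[of y] n1 n2 Tpos by (intro frac_le mult_mono) auto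
    also have "\<dots> = 2 * C / T ^ 3" using Tpos by (simp add: field_simps power3_eq_cube)
    finally have "\<bar>c1\<bar> * \<bar>Re (1 / Complex (r y) y) - Re (1 / Complex T y)\<bar> \<le> C * (2 * C / T ^ 3)"
      using C by (intro mult_mono) auto
    also have "\<dots> = (2 * C\<^sup>2 / T\<^sup>2) / T" by (simp add: power2_eq_square power3_eq_cube)
    also have "\<dots> \<le> \<epsilon> / T"
    proof (rule divide_right_mono)
      have "2 * C\<^sup>2 \<le> \<epsilon> * T" using T(6) \<epsilon> by (simp add: field_simps)
      also have "\<dots> \<le> \<epsilon> * T\<^sup>2" using T(1) \<epsilon> by (simp add: power2_eq_square)
      finally show "2 * C\<^sup>2 / T\<^sup>2 \<le> \<epsilon>" using Tpos by (simp add: divide_simps)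
    qed (use Tpos in simp)
    finally have "\<bar>c1 * (Re (1 / Complex (r y) y) - Re (1 / Complex T y))\<bar> \<le> \<epsilon> / T" by (simp add: abs_mult)
    then show ?thesis by (simp add: r_eq[of y] algebra_simps)
  qed
  have scale: "\<epsilon> / cmod w \<le> 2 * \<epsilon> / T" if "T / 2 \<le> cmod w" for w
    using that Tpos \<epsilon> frac_le[of \<epsilon> \<epsilon> "T/2" "cmod w"] by (simp add: mult.commute)
  have ReH: "\<bar>Re (H w) - (Re w + c1 * Re (1 / w))\<bar> \<le> 2 * \<epsilon> / T" if "w \<in> ?D" "T / 2 \<le> cmod w" for w
  proof -
    have "\<bar>Re (H w - (w - \<i> * c0 + c1 / w))\<bar> \<le> \<epsilon> / cmod w"
      by (rule order_trans[OF abs_Re_le_cmod approx[OF that(1)]]) (use that(2) T in linarith)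
    moreover have "Re (H w - (w - \<i> * c0 + c1 / w)) = Re (H w) - (Re w + c1 * Re (1 / w))"
      by (simp add: Re_divide)
    ultimately show ?thesis using scale[OF that(2)] by linarith
  qed
  have n_r: "T / 2 \<le> cmod (Complex (r y) y)" for y
    using abs_Re_le_cmod[of "Complex (r y) y"] r_ge[of y] by simp
  have ends: "T - 3 * \<epsilon> / T \<le> Re (H (Complex (r y) y))" if "y \<noteq> 0" for y
  proof -
    have "Complex (r y) y \<in> ?D" using that r_ge(2)[of y] m by (auto simp: step_domain_def)
    from ReH[OF this n_r] end_approx[of y] show ?thesis by (simp add: add_divide_distrib[symmetric] abs_le_iff)
  qed
  have Re_le: "Re (H w) \<le> T + 3 * \<epsilon> / T" if w: "w \<in> ?D" "Re w \<le> r (Im w)" for w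
  proof -
    have \<epsilon>T: "0 \<le> 3 * \<epsilon> / T" using \<epsilon> Tpos by simp
    \<comment> \<open>Near the origin \<open>R'\<close> is a sufficient bound, and at moderate
      distance Re w < T/2 leaves room for the crude error \<open>C\<close>. Far out, x + c1 Re(1/(x
      + iy)) increases along the horizontal chord because 4C/T^2 <= 1, so its right endpoint
      decides.\<close>
    consider "cmod w < R" | "R \<le> cmod w" "cmod w < T / 2" | "T / 2 \<le> cmod w" by linarith
    then show ?thesis
    proof cases
      case 1
      then show ?thesis using R'[OF w(1)] complex_Re_le_cmod[of "H w"] T \<epsilon>T by linarith
    next
      case 2
      have "Re (H w) - Re w \<le> cmod (H w - (w - \<i> * c0))"
        using complex_Re_le_cmod[of "H w - (w - \<i> * c0)"] by simp
      also have "\<dots> \<le> C / cmod w" by (rule approx'[OF w(1) 2(1)])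
      also have "\<dots> \<le> C" using C 2 R1 by (simp add: divide_simps)
      finally show ?thesis using 2 T complex_Re_le_cmod[of w] \<epsilon>T by linarith
    next
      case 3
      let ?wr = "Complex (r (Im w)) (Im w)"
      have nz: "w \<noteq> 0" "?wr \<noteq> 0" using 3 n_r[of "Im w"] Tpos by (auto simp del: complex_norm)
      have "w - ?wr = complex_of_real (Re w - r (Im w))" by (simp add: complex_eq_iff)
      then have "cmod (w - ?wr) = r (Im w) - Re w" using w(2) by (simp only: norm_of_real)
      then have "\<bar>Re (1 / w) - Re (1 / ?wr)\<bar> \<le> (r (Im w) - Re w) / (cmod w * cmod ?wr)"
        using Re_inverse_diff_le[OF nz] by simp
      also have "\<dots> \<le> (r (Im w) - Re w) / ((T / 2) * (T / 2))"
        using 3 n_r[of "Im w"] Tpos w(2) by (intro divide_left_mono mult_mono) (auto simp del: complex_norm intro!: mult_pos_pos simp: nz)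
      finally have "\<bar>c1\<bar> * \<bar>Re (1 / w) - Re (1 / ?wr)\<bar> \<le> C * ((r (Im w) - Re w) / ((T / 2) * (T / 2)))"
        using C by (intro mult_mono) auto
      also have "\<dots> = (r (Im w) - Re w) * (4 * C / T\<^sup>2)" by (simp add: power2_eq_square)
      also have "\<dots> \<le> (r (Im w) - Re w) * 1"
      proof (rule mult_left_mono)
        have "4 * C \<le> T * 1" using T by simp
        also have "\<dots> \<le> T * T" using T by (intro mult_left_mono) auto
        finally show "4 * C / T\<^sup>2 \<le> 1" using Tpos by (simp add: divide_simps power2_eq_square)
      qed (use w in simp)
      finally have "c1 * Re (1 / w) - c1 * Re (1 / ?wr) \<le> r (Im w) - Re w"
        by (simp add: abs_mult[symmetric] right_diff_distrib)
      moreover have "Re (H w) \<le> Re w + c1 * Re (1 / w) + 2 * \<epsilon> / T" using ReH[OF w(1) 3] by linarith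
      moreover have "r (Im w) + c1 * Re (1 / ?wr) \<le> T + \<epsilon> / T" using end_approx[of "Im w"] by linarith
      ultimately have "Re (H w) \<le> T + \<epsilon> / T + 2 * \<epsilon> / T" by linarith
      then show ?thesis by (simp add: add_divide_distrib[symmetric])
    qed
  qed
  have Im_le: "Im (H w) \<le> L - c0 + 2 * C / L \<and> - (L + c0 + 2 * C / L) \<le> Im (H w)" if w: "w \<in> ?D" "\<bar>Im w\<bar> \<le> L" for w
  proof -
    have CL: "0 \<le> 2 * C / L" using C LT Tpos by simp
    consider "cmod w < R" | "R \<le> cmod w" "cmod w < L / 2" | "R \<le> cmod w" "L / 2 \<le> cmod w" by linarith
    then show ?thesis
    proof cases
      case 1
      then show ?thesis using R'[OF w(1)] abs_Im_le_cmod[of "H w"] T LT CL by linarith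
    next
      case 2
      have "\<bar>Im (H w) - (Im w - c0)\<bar> \<le> cmod (H w - (w - \<i> * c0))"
        using abs_Im_le_cmod[of "H w - (w - \<i> * c0)"] by simp
      also have "\<dots> \<le> C / cmod w" by (rule approx'[OF w(1) 2(1)])
      also have "\<dots> \<le> C" using C 2 R1 by (simp add: divide_simps)
      finally show ?thesis using 2 T LT abs_Im_le_cmod[of w] CL by linarith
    next
      case 3
      have "\<bar>Im (H w) - (Im w - c0)\<bar> \<le> cmod (H w - (w - \<i> * c0))"
        using abs_Im_le_cmod[of "H w - (w - \<i> * c0)"] by simp
      also have "\<dots> \<le> C / cmod w" by (rule approx'[OF w(1) 3(1)])
      also have "\<dots> \<le> C / (L / 2)" using C 3 LT Tpos R1 by (intro frac_le) auto
      also have "\<dots> = 2 * C / L" by simp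
      finally show ?thesis using w(2) by linarith
    qed
  qed
  define T' L1 L2 e where "T' = T + 3 * \<epsilon> / T" and "L1 = L - c0 + 2 * C / L" and "L2 = L + c0 + 2 * C / L"
    and "e = T - 3 * \<epsilon> / T"
  have \<epsilon>T: "0 \<le> 3 * \<epsilon> / T" using \<epsilon> Tpos by simp
  have CL: "0 \<le> 2 * C / L" using C LT Tpos by simp
  have est: "(L - \<eta>) * (4 * e - m - 4 * \<epsilon>' - 2 * T) + 2 * c1 * (arctan (L / T) - arctan (\<eta> / T)) \<le> T' * L1 + (T' - m) * L2"
    if \<eta>: "0 < \<eta>" "\<eta> \<le> L" and \<epsilon>': "0 < \<epsilon>'" for \<eta> \<epsilon>'
  proof -
    have "compact (Complex 0 ` {\<eta>..L})" "compact (Complex m ` {-L..-\<eta>})"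
      by (intro compact_continuous_image continuous_on_Complex continuous_intros compact_Icc)+
    then obtain d1 d2 where d1: "d1 > 0" "\<And>y w. y \<in> {\<eta>..L} \<Longrightarrow> w \<in> ?D \<Longrightarrow> dist (Complex 0 y) w < d1 \<Longrightarrow> Re (H w) < \<epsilon>'"
      and d2: "d2 > 0" "\<And>y w. y \<in> {-L..-\<eta>} \<Longrightarrow> w \<in> ?D \<Longrightarrow> dist (Complex m y) w < d2 \<Longrightarrow> Re (H w) < m + \<epsilon>'"
    proof -
      assume cc: "compact (Complex 0 ` {\<eta>..L})" "compact (Complex m ` {-L..-\<eta>})"
      obtain d1 where d1: "d1 > 0" "\<And>a w. a \<in> Complex 0 ` {\<eta>..L} \<Longrightarrow> w \<in> ?D \<Longrightarrow> dist a w < d1 \<Longrightarrow> Re (H w) < \<epsilon>'"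
        by (rule compact_eventually_within_uniform[OF cc(1), of ?D "\<lambda>w. Re (H w) < \<epsilon>'"])
           (use \<eta> \<epsilon>' start1 in \<open>auto simp: step_domain_def\<close>)
      obtain d2 where d2: "d2 > 0" "\<And>a w. a \<in> Complex m ` {-L..-\<eta>} \<Longrightarrow> w \<in> ?D \<Longrightarrow> dist a w < d2 \<Longrightarrow> Re (H w) < m + \<epsilon>'"
        by (rule compact_eventually_within_uniform[OF cc(2), of ?D "\<lambda>w. Re (H w) < m + \<epsilon>'"])
           (use \<eta> \<epsilon>' start2 in \<open>auto simp: step_domain_def\<close>)
      show thesis using that[of d1 d2, OF d1(1) d1(2)[OF imageI] d2(1) d2(2)[OF imageI]] .
    qed
    \<comment> \<open>The bound 1 keeps m + \<delta> to the left of the right boundary, which lies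
      beyond m + 1.\<close>
    define \<delta> where "\<delta> = min 1 (min d1 d2 / 2)"
    have \<delta>: "0 < \<delta>" "\<delta> \<le> 1" "\<delta> < d1" "\<delta> < d2" using d1(1) d2(1) by (auto simp: \<delta>_def min_def)
    have dist: "dist (Complex a y) (Complex (a + \<delta>) y) = \<delta>" for a y
    proof -
      have "Complex a y - Complex (a + \<delta>) y = - complex_of_real \<delta>" by (simp add: complex_eq_iff)
      then show ?thesis using \<delta> by (simp add: dist_norm)
    qed
    have B: "{w. Im w \<in> {\<eta>..L} \<and> \<delta> \<le> Re w \<and> Re w \<le> r (Im w)} \<subseteq> ?D"
      "{w. Im w \<in> {-L..-\<eta>} \<and> m + \<delta> \<le> Re w \<and> Re w \<le> r (Im w)} \<subseteq> ?D"
      using \<eta> \<delta> by (auto simp: step_domain_def)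
    show ?thesis
    proof (rule step_domain_area_estimate[OF r_def H(1) open_step_domain H(2), where \<delta> = \<delta> and m = m and \<eta> = \<eta>
          and L = L and T' = T' and ?L1.0 = L1 and ?L2.0 = L2 and e = e and \<epsilon> = \<epsilon>'])
      show "0 < \<eta>" "\<eta> \<le> L" "0 < T" "0 \<le> m" "0 \<le> \<delta>" using \<eta> Tpos m \<delta> by auto
      show "m \<le> T'" "0 \<le> L1" "0 \<le> L2" using T \<epsilon>T CL LT C by (auto simp: T'_def L1_def L2_def)
      show "m + \<delta> \<le> r y" for y using r_ge(2)[of y] \<delta> by linarith
      show "e \<le> Re (H (Complex (r y) y))" if "\<eta> \<le> \<bar>y\<bar>" "\<bar>y\<bar> \<le> L" for y
        using ends[of y] that \<eta> by (auto simp: e_def)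
      show "Re (H (Complex \<delta> y)) \<le> \<epsilon>'" if "\<eta> \<le> y" "y \<le> L" for y
        using d1(2)[of y "Complex \<delta> y"] dist[of 0 y] that \<eta> \<delta> by (auto simp: step_domain_def)
      show "Re (H (Complex (m + \<delta>) (-y))) \<le> m + \<epsilon>'" if "\<eta> \<le> y" "y \<le> L" for y
        using d2(2)[of "-y" "Complex (m + \<delta>) (-y)"] dist[of m "-y"] that \<eta> \<delta> by (auto simp: step_domain_def)
      fix w assume "w \<in> {w. Im w \<in> {\<eta>..L} \<and> \<delta> \<le> Re w \<and> Re w \<le> r (Im w)} \<union> {w. Im w \<in> {-L..-\<eta>} \<and> m + \<delta> \<le> Re w \<and> Re w \<le> r (Im w)}"
      then have w: "w \<in> ?D" "Re w \<le> r (Im w)" "\<bar>Im w\<bar> \<le> L" using B \<eta> by auto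
      then show "0 \<le> Re (H w) \<and> Re (H w) \<le> T' \<and> - L2 \<le> Im (H w) \<and> Im (H w) \<le> L1 \<and> (Im (H w) \<le> 0 \<longrightarrow> m \<le> Re (H w))"
        using Re_le[OF w(1,2)] Im_le[OF w(1,3)] image(1,2)[OF w(1)] unfolding T'_def L1_def L2_def
        by (auto intro: less_imp_le)
    qed (use B in auto)
  qed
  \<comment> \<open>Both \<eta> and \<epsilon>' are set to the same x, which tends to 0 from the
    right.\<close>
  have lim: "L * (4 * e - m - 2 * T) + 2 * c1 * arctan (L / T) \<le> T' * L1 + (T' - m) * L2"
  proof (rule tendsto_upperbound[of "\<lambda>x. (L - x) * (4 * e - m - 4 * x - 2 * T) + 2 * c1 * (arctan (L / T) - arctan (x / T))"])
    have "((\<lambda>x. (L - x) * (4 * e - m - 4 * x - 2 * T) + 2 * c1 * (arctan (L / T) - arctan (x / T))) \<longlongrightarrow>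
       (L - 0) * (4 * e - m - 4 * 0 - 2 * T) + 2 * c1 * (arctan (L / T) - arctan (0 / T))) (at_right 0)"
      using Tpos by (intro tendsto_intros) auto
    then show "((\<lambda>x. (L - x) * (4 * e - m - 4 * x - 2 * T) + 2 * c1 * (arctan (L / T) - arctan (x / T))) \<longlongrightarrow>
      L * (4 * e - m - 2 * T) + 2 * c1 * arctan (L / T)) (at_right 0)" by simp
    show "\<forall>\<^sub>F x in at_right 0. (L - x) * (4 * e - m - 4 * x - 2 * T) + 2 * c1 * (arctan (L / T) - arctan (x / T))
           \<le> T' * L1 + (T' - m) * L2"
      unfolding eventually_at_right_field using est LT Tpos by (intro exI[of _ L]) auto
  qed simp
  have "L / T = K" using Tpos by (simp add: L_def)
  define u where "u = \<epsilon> / T"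
  have Lu: "L * u = 1 / K" using Tpos K by (simp add: L_def u_def \<epsilon>_def power2_eq_square)
  define v where "v = C / L"
  have Tv: "T * v = C / K" using Tpos K by (simp add: L_def v_def)
  have uv: "u * v \<le> C / K"
  proof -
    have "u \<le> 1" using \<epsilon> T(1) by (simp add: u_def divide_le_eq)
    then have "u \<le> T" using T(1) by linarith
    then have "u * v \<le> T * v" using CL by (intro mult_right_mono) (auto simp: v_def)
    then show ?thesis using Tv by simp
  qed
  have E: "4 * e - m - 2 * T = 2 * T - 12 * u - m" "T' = T + 3 * u" "L1 = L - c0 + 2 * v" "L2 = L + c0 + 2 * v"
    by (simp_all add: e_def u_def T'_def L1_def L2_def v_def)
  have "L * (2 * T - 12 * u - m) + 2 * c1 * arctan K \<le> (T + 3 * u) * (L - c0 + 2 * v) + (T + 3 * u - m) * (L + c0 + 2 * v)"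
    using lim unfolding E \<open>L / T = K\<close> .
  \<comment> \<open>In the expansion the products of c0 with the full width cancel between the two
    halves; only -m c0 survives.\<close>
  then have "2 * c1 * arctan K \<le> 18 * (L * u) + 4 * (T * v) + 12 * (u * v) - m * c0 - 2 * (m * v)"
    by (simp add: algebra_simps)
  moreover have "0 \<le> m * v" using m C LT Tpos by (simp add: v_def)
  ultimately have "2 * c1 * arctan K \<le> 18 * (1 / K) + 4 * (C / K) + 12 * (C / K) - m * c0"
    using uv unfolding Lu Tv by linarith
  then show ?thesis by (simp add: C_def add_divide_distrib algebra_simps)
qed

text \<open>Let the aspect ratio grow: arctan K tends to pi/2 and the error to 0.\<close>

lemma step_domain_inequality:
  fixes m c0 c1 :: real and H :: "complex \<Rightarrow> complex"
  assumes H: "H holomorphic_on step_domain m" "inj_on H (step_domain m)" and m: "0 \<le> m"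
    and image: "\<And>w. w \<in> step_domain m \<Longrightarrow> 0 < Re (H w)"
      "\<And>w. w \<in> step_domain m \<Longrightarrow> Im (H w) \<le> 0 \<Longrightarrow> m < Re (H w)"
    and asym: "\<And>e. e > 0 \<Longrightarrow> \<exists>R. \<forall>w\<in>step_domain m. R \<le> cmod w \<longrightarrow> cmod (w * (H w - w + \<i> * c0) - c1) \<le> e"
    and bdd: "\<And>R. \<exists>R'. \<forall>w\<in>step_domain m. cmod w < R \<longrightarrow> cmod (H w) \<le> R'"
    and start1: "\<And>y e. y > 0 \<Longrightarrow> e > 0 \<Longrightarrow> eventually (\<lambda>w. Re (H w) < e) (at (Complex 0 y) within step_domain m)"
    and start2: "\<And>y e. y < 0 \<Longrightarrow> e > 0 \<Longrightarrow> eventually (\<lambda>w. Re (H w) < m + e) (at (Complex m y) within step_domain m)"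
  shows "pi * c1 \<le> - m * c0"
proof -
  have "2 * c1 * (pi / 2) \<le> 0 - m * c0"
  proof (rule tendsto_le[of at_top])
    show "((\<lambda>K. 2 * c1 * arctan K) \<longlongrightarrow> 2 * c1 * (pi / 2)) at_top"
      by (intro tendsto_intros tendsto_arctan_at_top)
    have "((\<lambda>K. (18 + 16 * (\<bar>c1\<bar> + 1)) / K) \<longlongrightarrow> 0) at_top"
      by (rule tendsto_divide_0[OF tendsto_const filterlim_at_top_imp_at_infinity[OF filterlim_ident]])
    then show "((\<lambda>K. (18 + 16 * (\<bar>c1\<bar> + 1)) / K - m * c0) \<longlongrightarrow> 0 - m * c0) at_top"
      by (intro tendsto_intros)
    show "\<forall>\<^sub>F K in at_top. 2 * c1 * arctan K \<le> (18 + 16 * (\<bar>c1\<bar> + 1)) / K - m * c0"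
      using eventually_ge_at_top[of "1::real"]
      by eventually_elim (rule step_domain_inequality_finite[OF H m _ image asym bdd start1 start2])
  qed simp
  then show ?thesis by (simp add: algebra_simps)
qed

section \<open>The natural parameter on the half-strip\<close>

lemma proper_map_image_closed:
  fixes h :: "'a::heine_borel \<Rightarrow> 'b::metric_space"
  assumes K: "closed K" "continuous_on K h" and proper: "\<And>y r. bounded {q\<in>K. dist (h q) y \<le> r}"
  shows "closed (h ` K)"
proof -
  have "y \<in> h ` K" if y: "y \<in> closure (h ` K)" for y
  proof -
    define C where "C = {q\<in>K. dist (h q) y \<le> 1}"
    have "closed C"
    proof -
      have "C = K \<inter> h -` cball y 1" by (auto simp: C_def dist_commute)
      then show ?thesis using continuous_closed_preimage[OF K(2,1) closed_cball] by simp
    qed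
    then have "compact C" using proper[of y 1] by (simp add: C_def compact_eq_bounded_closed)
    moreover have "continuous_on C h" by (rule continuous_on_subset[OF K(2)]) (auto simp: C_def)
    ultimately have "compact (h ` C)" by (intro compact_continuous_image)
    then have cl: "closed (h ` C)" by (rule compact_imp_closed)
    have "y \<in> closure (h ` C)"
      unfolding closure_approachable
    proof (intro allI impI)
      fix e :: real assume "e > 0"
      then obtain x where "x \<in> h ` K" "dist x y < min e 1"
        using y unfolding closure_approachable by (metis min_less_iff_conj zero_less_one)
      then show "\<exists>x\<in>h ` C. dist x y < e" by (auto simp: C_def)
    qed
    with cl have "y \<in> h ` C" by simp
    then show ?thesis by (auto simp: C_def)
  qed
  then show ?thesis by (metis closure_subset_eq subsetI)
qed

text \<open>Only the fibre over \<open>y0\<close> has to be a single point. The preimages of a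
  neighbourhood of \<open>y0\<close> that stay at distance \<open>e\<close> from \<open>q0\<close>
  form a compact set, on which \<open>h\<close> keeps a positive distance from \<open>y0\<close>.
  This gives boundary limits of inverses that are known only in the interior.\<close>

lemma proper_map_inverse_tendsto:
  fixes h :: "'a::heine_borel \<Rightarrow> 'b::metric_space"
  assumes K: "closed K" "continuous_on K h" and proper: "\<And>y r. bounded {q\<in>K. dist (h q) y \<le> r}"
    and q0: "\<And>q. q \<in> K \<Longrightarrow> h q = y0 \<Longrightarrow> q = q0"
    and u: "((\<lambda>x. h (u x)) \<longlongrightarrow> y0) F" "eventually (\<lambda>x. u x \<in> K) F"
  shows "(u \<longlongrightarrow> q0) F"
proof (rule tendstoI)
  fix e :: real assume e: "e > 0"
  define C where "C = {q\<in>K. dist (h q) y0 \<le> 1} \<inter> {q. e \<le> dist q q0}"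
  have "closed C"
  proof -
    have "C = (K \<inter> h -` cball y0 1) \<inter> {q. e \<le> dist q q0}" by (auto simp: C_def dist_commute)
    moreover have "closed {q. e \<le> dist q q0}" by (intro closed_Collect_le continuous_intros)
    ultimately show ?thesis using continuous_closed_preimage[OF K(2,1) closed_cball] by (simp add: closed_Int)
  qed
  moreover have "bounded C" using proper[of y0 1] by (rule bounded_subset) (auto simp: C_def)
  ultimately have C: "compact C" by (simp add: compact_eq_bounded_closed)
  have "\<exists>\<delta>>0. \<forall>q\<in>C. \<delta> \<le> dist (h q) y0"
  proof (cases "C = {}")
    case False
    have "continuous_on C (\<lambda>q. dist (h q) y0)"
      by (intro continuous_intros continuous_on_subset[OF K(2)]) (auto simp: C_def)
    from continuous_attains_inf[OF C False this] obtain q1 where q1: "q1 \<in> C" "\<And>q. q \<in> C \<Longrightarrow> dist (h q1) y0 \<le> dist (h q) y0"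
      by blast
    have "h q1 \<noteq> y0" using q0[of q1] q1(1) e by (auto simp: C_def)
    then show ?thesis using q1(2) by (intro exI[of _ "dist (h q1) y0"]) auto
  qed (auto intro: exI[of _ 1])
  then obtain \<delta> where \<delta>: "\<delta> > 0" "\<And>q. q \<in> C \<Longrightarrow> \<delta> \<le> dist (h q) y0" by blast
  have "eventually (\<lambda>x. dist (h (u x)) y0 < min 1 \<delta>) F"
    using tendstoD[OF u(1), of "min 1 \<delta>"] \<delta>(1) by simp
  then show "eventually (\<lambda>x. dist (u x) q0 < e) F"
    using u(2)
  proof eventually_elim
    case (elim x)
    show ?case
    proof (rule ccontr)
      assume "\<not> dist (u x) q0 < e"
      then have "u x \<in> C" using elim by (simp add: C_def)
      then show False using \<delta>(2) elim by fastforce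
    qed
  qed
qed

section \<open>The map 2 sin q + bq: growth, injectivity, image\<close>

definition strip_map :: "real \<Rightarrow> complex \<Rightarrow> complex" where
  "strip_map b q = 2 * sin q + b * q"

definition half_strip :: "complex set" where
  "half_strip = {q. 0 < Re q \<and> Re q < pi \<and> 0 < Im q}"

definition closed_half_strip :: "complex set" where
  "closed_half_strip = {q. 0 \<le> Re q \<and> Re q \<le> pi \<and> 0 \<le> Im q}"

lemma half_strip_subset: "half_strip \<subseteq> closed_half_strip"
  by (auto simp: half_strip_def closed_half_strip_def)

lemma open_half_strip: "open half_strip"
  unfolding half_strip_def by (intro open_Collect_conj open_Collect_less continuous_intros)

lemma convex_half_strip: "convex half_strip"
proof -
  have eq: "half_strip = {q. Re q > 0} \<inter> {q. Re q < pi} \<inter> {q. Im q > 0}" by (auto simp: half_strip_def)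
  show ?thesis
    unfolding eq by (rule convex_Int[OF convex_Int[OF convex_halfspace_Re_gt convex_halfspace_Re_lt] convex_halfspace_Im_gt])
qed

lemma closed_closed_half_strip: "closed closed_half_strip"
  unfolding closed_half_strip_def by (intro closed_Collect_conj closed_Collect_le continuous_intros)

lemma Re_sin_cosh: "Re (sin q) = sin (Re q) * cosh (Im q)"
  by (simp add: Re_sin cosh_field_def)

lemma Im_sin_sinh: "Im (sin q) = cos (Re q) * sinh (Im q)"
  by (simp add: Im_sin sinh_field_def)

lemma Re_cos_cosh: "Re (cos q) = cos (Re q) * cosh (Im q)"
  by (simp add: Re_cos cosh_field_def)

lemma Im_cos_sinh: "Im (cos q) = - (sin (Re q) * sinh (Im q))"
  by (simp add: Im_cos sinh_field_def field_simps)

lemma strip_map_Re_Im: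
  "Re (strip_map b q) = 2 * sin (Re q) * cosh (Im q) + b * Re q"
  "Im (strip_map b q) = 2 * cos (Re q) * sinh (Im q) + b * Im q"
  by (simp_all add: strip_map_def Re_sin_cosh Im_sin_sinh)

lemma strip_map_derivative: "(strip_map b has_field_derivative (2 * cos q + b)) (at q within S)"
  unfolding strip_map_def by (auto intro!: derivative_eq_intros)

lemma strip_map_holomorphic: "strip_map b holomorphic_on S"
  unfolding strip_map_def by (intro holomorphic_intros)

lemma less_sinh: "0 < s \<Longrightarrow> s < sinh s" for s :: real
proof -
  assume s: "0 < s"
  have "(\<lambda>x. sinh x - x) 0 < (\<lambda>x. sinh x - x) s"
  proof (rule DERIV_pos_imp_increasing_open[OF s])
    fix x :: real assume "0 < x"
    then show "\<exists>y. ((\<lambda>x. sinh x - x) has_real_derivative y) (at x) \<and> 0 < y"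
      using cosh_real_strict_mono[of 0 x] by (intro exI[of _ "cosh x - 1"]) (auto intro!: derivative_eq_intros)
  qed (intro continuous_intros)
  then show ?thesis by simp
qed

lemma sinh_less_mult_cosh: "0 < s \<Longrightarrow> sinh s < s * cosh s" for s :: real
proof -
  assume s: "0 < s"
  have "(\<lambda>x. x * cosh x - sinh x) 0 < (\<lambda>x. x * cosh x - sinh x) s"
  proof (rule DERIV_pos_imp_increasing_open[OF s])
    fix x :: real assume "0 < x"
    then show "\<exists>y. ((\<lambda>x. x * cosh x - sinh x) has_real_derivative y) (at x) \<and> 0 < y"
      by (intro exI[of _ "x * sinh x"]) (auto intro!: derivative_eq_intros)
  qed (intro continuous_intros)
  then show ?thesis by simp
qed

lemma mult_cos_less_sin: "0 < x \<Longrightarrow> x < pi \<Longrightarrow> x * cos x < sin x" for x :: real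
proof -
  assume x: "0 < x" "x < pi"
  have "(\<lambda>x. sin x - x * cos x) 0 < (\<lambda>x. sin x - x * cos x) x"
  proof (rule DERIV_pos_imp_increasing_open[OF x(1)])
    fix y :: real assume "0 < y" "y < x"
    then show "\<exists>z. ((\<lambda>x. sin x - x * cos x) has_real_derivative z) (at y) \<and> 0 < z"
      using x sin_gt_zero[of y] by (intro exI[of _ "y * sin y"]) (auto intro!: derivative_eq_intros)
  qed (intro continuous_intros)
  then show ?thesis by simp
qed

text \<open>With x = pi - Re q and s = Im q the hypothesis reads b s <= 2 cos x sinh s. Multiplying
  by x and using x cos x < sin x and sinh s < s cosh s gives b x < 2 sin x cosh s, which is the
  claim. It is applied to the source with b and to the target with 2.\<close>

lemma strip_map_right_of_step:
  assumes b: "0 < b" "b \<le> 2" and q: "0 < Re q" "Re q < pi" "0 < Im q" and Im: "Im (strip_map b q) \<le> 0"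
  shows "b * pi < Re (strip_map b q)"
proof -
  define s where "s = Im q"
  define x where "x = pi - Re q"
  have x: "0 < x" "x < pi" "0 < s" using q by (auto simp: x_def s_def)
  have le: "b * s \<le> 2 * (cos x * sinh s)" using Im by (simp add: strip_map_Re_Im x_def s_def)
  have "s * (b * x) \<le> 2 * ((x * cos x) * sinh s)" using mult_left_mono[OF le, of x] x by (simp add: algebra_simps)
  also have "\<dots> < 2 * (sin x * sinh s)" using mult_cos_less_sin[OF x(1,2)] x by simp
  also have "\<dots> < 2 * (sin x * (s * cosh s))" using sinh_less_mult_cosh[OF x(3)] sin_gt_zero[OF x(1,2)] by simp
  finally have "s * (b * x) < s * (2 * sin x * cosh s)" by (simp add: algebra_simps)
  then have "b * x < 2 * sin x * cosh s" using x(3) by simp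
  then show ?thesis by (simp add: strip_map_Re_Im x_def s_def algebra_simps)
qed

lemma strip_map_Re_pos:
  assumes "0 < b" "q \<in> half_strip"
  shows "0 < Re (strip_map b q)"
  using assms sin_gt_zero[of "Re q"] by (auto simp: strip_map_Re_Im half_strip_def intro!: add_pos_pos)

text \<open>The Noshiro-Warschawski argument: on the convex half-strip the derivative 2 cos q + b
  has negative imaginary part. The mean value theorem is applied to the imaginary part along a
  segment, after division by its direction.\<close>

lemma inj_on_strip_map: "inj_on (strip_map b) half_strip"
proof (rule inj_onI, rule ccontr)
  fix p q assume pq: "p \<in> half_strip" "q \<in> half_strip" "strip_map b p = strip_map b q" "p \<noteq> q"
  define \<phi> where "\<phi> = (\<lambda>t::real. Im (strip_map b (p + t * (q - p)) / (q - p)))"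
  have deriv: "(\<phi> has_real_derivative Im (2 * cos (p + t * (q - p)) + b)) (at t)" for t :: real
  proof -
    have "((\<lambda>t. strip_map b (p + of_real t * (q - p))) has_vector_derivative ((q - p) * (2 * cos (p + of_real t * (q - p)) + b))) (at t)"
    proof -
      have "((\<lambda>t. p + of_real t * (q - p)) has_vector_derivative (q - p)) (at t)"
        by (auto intro!: derivative_eq_intros)
      from field_vector_diff_chain_at[OF this strip_map_derivative]
      show ?thesis by (simp add: o_def)
    qed
    from has_vector_derivative_divide[OF this, of "q - p"]
    have "((\<lambda>t. strip_map b (p + of_real t * (q - p)) / (q - p)) has_vector_derivative (2 * cos (p + of_real t * (q - p)) + b)) (at t)"
      using pq(4) by simp
    from bounded_linear.has_vector_derivative[OF bounded_linear_Im this]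
    show ?thesis
      by (simp add: \<phi>_def has_real_derivative_iff_has_vector_derivative)
  qed
  obtain t :: real where t: "0 < t" "t < 1" "\<phi> 1 - \<phi> 0 = Im (2 * cos (p + t * (q - p)) + b)"
    using MVT2[of 0 1 \<phi> "\<lambda>t. Im (2 * cos (p + t * (q - p)) + b)", OF _ deriv] by auto
  have "p + t * (q - p) \<in> half_strip"
  proof -
    have "(1 - t) *\<^sub>R p + t *\<^sub>R q \<in> half_strip"
      using convexD_alt[OF convex_half_strip pq(1,2), of t] t by auto
    then show ?thesis by (simp add: scaleR_conv_of_real algebra_simps)
  qed
  then have "Im (2 * cos (p + t * (q - p)) + b) < 0"
    using sin_gt_zero[of "Re (p + t * (q - p))"] by (auto simp: Im_cos_sinh half_strip_def)
  moreover have "\<phi> 1 = \<phi> 0" using pq(3) by (simp add: \<phi>_def diff_divide_distrib)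
  ultimately show False using t(3) by simp
qed

text \<open>From the identity |sin q|^2 = sin^2(Re q) + sinh^2(Im q).\<close>

lemma sinh_le_cmod_sin: "sinh (Im q) \<le> cmod (sin q)"
proof (rule power2_le_imp_le)
  have "(cmod (sin q))\<^sup>2 = (sin (Re q))\<^sup>2 * (cosh (Im q))\<^sup>2 + (1 - (sin (Re q))\<^sup>2) * (sinh (Im q))\<^sup>2"
    by (simp add: cmod_power2 Re_sin_cosh Im_sin_sinh power_mult_distrib cos_squared_eq)
  also have "\<dots> = (sin (Re q))\<^sup>2 + (sinh (Im q))\<^sup>2"
    by (simp add: cosh_square_eq algebra_simps)
  finally show "(sinh (Im q))\<^sup>2 \<le> (cmod (sin q))\<^sup>2" by simp
qed simp

lemma cmod_sin_le_exp:
  assumes "0 \<le> Im q" shows "cmod (sin q) \<le> exp (Im q)"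
proof -
  have "cmod (sin q) \<le> (exp (- Im q) + exp (Im q)) / 2"
    using norm_triangle_ineq4[of "exp (\<i> * q)" "exp (- (\<i> * q))"]
    by (simp add: sin_exp_eq norm_divide norm_mult)
  also have "\<dots> \<le> exp (Im q)" using assms by simp
  finally show ?thesis .
qed

lemma cmod_closed_half_strip_le: "q \<in> closed_half_strip \<Longrightarrow> cmod q \<le> pi + Im q"
  using cmod_le[of q] by (auto simp: closed_half_strip_def)

lemma strip_map_norm_le:
  assumes "0 < b" "b \<le> 2" "q \<in> closed_half_strip"
  shows "cmod (strip_map b q) \<le> 2 * exp (Im q) + 2 * (pi + Im q)"
proof -
  have "cmod (strip_map b q) \<le> 2 * cmod (sin q) + b * cmod q"
    using norm_triangle_ineq[of "2 * sin q" "b * q"] assms by (simp add: strip_map_def norm_mult)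
  moreover have "b * cmod q \<le> 2 * (pi + Im q)"
    using assms cmod_closed_half_strip_le[OF assms(3)] by (intro mult_mono) auto
  moreover have "cmod (sin q) \<le> exp (Im q)" using assms by (intro cmod_sin_le_exp) (simp add: closed_half_strip_def)
  ultimately show ?thesis by linarith
qed

text \<open>A quadratic lower bound for the exponential already beats the linear term bq; beyond the
  cutoff 4 the term 2s is absorbed into s^2/2.\<close>

lemma strip_map_Im_bound:
  assumes "0 < b" "b \<le> 2" "q \<in> closed_half_strip" "cmod (strip_map b q) \<le> R"
  shows "Im q \<le> 4 + R + 2 * pi"
proof (cases "Im q \<le> 4")
  case True
  have "0 \<le> R" using assms(4) norm_ge_zero order_trans by blast
  then show ?thesis using True pi_ge_zero by linarith
next
  case False
  define s where "s = Im q"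
  have s: "4 < s" using False by (simp add: s_def)
  have "exp (-s) \<le> 1" using s by simp
  moreover have "2 * sinh s = exp s - exp (-s)" by (simp add: sinh_field_def)
  ultimately have "s + s\<^sup>2 / 2 \<le> 2 * sinh s"
    using exp_lower_Taylor_quadratic[of s] s by linarith
  also have "\<dots> \<le> 2 * cmod (sin q)" using sinh_le_cmod_sin[of q] by (simp add: s_def)
  also have "\<dots> \<le> R + b * cmod q"
    using norm_triangle_ineq4[of "strip_map b q" "b * q"] assms by (simp add: strip_map_def norm_mult)
  also have "b * cmod q \<le> 2 * (pi + s)"
    using assms cmod_closed_half_strip_le[OF assms(3)] by (intro mult_mono) (auto simp: s_def)
  finally have "s\<^sup>2 \<le> 2 * R + 4 * pi + 2 * s" by simp
  moreover have "4 * s \<le> s\<^sup>2" using s by (simp add: power2_eq_square)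
  ultimately have "s \<le> R + 2 * pi" by linarith
  then show ?thesis by (simp add: s_def)
qed

lemma strip_map_proper:
  assumes "0 < b" "b \<le> 2"
  shows "bounded {q\<in>closed_half_strip. dist (strip_map b q) y \<le> r}"
  unfolding bounded_iff
proof (intro exI ballI)
  fix q assume q: "q \<in> {q\<in>closed_half_strip. dist (strip_map b q) y \<le> r}"
  then have "cmod (strip_map b q) \<le> r + cmod y"
    using norm_triangle_ineq2[of "strip_map b q" y] by (simp add: dist_norm)
  then have "Im q \<le> 4 + (r + cmod y) + 2 * pi" using strip_map_Im_bound assms q by blast
  then show "cmod q \<le> 4 + (r + cmod y) + 3 * pi" using cmod_closed_half_strip_le[of q] q by simp
qed

lemma strip_map_unique_left:
  assumes b: "0 < b" "b \<le> 2" and s: "0 < s" and q: "q \<in> closed_half_strip" "strip_map b q = strip_map b (Complex 0 s)"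
  shows "q = Complex 0 s"
proof -
  have nn: "0 \<le> sin (Re q) * cosh (Im q)" "0 \<le> b * Re q"
    using q b sin_ge_zero[of "Re q"] by (auto simp: closed_half_strip_def)
  have "Re (strip_map b q) = 0" by (simp add: q strip_map_Re_Im)
  then have "b * Re q = 0" using nn unfolding strip_map_Re_Im by linarith
  then have Re0: "Re q = 0" using b by simp
  have "Im (strip_map b q) = Im (strip_map b (Complex 0 s))" using q by simp
  then have *: "2 * sinh (Im q) + b * Im q = 2 * sinh s + b * s" using Re0 by (simp add: strip_map_Re_Im)
  have "Im q = s"
  proof (rule linorder_cases[of "Im q" s])
    assume "Im q < s"
    then have "sinh (Im q) < sinh s" "b * Im q < b * s" using b by auto
    then show ?thesis using * by linarith
  next
    assume "s < Im q"
    then have "sinh s < sinh (Im q)" "b * s < b * Im q" using b by auto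
    then show ?thesis using * by linarith
  qed
  with Re0 show ?thesis by (simp add: complex_eq_iff)
qed

lemma sinh_diff_strict_mono:
  fixes s t :: real assumes "0 \<le> s" "s < t" shows "sinh s - s < sinh t - t"
proof (rule DERIV_pos_imp_increasing_open[OF assms(2)])
  fix x :: real assume "s < x"
  then show "\<exists>y. ((\<lambda>x. sinh x - x) has_real_derivative y) (at x) \<and> 0 < y"
    using cosh_real_strict_mono[of 0 x] assms by (intro exI[of _ "cosh x - 1"]) (auto intro!: derivative_eq_intros)
qed (intro continuous_intros)

text \<open>Interior preimages would lie strictly to the right of the step, and on the right edge
  the height bs - 2 sinh s is strictly monotone because b <= 2.\<close>

lemma strip_map_unique_right:
  assumes b: "0 < b" "b \<le> 2" and s: "0 < s" and q: "q \<in> closed_half_strip" "strip_map b q = strip_map b (Complex pi s)"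
  shows "q = Complex pi s"
proof -
  have eq: "Re (strip_map b q) = b * pi" "Im (strip_map b q) = b * s - 2 * sinh s"
    using q by (simp_all add: strip_map_Re_Im)
  have "b * s \<le> 2 * s" using b s by simp
  then have neg: "Im (strip_map b q) < 0" using less_sinh[OF s] eq by linarith
  then have Im: "0 < Im q" using q(1) by (cases "Im q = 0") (auto simp: closed_half_strip_def strip_map_Re_Im)
  have "Re q \<noteq> 0" using eq(1) b by (auto simp: strip_map_Re_Im)
  moreover have "\<not> (0 < Re q \<and> Re q < pi)"
    using strip_map_right_of_step[OF b, of q] Im neg eq(1) by auto
  ultimately have Re: "Re q = pi" using q(1) by (auto simp: closed_half_strip_def)
  have *: "2 * sinh (Im q) - b * Im q = 2 * sinh s - b * s" using eq(2) by (simp add: strip_map_Re_Im Re)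
  have mono: "2 * sinh x - b * x < 2 * sinh y - b * y" if "0 \<le> x" "x < y" for x y
  proof -
    have "(2 - b) * x \<le> (2 - b) * y" using that b by (intro mult_left_mono) auto
    then show ?thesis using sinh_diff_strict_mono[OF that] by (simp add: algebra_simps)
  qed
  have "Im q = s"
    using mono[of "Im q" s] mono[of s "Im q"] * s Im by (cases "Im q" s rule: linorder_cases) auto
  with Re show ?thesis by (simp add: complex_eq_iff)
qed

lemma closed_strip_map_image:
  assumes "0 < b" "b \<le> 2" shows "closed (strip_map b ` closed_half_strip)"
  by (rule proper_map_image_closed[OF closed_closed_half_strip holomorphic_on_imp_continuous_on[OF strip_map_holomorphic]
       strip_map_proper[OF assms]])

lemma strip_map_edge_not_in_step_domain:
  assumes b: "0 < b" "b \<le> 2" and q: "q \<in> closed_half_strip" "q \<notin> half_strip"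
  shows "strip_map b q \<notin> step_domain (b * pi)"
proof -
  consider "Re q = 0" | "Re q = pi" | "Im q = 0" using q by (force simp: half_strip_def closed_half_strip_def)
  then show ?thesis
  proof cases
    case 1
    have "0 < b * pi" using b by simp
    with 1 show ?thesis by (auto simp: step_domain_def strip_map_Re_Im)
  next
    case 2
    have "b * Im q \<le> 2 * Im q" using b q by (intro mult_right_mono) (auto simp: closed_half_strip_def)
    also have "\<dots> \<le> 2 * sinh (Im q)" using q less_sinh[of "Im q"] by (cases "Im q = 0") (auto simp: closed_half_strip_def)
    finally show ?thesis using 2 by (auto simp: step_domain_def strip_map_Re_Im)
  next
    case 3
    then show ?thesis by (auto simp: step_domain_def strip_map_Re_Im)
  qed
qed

text \<open>On each quadrant the image of the open half-strip and the complement of the image of the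
  closed one are open, disjoint and exhaustive, because the edges map outside the step domain. A
  connected quadrant that contains one image point is therefore covered.\<close>

lemma step_domain_subset_strip_map_image:
  assumes b: "0 < b" "b \<le> 2"
  shows "step_domain (b * pi) \<subseteq> strip_map b ` half_strip"
proof -
  have key: "Q \<subseteq> strip_map b ` half_strip"
    if Q: "connected Q" "Q \<subseteq> step_domain (b * pi)" "Q \<inter> strip_map b ` half_strip \<noteq> {}" for Q
  proof -
    have "open (strip_map b ` half_strip)"
      by (rule open_mapping_thm3[OF strip_map_holomorphic open_half_strip inj_on_strip_map])
    moreover have "open (- (strip_map b ` closed_half_strip))"
      using closed_strip_map_image[OF b] by (simp add: closed_def)
    moreover have "Q \<subseteq> strip_map b ` half_strip \<union> - (strip_map b ` closed_half_strip)"
    proof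
      fix w assume w: "w \<in> Q"
      show "w \<in> strip_map b ` half_strip \<union> - (strip_map b ` closed_half_strip)"
        using w Q(2) strip_map_edge_not_in_step_domain[OF b] by blast
    qed
    moreover have "strip_map b ` half_strip \<inter> - (strip_map b ` closed_half_strip) \<inter> Q = {}"
      using half_strip_subset by blast
    ultimately have "Q \<inter> - (strip_map b ` closed_half_strip) = {}"
      using connectedD[OF Q(1)] Q(3) by (smt (verit) Int_commute)
    then show ?thesis
      using \<open>Q \<subseteq> strip_map b ` half_strip \<union> - (strip_map b ` closed_half_strip)\<close> by blast
  qed
  have 1: "{w. 0 < Re w \<and> 0 < Im w} \<subseteq> strip_map b ` half_strip"
  proof (rule key)
    have "{w. 0 < Re w \<and> 0 < Im w} = {w. Re w > 0} \<inter> {w. Im w > 0}" by auto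
    then show "connected {w. 0 < Re w \<and> 0 < Im w}"
      by (auto intro!: convex_connected convex_Int convex_halfspace_Re_gt convex_halfspace_Im_gt)
    have "Complex (pi/2) 1 \<in> half_strip" by (simp add: half_strip_def)
    moreover have "strip_map b (Complex (pi/2) 1) \<in> {w. 0 < Re w \<and> 0 < Im w}"
      using b by (simp add: strip_map_Re_Im add_pos_pos)
    ultimately show "{w. 0 < Re w \<and> 0 < Im w} \<inter> strip_map b ` half_strip \<noteq> {}" by blast
  qed (auto simp: step_domain_def)
  have 2: "{w. b * pi < Re w \<and> Im w < 0} \<subseteq> strip_map b ` half_strip"
  proof (rule key)
    have "{w. b * pi < Re w \<and> Im w < 0} = {w. Re w > b * pi} \<inter> {w. Im w < 0}" by auto
    then show "connected {w. b * pi < Re w \<and> Im w < 0}"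
      by (auto intro!: convex_connected convex_Int convex_halfspace_Re_gt convex_halfspace_Im_lt)
    \<comment> \<open>Here cos(Re q) = -1/2, so the height is 8b - sinh 8 <= 16 - 20 < 0.\<close>
    let ?q = "Complex (2 * pi / 3) 8"
    have q: "?q \<in> half_strip" by (simp add: half_strip_def)
    have c: "cos (2 * pi / 3) = - (1/2 :: real)" using cos_120 by simp
    have "exp (-8::real) \<le> 1" "(41::real) \<le> exp 8"
      using exp_lower_Taylor_quadratic[of "8::real"] by simp_all
    moreover have "2 * sinh (8::real) = exp 8 - exp (-8)" by (simp add: sinh_field_def)
    ultimately have "20 \<le> sinh (8::real)" by linarith
    then have Im: "Im (strip_map b ?q) < 0" using b by (simp add: strip_map_Re_Im c)
    moreover have "b * pi < Re (strip_map b ?q)"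
      using strip_map_right_of_step[OF b, of ?q] Im q by (simp add: half_strip_def)
    ultimately show "{w. b * pi < Re w \<and> Im w < 0} \<inter> strip_map b ` half_strip \<noteq> {}" using q by blast
  qed (auto simp: step_domain_def)
  show ?thesis using 1 2 by (auto simp: step_domain_def)
qed

text \<open>P and -P have the same cosine. If P had Im P <= 0, then -P would lie in the range in
  which \<open>Arccos\<close> inverts the cosine, forcing P = -P.\<close>

lemma Arccos_half_strip:
  assumes "Im c < 0" shows "Arccos c \<in> half_strip"
proof -
  define P where "P = Arccos c"
  have Re: "- pi < Re P" "Re P \<le> pi" using Re_Arccos_bounds[of c] by (auto simp: P_def)
  have cosP: "cos P = c" by (simp add: P_def)
  have pos: "0 < sin (Re P) * sinh (Im P)"
    using assms Im_cos_sinh[of P] by (simp add: cosP)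
  show ?thesis
  proof (cases "0 < Im P")
    case True
    then have "0 < sin (Re P)" using pos by (simp add: zero_less_mult_iff)
    moreover have "sin (Re P) \<le> 0" if "Re P \<le> 0" using sin_ge_zero[of "- Re P"] that Re by simp
    moreover have "Re P \<noteq> pi" using \<open>0 < sin (Re P)\<close> by auto
    ultimately have "0 < Re P" "Re P < pi" using Re by force+
    then show ?thesis using True by (simp add: half_strip_def P_def)
  next
    case False
    then have "sinh (Im P) \<le> 0" by simp
    then have neg: "sin (Re P) < 0" "sinh (Im P) < 0" using pos by (auto simp: zero_less_mult_iff)
    have "\<not> 0 \<le> Re P" using sin_ge_zero[of "Re P"] Re neg(1) by auto
    then have "Arccos (cos (- P)) = - P" using Re by (intro Arccos_cos) auto
    then have "P = - P" by (simp add: cosP P_def)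
    then have "Im P = 0" by (simp add: complex_eq_iff)
    then show ?thesis using neg(2) by simp
  qed
qed

lemma Im_cos_half_strip: "q \<in> half_strip \<Longrightarrow> Im (cos q) < 0"
  using sin_gt_zero[of "Re q"] by (auto simp: half_strip_def Im_cos_sinh)

lemma cos_inj_half_strip:
  assumes p: "0 \<le> Re p" "Re p \<le> pi" "0 < Im p" and q: "0 \<le> Re q" "Re q \<le> pi" "0 < Im q" and eq: "cos p = cos q"
  shows "p = q"
proof -
  obtain n where n: "n \<in> \<int>" "p = q + of_real (2 * n * pi) \<or> p = - q + of_real (2 * n * pi)"
    using eq complex_cos_eq[of p q] by auto
  have "Im p \<noteq> - Im q" using p q by linarith
  then have p_eq: "p = q + of_real (2 * n * pi)" using n(2) by (auto simp: complex_eq_iff)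
  then have "Re p = Re q + 2 * n * pi" by simp
  then have "\<bar>2 * n * pi\<bar> \<le> pi" using p q by linarith
  then have "\<bar>n\<bar> < 1" by (simp add: abs_mult)
  then have "n = 0" using n(1) by (metis Ints_nonzero_abs_less1)
  then show ?thesis using p_eq by simp
qed

text \<open>The two solutions $e^{-iP}$ of the quadratic equation are $(s+1)/(s-1)$ and its inverse; the
  signs of $\mathrm{Im}\,P$ and $\mathrm{Re}\,s$ decide between them.\<close>

lemma exp_cos_root:
  fixes b :: real and f s P :: complex
  assumes c: "cos P = 1 + 1 / (b * f)" and P: "0 < Im P" and b: "0 < b" and f: "f \<noteq> 0" and Ref: "0 < Re s" and s: "s\<^sup>2 = 1 + 2 * b * f"
  shows "exp (- (\<i> * P)) = (s + 1)\<^sup>2 / (2 * b * f)" "sin P = \<i> * s / (b * f)"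
proof -
  define x where "x = exp (- (\<i> * P))"
  have x0: "x \<noteq> 0" by (simp add: x_def)
  have ex: "exp (\<i> * P) = 1 / x" by (simp add: x_def exp_minus field_simps)
  have bf: "complex_of_real b * f \<noteq> 0" using b f by simp
  have prod: "(s - 1) * (s + 1) = 2 * (b * f)" using s by (simp add: power2_eq_square algebra_simps)
  then have sm: "s - 1 \<noteq> 0" "s + 1 \<noteq> 0" using bf by auto
  define y where "y = (s + 1) / (s - 1)"
  have y0: "y \<noteq> 0" using sm by (simp add: y_def)
  have y_eq: "y = (s + 1)\<^sup>2 / (2 * b * f)"
  proof -
    have "2 * b * f = (s - 1) * (s + 1)" unfolding prod by simp
    then show ?thesis unfolding y_def using sm by (simp add: power2_eq_square)
  qed
  have y_sum: "y + 1 / y = 2 + 2 / (b * f)"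
  proof -
    have "y + 1 / y = ((s + 1) * (s + 1) + (s - 1) * (s - 1)) / ((s - 1) * (s + 1))"
      using sm by (simp add: y_def add_frac_eq)
    also have "(s + 1) * (s + 1) + (s - 1) * (s - 1) = 2 * ((s - 1) * (s + 1)) + 4"
      by (simp add: algebra_simps)
    also have "(2 * ((s - 1) * (s + 1)) + 4) / ((s - 1) * (s + 1)) = 2 + 4 / ((s - 1) * (s + 1))"
      using sm by (subst add_divide_distrib) simp
    finally have "y + 1 / y = 2 + 4 / ((s - 1) * (s + 1))" .
    then show ?thesis unfolding prod by simp
  qed
  have y_diff: "y - 1 / y = 2 * s / (b * f)"
  proof -
    have "y - 1 / y = 4 * s / ((s - 1) * (s + 1))"
      using sm by (simp add: y_def field_simps)
    then show ?thesis unfolding prod by simp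
  qed
  have "x + 1 / x = 2 * cos P" by (simp add: cos_exp_eq ex x_def[symmetric])
  also have "\<dots> = y + 1 / y" unfolding y_sum c by simp
  finally have "(x - y) * (x * y - 1) = 0" using x0 y0 by (simp add: field_simps)
  moreover have "x * y \<noteq> 1"
  proof -
    have "cmod x = exp (Im P)" by (simp add: x_def norm_exp_eq_Re)
    then have "1 < cmod x" using P by simp
    moreover have "1 < cmod y"
    proof -
      have "(cmod (s - 1))\<^sup>2 < (cmod (s + 1))\<^sup>2"
        unfolding cmod_power2 using Ref by (simp add: power2_eq_square algebra_simps)
      then have "cmod (s - 1) < cmod (s + 1)" by (rule power2_less_imp_less) simp
      then show ?thesis using sm by (simp add: y_def norm_divide)
    qed
    ultimately have "1 < cmod (x * y)" unfolding norm_mult by (rule less_1_mult)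
    then show ?thesis by auto
  qed
  ultimately have xy: "x = y" by simp
  show "exp (- (\<i> * P)) = (s + 1)\<^sup>2 / (2 * b * f)" using xy y_eq by (simp add: x_def)
  have "sin P = (1 / x - x) / (2 * \<i>)" by (simp add: sin_exp_eq ex x_def[symmetric])
  also have "\<dots> = \<i> * (x - 1 / x) / 2" by (simp add: field_simps)
  also have "\<dots> = \<i> * s / (b * f)" unfolding xy y_diff by simp
  finally show "sin P = \<i> * s / (b * f)" .
qed

section \<open>Difference of the natural parameters as a function of z\<close>

lemma Re_csqrt_pos: "Im w \<noteq> 0 \<Longrightarrow> 0 < Re (csqrt w)"
proof -
  assume w: "Im w \<noteq> 0"
  have "0 \<le> Re (csqrt w)" using csqrt_principal[of w] by auto
  moreover have "Re (csqrt w) \<noteq> 0"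
  proof
    assume "Re (csqrt w) = 0"
    then have "Im ((csqrt w)\<^sup>2) = 0" by (simp add: power2_eq_square)
    then show False using w by simp
  qed
  ultimately show ?thesis by simp
qed

text \<open>With $k=1/z-1/f$, this is the closed form of $i(b(\sin P+P)-(2\sin q+bq))$ as a function of
  $z=e^{iq}$. Unlike the two terms of the difference it is holomorphic near \<open>0\<close>.\<close>

definition strip_kernel :: "real \<Rightarrow> (complex \<Rightarrow> complex) \<Rightarrow> (complex \<Rightarrow> complex) \<Rightarrow> complex \<Rightarrow> complex" where
  "strip_kernel b k f z = k z - 2 * of_real b / (csqrt (1 + 2 * of_real b * f z) + 1) - z
     - of_real b * Ln ((csqrt (1 + 2 * of_real b * f z) + 1)\<^sup>2 * (1 - z * k z) / (2 * of_real b))"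

text \<open>Two singularities cancel: 1/f from sin p against 1/z from sin q, leaving
  \<open>k\<close>, and exp(-ip) against exp(-iq), since z/f = 1 - z k. The principal
  \<open>Ln\<close> returns the difference P - q itself because both real parts lie in an interval
  of length pi.\<close>

lemma strip_map_diff_eq_kernel:
  assumes b: "0 < b" and P: "P \<in> half_strip" and q: "q \<in> half_strip"
    and z: "z = exp (\<i> * q)" and f: "Im (f z) \<noteq> 0" and c: "cos P = 1 + 1 / (b * f z)" and k: "k z = 1 / z - 1 / f z"
  shows "b * (sin P + P) - strip_map b q = - (\<i> * strip_kernel b k f z)"
proof -
  define s where "s = csqrt (1 + 2 * b * f z)"
  have f0: "f z \<noteq> 0" using f by auto
  have z0: "z \<noteq> 0" by (simp add: z)
  have s: "0 < Re s" "s\<^sup>2 = 1 + 2 * b * f z"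
    using b f Re_csqrt_pos[of "1 + 2 * b * f z"] by (auto simp: s_def)
  have ImP: "0 < Im P" using P by (simp add: half_strip_def)
  note root = exp_cos_root[OF c ImP b f0 s]
  have s1: "s + 1 \<noteq> 0"
  proof
    assume "s + 1 = 0"
    then have "Re (s + 1) = 0" by simp
    with s(1) show False by simp
  qed
  have "Ln (exp (- (\<i> * (P - q)))) = - (\<i> * (P - q))"
    using P q by (intro Ln_exp) (auto simp: half_strip_def)
  moreover have "exp (- (\<i> * (P - q))) = (s + 1)\<^sup>2 / (2 * b * f z) * z"
  proof -
    have "exp (- (\<i> * (P - q))) = exp (- (\<i> * P)) * exp (\<i> * q)"
      by (simp add: exp_add[symmetric] algebra_simps)
    then show ?thesis by (simp only: root(1) z[symmetric])
  qed
  moreover have "(s + 1)\<^sup>2 / (2 * b * f z) * z = (s + 1)\<^sup>2 * (1 - z * k z) / (2 * b)"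
    using f0 z0 b by (simp add: k field_simps)
  ultimately have "\<i> * Ln ((s + 1)\<^sup>2 * (1 - z * k z) / (2 * b)) = P - q" by simp
  then obtain l where l: "P - q = \<i> * l" "l = Ln ((s + 1)\<^sup>2 * (1 - z * k z) / (2 * b))" by metis
  have "2 * sin q = \<i> * (1 / z - z)"
    by (simp add: sin_exp_eq z exp_minus field_simps)
  moreover have "b * sin P = \<i> * (1 / f z + 2 * b / (s + 1))"
  proof -
    have "(s - 1) * (s + 1) = 2 * b * f z" using s(2) by (simp add: power2_eq_square algebra_simps)
    then have "s - 1 = 2 * b * f z / (s + 1)" using s1 by (simp add: eq_divide_eq)
    then have "(s - 1) / f z = 2 * b / (s + 1)" using f0 by simp
    then have "s / f z = 1 / f z + 2 * b / (s + 1)" by (simp add: diff_divide_distrib algebra_simps)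
    moreover have "b * sin P = \<i> * (s / f z)" using b by (simp add: root(2))
    ultimately show ?thesis by simp
  qed
  moreover have "b * (sin P + P) - strip_map b q = b * sin P - 2 * sin q + b * (P - q)"
    by (simp add: strip_map_def algebra_simps)
  ultimately have "b * (sin P + P) - strip_map b q = \<i> * (1 / f z + 2 * b / (s + 1)) - \<i> * (1 / z - z) + b * (\<i> * l)"
    by (simp only: l(1))
  also have "\<dots> = - (\<i> * (k z - 2 * b / (s + 1) - z - b * l))"
    unfolding k by (simp add: algebra_simps)
  also have "k z - 2 * b / (s + 1) - z - b * l = strip_kernel b k f z"
    by (simp only: strip_kernel_def s_def l(2) of_real_mult of_real_numeral)
  finally show ?thesis .
qed

text \<open>These two values become c0 and c1: since w z tends to i at the end of the half-strip, -i
  \<kappa>(z) = -i \<kappa>(0) + \<kappa>'(0)/w + o(1/w) for the kernel \<kappa>.\<close>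

lemma strip_kernel_at_0:
  assumes b: "0 < b" and f: "f 0 = 0" "(f has_field_derivative 1) (at 0)" and k: "(k has_field_derivative D) (at 0)"
  shows "strip_kernel b k f 0 = k 0 - of_real b + of_real b * of_real (ln (b / 2))"
    and "(strip_kernel b k f has_field_derivative (D + of_real b * k 0 - (of_real b)\<^sup>2 / 2 - 1)) (at 0)"
proof -
  have "Ln (complex_of_real (2 / b)) = ln (2 / b)" using b by (intro Ln_of_real) simp
  moreover have "ln (2 / b) = - ln (b / 2)" using b by (simp add: ln_div)
  ultimately have ln: "Ln (2 / complex_of_real b) = - complex_of_real (ln (b / 2))" by simp
  then show "strip_kernel b k f 0 = k 0 - of_real b + of_real b * of_real (ln (b / 2))"
    using b by (simp add: strip_kernel_def f(1))
  define S where "S = (\<lambda>z. csqrt (1 + 2 * of_real b * f z))"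
  have S0: "S 0 = 1" by (simp add: S_def f)
  have S: "(S has_field_derivative of_real b) (at 0)"
    unfolding S_def using f by (auto intro!: derivative_eq_intros simp: field_simps)
  define M where "M = (\<lambda>z. (S z + 1)\<^sup>2 * (1 - z * k z) / (2 * of_real b))"
  have M0: "M 0 = 2 / of_real b" using b by (simp add: M_def S0)
  have M: "(M has_field_derivative (2 - 2 * k 0 / of_real b)) (at 0)"
    unfolding M_def using b by (auto intro!: derivative_eq_intros S k simp: S0 field_simps)
  have "M 0 \<notin> \<real>\<^sub>\<le>\<^sub>0" unfolding M0 using b by (simp add: complex_nonpos_Reals_iff)
  moreover have "inverse (M 0) * (2 - 2 * k 0 / of_real b) = of_real b - k 0"
    using b by (simp add: M0 field_simps)
  ultimately
  have LM: "((\<lambda>z. Ln (M z)) has_field_derivative (of_real b - k 0)) (at 0)"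
    using DERIV_chain2[OF has_field_derivative_Ln M] by simp
  define N where "N = (\<lambda>z. Ln (M z))"
  have N: "(N has_field_derivative (of_real b - k 0)) (at 0)" using LM by (simp add: N_def)
  have "((\<lambda>z. k z - 2 * of_real b / (S z + 1) - z - of_real b * N z) has_field_derivative (D + of_real b * k 0 - (of_real b)\<^sup>2 / 2 - 1)) (at 0)"
    by (auto intro!: derivative_eq_intros S k N simp: S0 power2_eq_square field_simps)
  then show "(strip_kernel b k f has_field_derivative (D + of_real b * k 0 - (of_real b)\<^sup>2 / 2 - 1)) (at 0)"
    by (simp add: strip_kernel_def[abs_def] S_def M_def N_def)
qed

section \<open>Coefficients of real univalent functions\<close>

text \<open>Two removable singularities: f(z)/z extends to a zero-free function with value 1 at the
  origin, so 1 - z/f(z) vanishes there and can be divided by z.\<close>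

lemma reciprocal_difference_extends:
  assumes f: "f \<in> schlicht"
  obtains k where "k holomorphic_on ball 0 1" "\<And>z. z \<in> ball 0 1 \<Longrightarrow> z \<noteq> 0 \<Longrightarrow> k z = 1 / z - 1 / f z"
proof -
  have hf: "f holomorphic_on ball 0 1" "inj_on f (ball 0 1)" "f 0 = 0" "deriv f 0 = 1"
    using f by (auto simp: schlicht_def)
  define F where "F = (\<lambda>z. if z = 0 then deriv f 0 else f z / z)"
  have hol: "F holomorphic_on ball 0 1"
    by (rule pole_theorem_open_0[OF hf(1), of 0]) (auto simp: F_def hf(3))
  have nz: "F z \<noteq> 0" if "z \<in> ball 0 1" for z
    using inj_onD[OF hf(2), of z 0] that hf(3,4) by (auto simp: F_def)
  define g where "g = (\<lambda>z. 1 - 1 / F z)"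
  have hg: "g holomorphic_on ball 0 1"
    unfolding g_def using nz by (intro holomorphic_intros hol) auto
  define k where "k = (\<lambda>z. if z = 0 then deriv g 0 else g z / z)"
  show ?thesis
  proof (rule that)
    show "k holomorphic_on ball 0 1"
      by (rule pole_theorem_open_0[OF hg, of 0]) (auto simp: k_def g_def F_def hf(4))
    fix z :: complex assume "z \<in> ball 0 1" "z \<noteq> 0"
    then show "k z = 1 / z - 1 / f z"
      using nz[of z] by (simp add: k_def g_def F_def field_simps)
  qed
qed

lemma schlicht_nonzero: "f \<in> schlicht \<Longrightarrow> z \<in> ball 0 1 \<Longrightarrow> z \<noteq> 0 \<Longrightarrow> f z \<noteq> 0"
  by (metis (mono_tags, lifting) centre_in_ball inj_onD mem_Collect_eq schlicht_def zero_less_one)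

text \<open>If l = log(f(z)/z), then exp(-l) = 1 - z k, hence l' = (k + z k') exp l. Evaluating this
  identity and its derivative at 0 gives l'(0) and l''(0).\<close>

lemma log_coeffs_reciprocal_difference:
  assumes f: "f \<in> schlicht" and k: "k holomorphic_on ball 0 1" "\<And>z. z \<in> ball 0 1 \<Longrightarrow> z \<noteq> 0 \<Longrightarrow> k z = 1 / z - 1 / f z"
  shows "log_coeff f 1 = k 0 / 2" "log_coeff f 2 = (deriv k 0 + (k 0)\<^sup>2 / 2) / 2"
proof -
  obtain l where l: "is_log_branch f l" using is_log_branch_exists[OF f] by blast
  then have hl: "l holomorphic_on ball 0 1" "l 0 = 0" and el: "\<And>z. z \<in> ball 0 1 \<Longrightarrow> z \<noteq> 0 \<Longrightarrow> exp (l z) = f z / z"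
    by (auto simp: is_log_branch_def)
  have e: "exp (- l z) = 1 - z * k z" if z: "z \<in> ball 0 1" for z
  proof (cases "z = 0")
    case False
    then have "exp (- l z) = z / f z" by (simp add: exp_minus el[OF z])
    then show ?thesis using False by (simp add: k(2)[OF z False] right_diff_distrib)
  qed (simp add: hl)
  have dk: "(k has_field_derivative deriv k z) (at z)" if "z \<in> ball 0 1" for z
    using k(1) that by (simp add: holomorphic_derivI)
  have dl: "(l has_field_derivative deriv l z) (at z)" if "z \<in> ball 0 1" for z
    using hl(1) that by (simp add: holomorphic_derivI)
  have D: "deriv l z = (k z + z * deriv k z) * exp (l z)" if z: "z \<in> ball 0 1" for z
  proof -
    have "((\<lambda>z. exp (- l z)) has_field_derivative (exp (- l z) * - deriv l z)) (at z)"
      using dl[OF z] by (auto intro!: derivative_eq_intros)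
    moreover have "((\<lambda>z. exp (- l z)) has_field_derivative (- (k z + z * deriv k z))) (at z)"
    proof (rule has_field_derivative_transform_within_open[where S = "ball 0 1"])
      show "((\<lambda>z. 1 - z * k z) has_field_derivative (- (k z + z * deriv k z))) (at z)"
        using dk[OF z] by (auto intro!: derivative_eq_intros)
    qed (use z e in auto)
    ultimately have "exp (- l z) * - deriv l z = - (k z + z * deriv k z)" by (rule DERIV_unique)
    then have "deriv l z * exp (- l z) = k z + z * deriv k z"
      by (metis minus_equation_iff minus_mult_right mult.commute)
    then show ?thesis by (simp add: exp_minus field_simps)
  qed
  have d1: "deriv l 0 = k 0" using D[of 0] hl by simp
  have "(deriv l has_field_derivative (2 * deriv k 0 + (k 0)\<^sup>2)) (at 0)"
  proof (rule has_field_derivative_transform_within_open[where S = "ball 0 1"])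
    have "(deriv k has_field_derivative deriv (deriv k) 0) (at 0)"
      using holomorphic_deriv[OF k(1)] by (simp add: holomorphic_derivI[where S = "ball 0 1"])
    then show "((\<lambda>z. (k z + z * deriv k z) * exp (l z)) has_field_derivative (2 * deriv k 0 + (k 0)\<^sup>2)) (at 0)"
      using dk[of 0] dl[of 0] by (auto intro!: derivative_eq_intros simp: hl d1 power2_eq_square)
  qed (use D in auto)
  then have d2: "deriv (deriv l) 0 = 2 * deriv k 0 + (k 0)\<^sup>2" by (rule DERIV_imp_deriv)
  show "log_coeff f 1 = k 0 / 2"
    using log_coeff_eq[OF f l, of 1] d1 by simp
  show "log_coeff f 2 = (deriv k 0 + (k 0)\<^sup>2 / 2) / 2"
    using log_coeff_eq[OF f l, of 2] d2 by (simp add: numeral_2_eq_2 field_simps)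
qed

lemma Reals_limit_and_derivative:
  fixes k :: "complex \<Rightarrow> complex" and r :: real
  assumes d: "(k has_field_derivative D) (at 0)" and r: "r > 0" and real: "\<And>x::real. 0 < x \<Longrightarrow> x < r \<Longrightarrow> k x \<in> \<real>"
  shows "k 0 \<in> \<real>" "D \<in> \<real>"
proof -
  have fl: "filterlim complex_of_real (at 0) (at_right 0)"
    unfolding filterlim_at by (auto intro!: tendsto_eq_intros simp: eventually_at_right_field intro: exI[of _ 1])
  have ev: "eventually (\<lambda>x::real. 0 < x \<and> x < r) (at_right 0)"
    using r eventually_at_right_field by blast
  have "(k \<longlongrightarrow> k 0) (at 0)" using DERIV_isCont[OF d] by (simp add: isCont_def)
  from filterlim_compose[OF this fl] have "((\<lambda>x. k (of_real x)) \<longlongrightarrow> k 0) (at_right 0)" .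
  moreover have "eventually (\<lambda>x. k (of_real x) \<in> \<real>) (at_right 0)"
    using ev by eventually_elim (use real in auto)
  ultimately show k0: "k 0 \<in> \<real>"
    by (intro Lim_in_closed_set[OF closed_complex_Reals]) auto
  have "((\<lambda>z. (k z - k 0) / z) \<longlongrightarrow> D) (at 0)" using d by (simp add: DERIV_def)
  from filterlim_compose[OF this fl] have "((\<lambda>x. (k (of_real x) - k 0) / of_real x) \<longlongrightarrow> D) (at_right 0)" .
  moreover have "eventually (\<lambda>x. (k (of_real x) - k 0) / of_real x \<in> \<real>) (at_right 0)"
    using ev by eventually_elim (use real k0 in \<open>auto intro!: Reals_divide Reals_diff\<close>)
  ultimately show "D \<in> \<real>"
    by (intro Lim_in_closed_set[OF closed_complex_Reals]) auto
qed

lemma reciprocal_difference_real: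
  assumes f: "f \<in> typically_real" and k: "k holomorphic_on ball 0 1" "\<And>z. z \<in> ball 0 1 \<Longrightarrow> z \<noteq> 0 \<Longrightarrow> k z = 1 / z - 1 / f z"
  shows "k 0 \<in> \<real>" "deriv k 0 \<in> \<real>" "\<And>z. z \<in> ball 0 1 \<Longrightarrow> z \<in> \<real> \<Longrightarrow> k z \<in> \<real>"
proof -
  have fr: "f z \<in> \<real>" if "z \<in> ball 0 1" "z \<in> \<real>" for z using f that by (auto simp: typically_real_def)
  have kr: "k z \<in> \<real>" if "z \<in> ball 0 1" "z \<noteq> 0" "z \<in> \<real>" for z
    unfolding k(2)[OF that(1,2)] using fr that by (intro Reals_diff Reals_divide) auto
  have d: "(k has_field_derivative deriv k 0) (at 0)" using k(1) by (simp add: holomorphic_derivI)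
  have *: "k x \<in> \<real>" if "0 < x" "x < 1" for x :: real using kr[of "of_real x"] that by simp
  show "k 0 \<in> \<real>" "deriv k 0 \<in> \<real>" using Reals_limit_and_derivative[OF d zero_less_one *] by auto
  then show "\<And>z. z \<in> ball 0 1 \<Longrightarrow> z \<in> \<real> \<Longrightarrow> k z \<in> \<real>" using kr by metis
qed

text \<open>The imaginary part of $k(z)+z=(1/z+z)-1/f(z)$ is nonnegative in the upper half-disc: on the
  circle \<open>1/z + z\<close> is real, on the diameter everything is real.\<close>

lemma reciprocal_difference_deriv_ge:
  assumes f: "f \<in> schlicht \<inter> typically_real" and k: "k holomorphic_on ball 0 1" "\<And>z. z \<in> ball 0 1 \<Longrightarrow> z \<noteq> 0 \<Longrightarrow> k z = 1 / z - 1 / f z"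
  shows "- 1 \<le> Re (deriv k 0)"
proof -
  have kr: "k 0 \<in> \<real>" "\<And>z. z \<in> ball 0 1 \<Longrightarrow> z \<in> \<real> \<Longrightarrow> k z \<in> \<real>"
    using reciprocal_difference_real[OF _ k] f by auto
  have bound: "0 \<le> Im (k w + w)" if w: "w \<in> ball 0 1" "0 < Im w" for w
  proof -
    \<comment> \<open>Since \<open>f\<close> is given only on the open disc, the maximum principle
      is used on half-discs of radius r < 1. On their arcs Im(1/z + z) may be negative, but not
      below r - 1/r, and this tends to 0.\<close>
    have le: "- Im (k w + w) \<le> 1 / r - r" if r: "cmod w < r" "r < 1" for r
    proof -
      define S where "S = {z. cmod z \<le> r \<and> 0 \<le> Im z}"
      have S: "S \<subseteq> ball 0 1" using r by (auto simp: S_def)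
      have r0: "0 < r" using r norm_ge_zero[of w] by linarith
      have clS: "closed S" unfolding S_def by (intro closed_Collect_conj closed_Collect_le continuous_intros)
      have hol: "(\<lambda>z. \<i> * (k z + z)) holomorphic_on ball 0 1" by (intro holomorphic_intros k(1))
      have "Re (\<i> * (k w + w)) \<le> 1 / r - r"
      proof (rule maximum_real_frontier[where S = S and f = "\<lambda>z. \<i> * (k z + z)"])
        show "(\<lambda>z. \<i> * (k z + z)) holomorphic_on interior S"
          using hol S interior_subset by (meson holomorphic_on_subset order_trans)
        show "continuous_on (closure S) (\<lambda>z. \<i> * (k z + z))"
          using hol S clS by (metis closure_closed holomorphic_on_imp_continuous_on holomorphic_on_subset)
        show "bounded S" unfolding bounded_iff S_def by auto
        show "w \<in> S" using w r by (simp add: S_def)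
        fix z assume z: "z \<in> frontier S"
        then have zS: "z \<in> S" using clS frontier_subset_closed by blast
        have "{z. cmod z < r \<and> 0 < Im z} \<subseteq> interior S"
          by (rule interior_maximal) (auto simp: S_def intro!: open_Collect_conj open_Collect_less continuous_intros)
        then have "\<not> (cmod z < r \<and> 0 < Im z)" using z by (auto simp: frontier_def)
        then consider "Im z = 0" | "cmod z = r" "0 < Im z" using zS by (force simp: S_def)
        then show "Re (\<i> * (k z + z)) \<le> 1 / r - r"
        proof cases
          case 1
          then have "k z \<in> \<real>" using kr(2)[of z] zS S by (auto simp: complex_is_Real_iff)
          moreover have "0 \<le> 1 / r - r" using r r0 by (simp add: field_simps) (metis less_eq_real_def mult_le_one)
          ultimately show ?thesis using 1 by (simp add: complex_is_Real_iff)
        next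
          case 2
          have zb: "z \<in> ball 0 1" using zS S by blast
          have "Im (f z) * Im z > 0" using f zb 2 by (auto simp: typically_real_def complex_is_Real_iff)
          then have "0 < Im (f z)" using 2 by (simp add: zero_less_mult_iff)
          then have "Im (1 / f z) \<le> 0" by (simp add: Im_divide divide_le_0_iff add_nonneg_nonneg)
          moreover have "Im (1 / z + z) = Im z * (1 - 1 / r\<^sup>2)"
          proof -
            have "Im (1 / z) = - (Im z / r\<^sup>2)" using 2(1) by (simp add: Im_divide cmod_power2[symmetric])
            then show ?thesis by (simp add: algebra_simps)
          qed
          moreover have "Im z * (1 / r\<^sup>2 - 1) \<le> 1 / r - r"
          proof -
            have "1 \<le> 1 / r\<^sup>2" using r r0 by (simp add: power_le_one)
            then have "Im z * (1 / r\<^sup>2 - 1) \<le> r * (1 / r\<^sup>2 - 1)"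
              using abs_Im_le_cmod[of z] 2 by (intro mult_right_mono) auto
            also have "\<dots> = 1 / r - r" using r0 by (simp add: field_simps power2_eq_square)
            finally show ?thesis .
          qed
          moreover have "Im (k z + z) = Im (1 / z + z) - Im (1 / f z)"
          proof -
            have "z \<noteq> 0" using 2 by auto
            then show ?thesis by (simp add: k(2)[OF zb])
          qed
          moreover have "Im z * (1 - 1 / r\<^sup>2) = - (Im z * (1 / r\<^sup>2 - 1))" by (simp add: algebra_simps)
          moreover have "Re (\<i> * (k z + z)) = - Im (k z + z)" by simp
          ultimately show ?thesis by linarith
        qed
      qed
      then show ?thesis by simp
    qed
    have "- Im (k w + w) \<le> 1 / 1 - 1"
    proof (rule tendsto_lowerbound[where F = "at_left (1::real)"])
      show "((\<lambda>r. 1 / r - r) \<longlongrightarrow> 1 / 1 - (1::real)) (at_left 1)" by (intro tendsto_intros) auto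
      show "\<forall>\<^sub>F r in at_left 1. - Im (k w + w) \<le> 1 / r - r"
        using le w(1) by (auto simp: eventually_at_left_field intro!: exI[of _ "cmod w"])
    qed simp
    then show ?thesis by simp
  qed
  have fl: "filterlim (\<lambda>y::real. \<i> * of_real y) (at 0) (at_right 0)"
    unfolding filterlim_at by (auto intro!: tendsto_eq_intros simp: eventually_at_right_field intro: exI[of _ 1])
  have "(k has_field_derivative deriv k 0) (at 0)" using k(1) by (simp add: holomorphic_derivI)
  then have "((\<lambda>z. (k z - k 0) / z) \<longlongrightarrow> deriv k 0) (at 0)" by (simp add: DERIV_def)
  from filterlim_compose[OF this fl]
  have lim: "((\<lambda>y. Re ((k (\<i> * of_real y) - k 0) / (\<i> * of_real y))) \<longlongrightarrow> Re (deriv k 0)) (at_right 0)"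
    by (rule tendsto_Re)
  show ?thesis
  proof (rule tendsto_lowerbound[OF lim])
    have "eventually (\<lambda>y::real. 0 < y \<and> y < 1) (at_right 0)"
      using eventually_at_right_field zero_less_one by blast
    then show "\<forall>\<^sub>F y in at_right 0. - 1 \<le> Re ((k (\<i> * of_real y) - k 0) / (\<i> * of_real y))"
    proof eventually_elim
      case (elim y)
      have "0 \<le> Im (k (\<i> * of_real y)) + y"
        using bound[of "\<i> * of_real y"] elim by (simp add: norm_mult)
      \<comment> \<open>Dividing by iy turns the imaginary part of k(iy) - k(0) into a real part,
        and k(0) is real; along this ray the bound becomes one for Re k'(0).\<close>
      moreover have "Re ((k (\<i> * of_real y) - k 0) / (\<i> * of_real y)) = Im (k (\<i> * of_real y)) / y"
        using kr(1) elim by (simp add: Re_divide complex_is_Real_iff power2_eq_square)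
      moreover have "- 1 \<le> v / y" if "0 \<le> v + y" for v using that elim by (simp add: field_simps)
      ultimately show ?case by metis
    qed
  qed simp
qed

section \<open>The coefficient inequality\<close>

text \<open>Under z = exp(iq) this filter is the approach to 0 from the upper half-disc.\<close>

definition half_strip_end :: "complex filter" where
  "half_strip_end = inf (filtercomap Im at_top) (principal half_strip)"

lemma eventually_half_strip_end:
  "eventually Q half_strip_end \<longleftrightarrow> (\<exists>s. \<forall>q\<in>half_strip. s \<le> Im q \<longrightarrow> Q q)"
  unfolding half_strip_end_def eventually_inf_principal eventually_filtercomap eventually_at_top_linorder
proof safe
  fix R s assume "\<forall>n\<ge>s. R n" "\<forall>x. R (Im x) \<longrightarrow> x \<in> half_strip \<longrightarrow> Q x"
  then show "\<exists>s. \<forall>q\<in>half_strip. s \<le> Im q \<longrightarrow> Q q" by (intro exI[of _ s]) auto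
next
  fix s assume "\<forall>q\<in>half_strip. s \<le> Im q \<longrightarrow> Q q"
  then show "\<exists>R. (\<exists>N. \<forall>n\<ge>N. R n) \<and> (\<forall>x. R (Im x) \<longrightarrow> x \<in> half_strip \<longrightarrow> Q x)"
    by (intro exI[of _ "\<lambda>t. s \<le> t"]) auto
qed

lemma exp_mult_half_strip_end: "filterlim (\<lambda>q. exp (\<i> * q)) (at 0) half_strip_end"
  "((\<lambda>q. q * exp (\<i> * q)) \<longlongrightarrow> 0) half_strip_end"
proof -
  have lim: "((\<lambda>q. h (Im q)) \<longlongrightarrow> 0) half_strip_end" if "(h \<longlongrightarrow> 0) at_top" for h :: "real \<Rightarrow> real"
    using filterlim_compose[OF that filterlim_mono[OF filterlim_filtercomap order_refl, of half_strip_end Im at_top]]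
    by (simp add: half_strip_end_def)
  have "((\<lambda>s::real. exp (- s)) \<longlongrightarrow> 0) at_top"
    by (rule filterlim_compose[OF exp_at_bot filterlim_uminus_at_bot_at_top])
  from lim[OF this] have 1: "((\<lambda>q. exp (- Im q)) \<longlongrightarrow> 0) half_strip_end" .
  have "((\<lambda>q. exp (\<i> * q)) \<longlongrightarrow> 0) half_strip_end"
    by (rule Lim_null_comparison[OF _ 1]) (simp add: norm_exp_eq_Re)
  then show "filterlim (\<lambda>q. exp (\<i> * q)) (at 0) half_strip_end"
    by (simp add: filterlim_at)
  have "((\<lambda>s::real. (pi + s) * exp (- s)) \<longlongrightarrow> 0) at_top"
  proof -
    have "((\<lambda>s::real. pi * exp (- s) + s ^ 1 / exp s) \<longlongrightarrow> pi * 0 + 0) at_top"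
      by (intro tendsto_intros tendsto_power_div_exp_0 filterlim_compose[OF exp_at_bot filterlim_uminus_at_bot_at_top])
    then show ?thesis by (simp add: exp_minus field_simps)
  qed
  from lim[OF this] have 2: "((\<lambda>q. (pi + Im q) * exp (- Im q)) \<longlongrightarrow> 0) half_strip_end" .
  show "((\<lambda>q. q * exp (\<i> * q)) \<longlongrightarrow> 0) half_strip_end"
  proof (rule Lim_null_comparison[OF _ 2])
    show "\<forall>\<^sub>F q in half_strip_end. norm (q * exp (\<i> * q)) \<le> (pi + Im q) * exp (- Im q)"
      unfolding eventually_half_strip_end using cmod_closed_half_strip_le half_strip_subset
      by (intro exI[of _ 0]) (auto simp: norm_mult norm_exp_eq_Re intro!: mult_right_mono)
  qed
qed

text \<open>Here 2 sin q exp(iq) = i(1 - exp(2iq)), and the linear term is negligible against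
  exp(-iq). For w the value of \<open>strip_map\<close> and z = exp(iq) this says that wz tends to
  i, which converts derivatives at z = 0 into coefficients of 1/w.\<close>

lemma strip_map_exp_tendsto: "((\<lambda>q. strip_map b q * exp (\<i> * q)) \<longlongrightarrow> \<i>) half_strip_end"
proof -
  have z: "((\<lambda>q. exp (\<i> * q)) \<longlongrightarrow> 0) half_strip_end"
    using exp_mult_half_strip_end(1) by (simp add: filterlim_at)
  have "((\<lambda>q. \<i> * (1 - exp (\<i> * q) * exp (\<i> * q)) + of_real b * (q * exp (\<i> * q))) \<longlongrightarrow> \<i> * (1 - 0 * 0) + of_real b * 0) half_strip_end"
    by (intro tendsto_intros z exp_mult_half_strip_end(2))
  moreover have "strip_map b q * exp (\<i> * q) = \<i> * (1 - exp (\<i> * q) * exp (\<i> * q)) + of_real b * (q * exp (\<i> * q))" for q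
    by (simp add: strip_map_def sin_exp_eq exp_minus field_simps)
  ultimately show ?thesis by simp
qed

lemma eventually_half_strip_end_strip_map:
  assumes b: "0 < b" "b \<le> 2" and ev: "eventually Q half_strip_end"
  shows "\<exists>R. \<forall>q\<in>half_strip. R \<le> cmod (strip_map b q) \<longrightarrow> Q q"
proof -
  obtain s where s: "\<forall>q\<in>half_strip. s \<le> Im q \<longrightarrow> Q q"
    using ev unfolding eventually_half_strip_end by blast
  have "Q q" if q: "q \<in> half_strip" "2 * exp s + 2 * (pi + s) \<le> cmod (strip_map b q)" for q
  proof -
    have "cmod (strip_map b q) \<le> 2 * exp (Im q) + 2 * (pi + Im q)"
      using strip_map_norm_le[OF b] q(1) half_strip_subset by blast
    moreover have "exp (Im q) < exp s" if "Im q < s" using that by simp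
    ultimately have "s \<le> Im q" using q(2) by (smt (verit))
    then show "Q q" using s q(1) by blast
  qed
  then show ?thesis by blast
qed

section \<open>Boundary values of Re(sin p + p)\<close>

text \<open>For \<open>c = cos p\<close> the function \<open>confocal\<close> is $\cos(\mathrm{Re}\,p)$ (the points with the same real part
  form a hyperbola with foci $\pm1$). It is continuous on the whole plane, which gives the boundary behaviour
  of $\mathrm{Re}(\sin p+p)$ across the cuts of \<open>Arccos\<close>.\<close>

definition confocal :: "complex \<Rightarrow> real" where
  "confocal c = (cmod (c + 1) - cmod (c - 1)) / 2"

lemma confocal_cos:
  assumes "0 \<le> Re p" "Re p \<le> pi"
  shows "confocal (cos p) = cos (Re p)"
proof -
  have ch: "1 \<le> cosh (Im p)" by (rule cosh_real_ge_1)
  have s: "(sin (Re p))\<^sup>2 = 1 - (cos (Re p))\<^sup>2" "(sinh (Im p))\<^sup>2 = (cosh (Im p))\<^sup>2 - 1"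
    by (simp_all add: sin_squared_eq cosh_square_eq)
  have sq: "(cmod (cos p + 1))\<^sup>2 = (cosh (Im p) + cos (Re p))\<^sup>2" "(cmod (cos p - 1))\<^sup>2 = (cosh (Im p) - cos (Re p))\<^sup>2"
    unfolding cmod_power2 
    by (simp_all add: Re_cos_cosh Im_cos_sinh power_mult_distrib s) (simp_all add: power2_eq_square algebra_simps)
  have "cmod (cos p + 1) = cosh (Im p) + cos (Re p)" "cmod (cos p - 1) = cosh (Im p) - cos (Re p)"
    using sq ch cos_ge_minus_one[of "Re p"] cos_le_one[of "Re p"]
    by (auto intro!: power2_eq_imp_eq)
  then show ?thesis by (simp add: confocal_def)
qed

lemma confocal_bounds: "- 1 \<le> confocal c" "confocal c \<le> 1"
  using norm_triangle_ineq2[of "c + 1" "c - 1"] norm_triangle_ineq2[of "c - 1" "c + 1"]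
  by (simp_all add: confocal_def norm_minus_commute)

text \<open>Extends Re(sin p + p), as a function of c = cos p, continuously to the plane:
  \<open>arccos\<close> returns Re p, and the root is sin(Re p) cosh(Im p), since Im c = -sin(Re p)
  sinh(Im p).\<close>

definition confocal_width :: "complex \<Rightarrow> real" where
  "confocal_width c = arccos (confocal c) + sqrt (1 - (confocal c)\<^sup>2 + (Im c)\<^sup>2)"

lemma Re_sin_add_eq_confocal_width:
  assumes "p \<in> half_strip"
  shows "Re (sin p + p) = confocal_width (cos p)"
proof -
  have p: "0 \<le> Re p" "Re p \<le> pi" "0 < Im p" using assms by (auto simp: half_strip_def)
  have "(sin (Re p) * cosh (Im p))\<^sup>2 = 1 - (cos (Re p))\<^sup>2 + (Im (cos p))\<^sup>2"
    by (simp add: Im_cos_sinh power_mult_distrib cosh_square_eq sin_squared_eq algebra_simps)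
  moreover have "0 \<le> sin (Re p) * cosh (Im p)" using sin_ge_zero[OF p(1,2)] by simp
  ultimately have "sin (Re p) * cosh (Im p) = sqrt (1 - (cos (Re p))\<^sup>2 + (Im (cos p))\<^sup>2)"
    by (metis real_sqrt_unique)
  then show ?thesis
    using p by (simp add: confocal_width_def confocal_cos[OF p(1,2)] Re_sin_cosh arccos_cos)
qed

lemma continuous_confocal_width: "continuous_on UNIV confocal_width"
proof -
  have c: "continuous_on UNIV confocal" unfolding confocal_def by (intro continuous_intros) auto
  show ?thesis unfolding confocal_width_def by (intro continuous_intros c) (use confocal_bounds in auto)
qed

lemma confocal_width_real_gt_1: "1 < x \<Longrightarrow> confocal_width (of_real x) = 0"
proof -
  assume "1 < x"
  moreover have "complex_of_real x + 1 = of_real (x + 1)" "complex_of_real x - 1 = of_real (x - 1)" by simp_all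
  ultimately have "confocal (of_real x) = 1"
    unfolding confocal_def by (simp only: norm_of_real) simp
  then show ?thesis by (simp add: confocal_width_def)
qed

text \<open>With a = arccos(confocal c) the width of a real point is a + sin a = a + sin(pi - a) <=
  pi.\<close>

lemma confocal_width_real_le: "c \<in> \<real> \<Longrightarrow> confocal_width c \<le> pi"
proof -
  assume c: "c \<in> \<real>"
  define a where "a = arccos (confocal c)"
  have a: "0 \<le> a" "a \<le> pi" "cos a = confocal c"
    using arccos_bounded[OF confocal_bounds] cos_arccos[OF confocal_bounds] by (auto simp: a_def)
  have "sqrt (1 - (confocal c)\<^sup>2 + (Im c)\<^sup>2) = \<bar>sin a\<bar>"
    using c by (simp add: a(3)[symmetric] complex_is_Real_iff sin_squared_eq[symmetric])
  also have "\<dots> = sin (pi - a)" using sin_ge_zero[OF a(1,2)] by simp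
  also have "\<dots> \<le> pi - a" using a sin_x_le_x[of "pi - a"] by simp
  finally show ?thesis by (simp add: confocal_width_def a_def)
qed

section \<open>Vertical edges of the half-strip and of the step domain\<close>

lemma closure_step_domain_subset:
  assumes b: "0 < b" "b \<le> 2"
  shows "closure (step_domain (b * pi)) \<subseteq> strip_map b ` closed_half_strip"
  using step_domain_subset_strip_map_image[OF b] half_strip_subset
  by (intro closure_minimal closed_strip_map_image[OF b]) blast

lemma Complex_in_closure_step_domain:
  assumes "0 \<le> m"
  shows "0 \<le> x \<Longrightarrow> 0 \<le> y \<Longrightarrow> Complex x y \<in> closure (step_domain m)"
    and "m \<le> x \<Longrightarrow> y \<le> 0 \<Longrightarrow> Complex x y \<in> closure (step_domain m)"
proof -
  have *: "Complex x y \<in> closure (step_domain m)" if s: "\<And>e. e > 0 \<Longrightarrow> Complex (x + e) (y + \<sigma> * e) \<in> step_domain m" "\<bar>\<sigma>\<bar> = 1" for \<sigma>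
    unfolding closure_approachable
  proof (intro allI impI)
    fix e :: real assume e: "e > 0"
    have "dist (Complex (x + e/3) (y + \<sigma> * (e/3))) (Complex x y) = cmod (Complex (e/3) (\<sigma> * (e/3)))"
      by (simp add: dist_norm complex_diff)
    also have "\<dots> \<le> \<bar>e/3\<bar> + \<bar>\<sigma> * (e/3)\<bar>" using cmod_le[of "Complex (e/3) (\<sigma> * (e/3))"] by simp
    also have "\<dots> < e" using e s(2) by (simp add: abs_mult)
    finally show "\<exists>w\<in>step_domain m. dist w (Complex x y) < e" using s(1)[of "e/3"] e by auto
  qed
  show "0 \<le> x \<Longrightarrow> 0 \<le> y \<Longrightarrow> Complex x y \<in> closure (step_domain m)"
    by (rule *[of 1]) (auto simp: step_domain_def)
  show "m \<le> x \<Longrightarrow> y \<le> 0 \<Longrightarrow> Complex x y \<in> closure (step_domain m)"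
    by (rule *[of "-1"]) (auto simp: step_domain_def)
qed

text \<open>A preimage exists because the closed image contains the closure of the step domain. Both
  terms of its real part are nonnegative and their sum is 0, which puts it on the left edge.\<close>

lemma strip_map_left_edge:
  assumes b: "0 < b" "b \<le> 2" and y: "0 < y"
  obtains s where "0 < s" "strip_map b (Complex 0 s) = Complex 0 y"
proof -
  obtain q where q: "q \<in> closed_half_strip" "strip_map b q = Complex 0 y"
    using closure_step_domain_subset[OF b] Complex_in_closure_step_domain(1)[of "b * pi" 0 y] b y by fastforce
  have nn: "0 \<le> sin (Re q) * cosh (Im q)" "0 \<le> b * Re q"
    using q b sin_ge_zero[of "Re q"] by (auto simp: closed_half_strip_def)
  have "Re (strip_map b q) = 0" by (simp add: q)
  then have "b * Re q = 0" using nn unfolding strip_map_Re_Im by linarith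
  then have Re0: "Re q = 0" using b by simp
  have "Im (strip_map b q) = y" by (simp add: q)
  then have "Im q \<noteq> 0" using y by (auto simp: strip_map_Re_Im)
  then have "0 < Im q" using q(1) by (simp add: closed_half_strip_def)
  moreover have "q = Complex 0 (Im q)" using Re0 by (simp add: complex_eq_iff)
  ultimately show ?thesis using that[of "Im q"] q(2) by simp
qed

lemma strip_map_right_edge:
  assumes b: "0 < b" "b \<le> 2" and y: "y < 0"
  obtains s where "0 < s" "strip_map b (Complex pi s) = Complex (b * pi) y"
proof -
  obtain q where q: "q \<in> closed_half_strip" "strip_map b q = Complex (b * pi) y"
    using closure_step_domain_subset[OF b] Complex_in_closure_step_domain(2)[of "b * pi" "b * pi" y] b y by fastforce
  have eq: "Re (strip_map b q) = b * pi" "Im (strip_map b q) = y" by (simp_all add: q)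
  have "Im q \<noteq> 0" using y eq(2) by (auto simp: strip_map_Re_Im)
  then have Im: "0 < Im q" using q(1) by (simp add: closed_half_strip_def)
  have "Re q \<noteq> 0" using eq(1) b by (auto simp: strip_map_Re_Im)
  moreover have "\<not> (0 < Re q \<and> Re q < pi)"
    using strip_map_right_of_step[OF b, of q] Im y eq by auto
  ultimately have "Re q = pi" using q(1) by (auto simp: closed_half_strip_def)
  then have "q = Complex pi (Im q)" by (simp add: complex_eq_iff)
  then show ?thesis using that[of "Im q"] q(2) Im by simp
qed

text \<open>The continuous function t/f(t) = 1 - t k(t) on [0, x] starts at 1 and has no zero for t
  > 0, so it stays positive.\<close>

lemma typically_real_schlicht_pos:
  assumes f: "f \<in> schlicht \<inter> typically_real" and x: "0 < x" "x < 1"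
  shows "f (of_real x) \<in> \<real>" "0 < Re (f (of_real x))"
proof -
  obtain k where k: "k holomorphic_on ball 0 1" "\<And>z. z \<in> ball 0 1 \<Longrightarrow> z \<noteq> 0 \<Longrightarrow> k z = 1 / z - 1 / f z"
    using reciprocal_difference_extends f by blast
  have fr: "f (of_real t) \<in> \<real>" if "0 < t" "t < 1" for t
    using f that by (auto simp: typically_real_def)
  show "f (of_real x) \<in> \<real>" by (rule fr[OF x])
  define h where "h = (\<lambda>t::real. Re (1 - of_real t * k (of_real t)))"
  have h_eq: "h t = t / Re (f (of_real t))" and nz: "Re (f (of_real t)) \<noteq> 0" if t: "0 < t" "t < 1" for t
  proof -
    have tb: "complex_of_real t \<in> ball 0 1" "complex_of_real t \<noteq> 0" using t by auto
    have f0: "f (of_real t) \<noteq> 0" using schlicht_nonzero[OF _ tb] f by blast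
    have fe: "f (of_real t) = of_real (Re (f (of_real t)))" using fr[OF t] by simp
    then show "Re (f (of_real t)) \<noteq> 0" using f0 by auto
    have "1 - of_real t * k (of_real t) = of_real t / f (of_real t)"
      using tb f0 by (simp add: k(2)[OF tb] right_diff_distrib)
    also have "\<dots> = of_real (t / Re (f (of_real t)))" by (subst fe) simp
    finally show "h t = t / Re (f (of_real t))" unfolding h_def by (simp only: Re_complex_of_real)
  qed
  have cont: "continuous_on {0..x} h"
    unfolding h_def using x
    by (intro continuous_intros continuous_on_compose2[OF holomorphic_on_imp_continuous_on[OF k(1)]]) auto
  have "0 < h x"
  proof (rule ccontr)
    assume "\<not> 0 < h x"
    then obtain t where t: "0 \<le> t" "t \<le> x" "h t = 0"
      using IVT2'[of h x 0 0] cont x by (auto simp: h_def)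
    then have "t \<noteq> 0" by (auto simp: h_def)
    then show False using h_eq[of t] nz[of t] t x by auto
  qed
  then show "0 < Re (f (of_real x))" using h_eq[OF x] x by (simp add: zero_less_divide_iff)
qed

text \<open>The image of the disc of radius \<open>r\<close> contains a disc about 0, and univalence
  keeps the remaining points out of it. This bounds cos p wherever w is bounded.\<close>

lemma schlicht_bounded_below:
  assumes f: "f \<in> schlicht" and r: "0 < r" "r < 1"
  obtains c where "0 < c" "\<And>z. r \<le> cmod z \<Longrightarrow> cmod z < 1 \<Longrightarrow> c \<le> cmod (f z)"
proof -
  have hf: "f holomorphic_on ball 0 1" "inj_on f (ball 0 1)" "f 0 = 0" using f by (auto simp: schlicht_def)
  have sub: "ball 0 r \<subseteq> ball (0::complex) 1" using r by auto
  have "open (f ` ball 0 r)"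
    using hf sub by (intro open_mapping_thm3) (auto intro: holomorphic_on_subset inj_on_subset)
  moreover have "0 \<in> f ` ball 0 r" using hf(3) r by (auto intro!: image_eqI[of _ _ 0])
  ultimately obtain c where c: "0 < c" "ball 0 c \<subseteq> f ` ball 0 r" by (meson open_contains_ball)
  show ?thesis
  proof (rule that[OF c(1)])
    fix z assume z: "r \<le> cmod z" "cmod z < 1"
    show "c \<le> cmod (f z)"
    proof (rule ccontr)
      assume "\<not> c \<le> cmod (f z)"
      then have "f z \<in> ball 0 c" by simp
      then obtain w where "w \<in> ball 0 r" "f z = f w" using c(2) by blast
      then have "z = w" using inj_onD[OF hf(2)] z sub by auto
      then show False using z \<open>w \<in> ball 0 r\<close> by simp
    qed
  qed
qed

lemma exp_half_strip:
  assumes "q \<in> half_strip"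
  shows "cmod (exp (\<i> * q)) < 1" "0 < Im (exp (\<i> * q))"
  using assms sin_gt_zero[of "Re q"] by (auto simp: half_strip_def norm_exp_eq_Re Im_exp)

lemma inj_on_exp_half_strip: "inj_on (\<lambda>q. exp (\<i> * q)) half_strip"
proof (rule inj_onI)
  fix p q assume pq: "p \<in> half_strip" "q \<in> half_strip" "exp (\<i> * p) = exp (\<i> * q)"
  have "\<i> * p = \<i> * q"
  proof (rule exp_complex_eqI[OF _ pq(3)])
    show "\<bar>Im (\<i> * p) - Im (\<i> * q)\<bar> < 2 * pi" using pq(1,2) by (auto simp: half_strip_def)
  qed
  then show "p = q" by simp
qed

theorem real_univalent_coefficient_inequality:
  assumes f: "f \<in> schlicht \<inter> typically_real"
    and k: "k holomorphic_on ball 0 1" "\<And>z. z \<in> ball 0 1 \<Longrightarrow> z \<noteq> 0 \<Longrightarrow> k z = 1 / z - 1 / f z"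
    and b: "0 < b" "b \<le> 2"
  shows "Re (deriv k 0) + 2 * b * Re (k 0) \<le> 1 + 3 * b\<^sup>2 / 2 - b\<^sup>2 * ln (b / 2)"
proof -
  let ?S = half_strip and ?D = "step_domain (b * pi)"
  have hf: "f holomorphic_on ball 0 1" "inj_on f (ball 0 1)" "f 0 = 0" "deriv f 0 = 1"
    using f by (auto simp: schlicht_def)
  have fS: "f \<in> schlicht" using f by blast
  have Uball: "exp (\<i> * q) \<in> ball 0 1" if "q \<in> ?S" for q using exp_half_strip[OF that] by simp
  have fpos: "0 < Im (f (exp (\<i> * q)))" if "q \<in> ?S" for q
  proof -
    have "exp (\<i> * q) \<notin> \<real>" using exp_half_strip(2)[OF that] by (auto simp: complex_is_Real_iff)
    then have "Im (f (exp (\<i> * q))) * Im (exp (\<i> * q)) > 0"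
      using f Uball[OF that] unfolding typically_real_def by blast
    then show ?thesis using exp_half_strip(2)[OF that] by (simp add: zero_less_mult_iff)
  qed
  define C where "C = (\<lambda>z. 1 + 1 / (of_real b * f z))"
  have ImC: "Im (C (exp (\<i> * q))) < 0" if "q \<in> ?S" for q
  proof -
    have "Im (1 / (of_real b * f (exp (\<i> * q)))) = Im (1 / f (exp (\<i> * q))) / b"
    proof -
      have "1 / (of_real b * f (exp (\<i> * q))) = of_real (1 / b) * (1 / f (exp (\<i> * q)))" by simp
      then show ?thesis by (simp only: complex.sel times_complex.sel Re_complex_of_real Im_complex_of_real) simp
    qed
    moreover have "Im (1 / f (exp (\<i> * q))) < 0"
      using fpos[OF that] by (auto simp: Im_divide divide_less_0_iff sum_power2_gt_zero_iff)
    ultimately show ?thesis using b by (simp add: C_def divide_less_0_iff)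
  qed
  define P where "P = (\<lambda>q. Arccos (C (exp (\<i> * q))))"
  have PS: "P q \<in> ?S" if "q \<in> ?S" for q unfolding P_def by (rule Arccos_half_strip[OF ImC[OF that]])
  have cosP: "cos (P q) = C (exp (\<i> * q))" for q by (simp add: P_def)
  have holP: "P holomorphic_on ?S"
  proof -
    have "(\<lambda>q. exp (\<i> * q)) holomorphic_on ?S" by (intro holomorphic_intros)
    then have "(\<lambda>q. f (exp (\<i> * q))) holomorphic_on ?S"
      using holomorphic_on_compose_gen[of "\<lambda>q. exp (\<i> * q)" ?S f "ball 0 1"] hf(1) image_subsetI[of ?S "\<lambda>q. exp (\<i> * q)", OF Uball]
      by (simp only: o_def)
    then have "(\<lambda>q. C (exp (\<i> * q))) holomorphic_on ?S"
      unfolding C_def using b fpos by (intro holomorphic_intros) force+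
    moreover have "Arccos holomorphic_on {c. Im c < 0}" by (rule holomorphic_on_Arccos) auto
    ultimately show ?thesis
      unfolding P_def using holomorphic_on_compose_gen[of "\<lambda>q. C (exp (\<i> * q))" ?S Arccos "{c. Im c < 0}"] ImC
      by (auto simp: o_def)
  qed
  have injP: "inj_on P ?S"
  proof (rule inj_onI)
    fix p q assume pq: "p \<in> ?S" "q \<in> ?S" "P p = P q"
    then have "C (exp (\<i> * p)) = C (exp (\<i> * q))" using cosP by metis
    then have "f (exp (\<i> * p)) = f (exp (\<i> * q))" using b fpos[OF pq(1)] fpos[OF pq(2)] by (force simp: C_def)
    then have "exp (\<i> * p) = exp (\<i> * q)" using inj_onD[OF hf(2)] Uball pq by blast
    then show "p = q" using inj_onD[OF inj_on_exp_half_strip] pq by blast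
  qed
  define G where "G = (\<lambda>q. of_real b * (sin (P q) + P q))"
  \<comment> \<open>In this form the facts about \<open>strip_map\<close> with parameter 2 apply to
    the target; the factor b/2 turns the step 2 pi into b pi.\<close>
  have G2: "G q = of_real (b / 2) * strip_map 2 (P q)" for q by (simp add: G_def strip_map_def algebra_simps)
  define \<kappa> where "\<kappa> = strip_kernel b k f"
  have ident: "G q - strip_map b q = - (\<i> * \<kappa> (exp (\<i> * q)))" if "q \<in> ?S" for q
    unfolding G_def \<kappa>_def
  proof (rule strip_map_diff_eq_kernel[OF b(1) PS[OF that] that refl])
    show "Im (f (exp (\<i> * q))) \<noteq> 0" using fpos[OF that] by simp
    show "cos (P q) = 1 + 1 / (of_real b * f (exp (\<i> * q)))" by (simp add: cosP C_def)
    show "k (exp (\<i> * q)) = 1 / exp (\<i> * q) - 1 / f (exp (\<i> * q))"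
      using k(2)[OF Uball[OF that]] by simp
  qed
  obtain g where g: "g holomorphic_on (strip_map b ` ?S)" "\<And>q. q \<in> ?S \<Longrightarrow> g (strip_map b q) = q"
    using holomorphic_has_inverse[OF strip_map_holomorphic open_half_strip inj_on_strip_map] by metis
  have DS: "?D \<subseteq> strip_map b ` ?S" by (rule step_domain_subset_strip_map_image[OF b])
  have gD: "g w \<in> ?S" "strip_map b (g w) = w" if "w \<in> ?D" for w
    using DS that g(2) by auto
  define H where "H = (\<lambda>w. G (g w))"
  define c0 c1 where "c0 = Re (k 0) - b + b * ln (b / 2)" and "c1 = Re (deriv k 0) + b * Re (k 0) - b\<^sup>2 / 2 - 1"
  have kr: "k 0 \<in> \<real>" "deriv k 0 \<in> \<real>" using reciprocal_difference_real[OF _ k] f by auto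
  have df: "(f has_field_derivative 1) (at 0)" using holomorphic_derivI[OF hf(1), of 0] hf(4) by simp
  have dk: "(k has_field_derivative deriv k 0) (at 0)" using holomorphic_derivI[OF k(1), of 0] by simp
  have \<kappa>0: "\<kappa> 0 = of_real c0"
    unfolding \<kappa>_def strip_kernel_at_0(1)[OF b(1) hf(3) df dk] c0_def using kr by (simp add: complex_is_Real_iff complex_eq_iff)
  have \<kappa>1: "(\<kappa> has_field_derivative (of_real c1)) (at 0)"
  proof -
    have "deriv k 0 + of_real b * k 0 - (of_real b)\<^sup>2 / 2 - 1 = of_real c1"
      using kr by (simp add: c1_def complex_is_Real_iff complex_eq_iff power2_eq_square)
    then show ?thesis using strip_kernel_at_0(2)[OF b(1) hf(3) df dk] by (simp add: \<kappa>_def)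
  qed
  have "pi * c1 \<le> - (b * pi) * c0"
  proof (rule step_domain_inequality[where H = H])
    show "0 \<le> b * pi" using b by simp
    have holG: "G holomorphic_on ?S" unfolding G_def by (intro holomorphic_intros holP)
    have holg: "g holomorphic_on ?D" using g(1) DS by (rule holomorphic_on_subset)
    show "H holomorphic_on ?D"
      unfolding H_def using holomorphic_on_compose_gen[OF holg holG] gD(1) by (auto simp: o_def)
    show "inj_on H ?D"
    proof (rule inj_onI)
      fix v w assume vw: "v \<in> ?D" "w \<in> ?D" "H v = H w"
      then have "strip_map 2 (P (g v)) = strip_map 2 (P (g w))" using b by (simp add: H_def G2)
      then have "P (g v) = P (g w)" using inj_onD[OF inj_on_strip_map] PS gD(1) vw by blast
      then have "g v = g w" using inj_onD[OF injP] gD(1) vw by blast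
      then show "v = w" using gD(2) vw by metis
    qed
    show "0 < Re (H w)" if "w \<in> ?D" for w
      using strip_map_Re_pos[of 2, OF _ PS[OF gD(1)[OF that]]] b by (simp add: H_def G2)
    show "b * pi < Re (H w)" if "w \<in> ?D" "Im (H w) \<le> 0" for w
    proof -
      have "Im (strip_map 2 (P (g w))) \<le> 0" using that(2) b by (simp add: H_def G2 mult_le_0_iff)
      then have "2 * pi < Re (strip_map 2 (P (g w)))"
        using strip_map_right_of_step[of 2 "P (g w)"] PS[OF gD(1)[OF that(1)]] by (simp add: half_strip_def)
      then show ?thesis using b by (simp add: H_def G2)
    qed
    \<comment> \<open>H w - w equals -i \<kappa>(z) with z = exp(iq). Its difference quotient at 0
      tends to c1, and multiplying it by -i wz, which tends to 1, gives the required limit.\<close>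
    show "\<exists>R. \<forall>w\<in>?D. R \<le> cmod w \<longrightarrow> cmod (w * (H w - w + \<i> * of_real c0) - of_real c1) \<le> e" if e: "e > 0" for e
    proof -
      have "((\<lambda>z. (\<kappa> z - \<kappa> 0) / z) \<longlongrightarrow> of_real c1) (at 0)" using \<kappa>1 by (simp add: DERIV_def)
      from filterlim_compose[OF this exp_mult_half_strip_end(1)]
      have "((\<lambda>q. (\<kappa> (exp (\<i> * q)) - \<kappa> 0) / exp (\<i> * q)) \<longlongrightarrow> of_real c1) half_strip_end" .
      then have "((\<lambda>q. (strip_map b q * exp (\<i> * q)) * (- \<i>) * ((\<kappa> (exp (\<i> * q)) - \<kappa> 0) / exp (\<i> * q))) \<longlongrightarrow> \<i> * (- \<i>) * of_real c1) half_strip_end"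
        by (intro tendsto_mult strip_map_exp_tendsto tendsto_const)
      from eventually_half_strip_end_strip_map[OF b tendstoD[OF this e]]
      obtain R where R: "\<forall>q\<in>?S. R \<le> cmod (strip_map b q) \<longrightarrow>
        dist ((strip_map b q * exp (\<i> * q)) * (- \<i>) * ((\<kappa> (exp (\<i> * q)) - \<kappa> 0) / exp (\<i> * q))) (\<i> * (- \<i>) * of_real c1) < e" ..
      show ?thesis
      proof (intro exI ballI impI)
        fix w assume w: "w \<in> ?D" "R \<le> cmod w"
        let ?z = "exp (\<i> * g w)"
        have "H w - w = - (\<i> * \<kappa> ?z)" using ident[OF gD(1)[OF w(1)]] gD(2)[OF w(1)] by (simp add: H_def)
        then have "H w - w + \<i> * of_real c0 = - \<i> * (\<kappa> ?z - \<kappa> 0)"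
          by (simp add: \<kappa>0 algebra_simps)
        then have "w * (H w - w + \<i> * of_real c0) = w * (- \<i>) * (\<kappa> ?z - \<kappa> 0)"
          by (simp only: mult.assoc)
        also have "\<dots> = (w * ?z) * (- \<i>) * ((\<kappa> ?z - \<kappa> 0) / ?z)" by simp
        finally show "cmod (w * (H w - w + \<i> * of_real c0) - of_real c1) \<le> e"
          using bspec[OF R gD(1)[OF w(1)]] w gD(2)[OF w(1)] by (simp add: dist_norm)
      qed
    qed
    show "\<exists>R'. \<forall>w\<in>?D. cmod w < R \<longrightarrow> cmod (H w) \<le> R'" for R
    proof -
      \<comment> \<open>A bound on w bounds Im q by \<sigma>, hence |z| from below, |f(z)| from
        below, |cos p| from above and finally |p|. The maximum with 1 keeps exp(-\<sigma>) <
        1.\<close>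
      define \<sigma> where "\<sigma> = max 1 (4 + R + 2 * pi)"
      have "0 < exp (- \<sigma>)" "exp (- \<sigma>) < 1" by (auto simp: \<sigma>_def)
      then obtain c where c: "0 < c" "\<And>z. exp (- \<sigma>) \<le> cmod z \<Longrightarrow> cmod z < 1 \<Longrightarrow> c \<le> cmod (f z)"
        using schlicht_bounded_below[OF fS] by metis
      define M where "M = 1 + 1 / (b * c)"
      show ?thesis
      proof (intro exI ballI impI)
        fix w assume w: "w \<in> ?D" "cmod w < R"
        let ?q = "g w"
        have q: "?q \<in> ?S" "strip_map b ?q = w" using gD w by auto
        have "Im ?q \<le> \<sigma>"
          using strip_map_Im_bound[OF b, of ?q R] q w half_strip_subset by (auto simp: \<sigma>_def)
        then have "exp (- \<sigma>) \<le> cmod (exp (\<i> * ?q))" by (simp add: norm_exp_eq_Re)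
        then have fc: "c \<le> cmod (f (exp (\<i> * ?q)))" using c(2) exp_half_strip[OF q(1)] by blast
        have "cmod (C (exp (\<i> * ?q))) \<le> 1 + cmod (1 / (of_real b * f (exp (\<i> * ?q))))"
          unfolding C_def by (rule order_trans[OF norm_triangle_ineq]) simp
        also have "\<dots> \<le> M"
          unfolding M_def using fc c(1) b by (auto simp: norm_divide norm_mult intro!: divide_left_mono mult_left_mono mult_pos_pos)
        finally have CM: "cmod (cos (P ?q)) \<le> M" by (simp add: cosP)
        have "(cmod (sin (P ?q)))\<^sup>2 = cmod (1 - (cos (P ?q))\<^sup>2)" by (simp add: sin_squared_eq[symmetric] norm_power)
        also have "\<dots> \<le> 1 + (cmod (cos (P ?q)))\<^sup>2" using norm_triangle_ineq4[of 1 "(cos (P ?q))\<^sup>2"] by (simp add: norm_power)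
        also have "\<dots> \<le> (1 + M)\<^sup>2"
        proof -
          have "(cmod (cos (P ?q)))\<^sup>2 \<le> M\<^sup>2" using CM by (intro power_mono) auto
          moreover have "0 \<le> M" using CM norm_ge_zero order_trans by blast
          ultimately show ?thesis by (simp add: power2_eq_square algebra_simps)
        qed
        finally have sinP: "cmod (sin (P ?q)) \<le> 1 + M"
          by (rule power2_le_imp_le) (use CM norm_ge_zero[of "cos (P ?q)"] in linarith)
        have PSq: "P ?q \<in> ?S" by (rule PS[OF q(1)])
        then have "Im (P ?q) \<le> 1 + M"
          using sinP sinh_le_cmod_sin[of "P ?q"] less_sinh[of "Im (P ?q)"] by (simp add: half_strip_def)
        then have "cmod (P ?q) \<le> pi + (1 + M)" using cmod_closed_half_strip_le[of "P ?q"] PSq half_strip_subset by fastforce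
        then have "cmod (sin (P ?q) + P ?q) \<le> (1 + M) + (pi + (1 + M))"
          using sinP norm_triangle_ineq[of "sin (P ?q)" "P ?q"] by linarith
        then show "cmod (H w) \<le> b * ((1 + M) + (pi + (1 + M)))"
          using b by (simp add: H_def G_def norm_mult)
      qed
    qed
    have ReH: "Re (H w) = b * confocal_width (C (exp (\<i> * g w)))" if "w \<in> ?D" for w
      using Re_sin_add_eq_confocal_width[OF PS[OF gD(1)[OF that]]] by (simp add: H_def G_def cosP)
    \<comment> \<open>Re H is a continuous function of C(z), so its boundary limit follows once
      \<open>g\<close> tends to \<open>q0\<close>; for that the fibre over \<open>w0\<close> in the
      closed half-strip must be the single point \<open>q0\<close>.\<close>
    have bdry: "eventually (\<lambda>w. Re (H w) < l + e) (at w0 within ?D)"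
      if q0: "\<And>q. q \<in> closed_half_strip \<Longrightarrow> strip_map b q = w0 \<Longrightarrow> q = q0"
        and z0: "exp (\<i> * q0) \<in> ball 0 1" "exp (\<i> * q0) \<noteq> 0" and l: "b * confocal_width (C (exp (\<i> * q0))) \<le> l" and e: "e > 0" for w0 q0 l e
    proof -
      have evD: "eventually (\<lambda>w. w \<in> ?D) (at w0 within ?D)" by (simp add: eventually_at_filter)
      have "(g \<longlongrightarrow> q0) (at w0 within ?D)"
      proof (rule proper_map_inverse_tendsto[OF closed_closed_half_strip
            holomorphic_on_imp_continuous_on[OF strip_map_holomorphic] strip_map_proper[OF b] q0])
        have "eventually (\<lambda>w. w = strip_map b (g w)) (at w0 within ?D)"
          using evD by eventually_elim (simp add: gD)
        then show "((\<lambda>w. strip_map b (g w)) \<longlongrightarrow> w0) (at w0 within ?D)"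
          by (rule Lim_transform_eventually[OF tendsto_ident_at])
        show "eventually (\<lambda>w. g w \<in> closed_half_strip) (at w0 within ?D)"
          using evD by eventually_elim (use gD half_strip_subset in blast)
      qed
      then have "((\<lambda>w. exp (\<i> * g w)) \<longlongrightarrow> exp (\<i> * q0)) (at w0 within ?D)" by (intro tendsto_intros)
      moreover have "isCont f (exp (\<i> * q0))"
        using holomorphic_on_imp_continuous_on[OF hf(1)] z0(1) continuous_on_eq_continuous_at open_ball by blast
      ultimately have "((\<lambda>w. f (exp (\<i> * g w))) \<longlongrightarrow> f (exp (\<i> * q0))) (at w0 within ?D)"
        by (rule isCont_tendsto_compose[rotated])
      then have "((\<lambda>w. C (exp (\<i> * g w))) \<longlongrightarrow> C (exp (\<i> * q0))) (at w0 within ?D)"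
        unfolding C_def using schlicht_nonzero[OF fS z0] b by (intro tendsto_intros) auto
      moreover have "isCont confocal_width (C (exp (\<i> * q0)))"
        using continuous_confocal_width continuous_on_eq_continuous_at open_UNIV by blast
      ultimately have "((\<lambda>w. confocal_width (C (exp (\<i> * g w)))) \<longlongrightarrow> confocal_width (C (exp (\<i> * q0)))) (at w0 within ?D)"
        by (rule isCont_tendsto_compose[rotated])
      then have "((\<lambda>w. b * confocal_width (C (exp (\<i> * g w)))) \<longlongrightarrow> b * confocal_width (C (exp (\<i> * q0)))) (at w0 within ?D)"
        by (intro tendsto_intros)
      from order_tendstoD(2)[OF this, of "l + e"] have "eventually (\<lambda>w. b * confocal_width (C (exp (\<i> * g w))) < l + e) (at w0 within ?D)"
        using l e by simp
      then show ?thesis using evD by eventually_elim (simp add: ReH)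
    qed
    show "eventually (\<lambda>w. Re (H w) < e) (at (Complex 0 y) within ?D)" if y: "y > 0" and e: "e > 0" for y e
    proof -
      \<comment> \<open>The left edge corresponds to z in (0, 1), where f > 0. Hence C(z) is real
        and greater than 1, and the width vanishes.\<close>
      obtain s where s: "0 < s" "strip_map b (Complex 0 s) = Complex 0 y" using strip_map_left_edge[OF b y] .
      have z: "exp (\<i> * Complex 0 s) = of_real (exp (- s))"
        by (simp add: Complex_eq exp_of_real[symmetric])
      define x where "x = Re (f (of_real (exp (- s))))"
      have "f (of_real (exp (- s))) \<in> \<real>" "0 < x"
        using typically_real_schlicht_pos[OF f, of "exp (- s)"] s unfolding x_def by auto
      then have "C (of_real (exp (- s))) = of_real (1 + 1 / (b * x))" "0 < x"
        unfolding C_def x_def by (auto simp: complex_is_Real_iff complex_eq_iff)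
      moreover have "1 < 1 + 1 / (b * x)" using b \<open>0 < x\<close> by simp
      ultimately have "confocal_width (C (exp (\<i> * Complex 0 s))) = 0"
        unfolding z by (metis confocal_width_real_gt_1)
      then have "eventually (\<lambda>w. Re (H w) < 0 + e) (at (Complex 0 y) within ?D)"
        using strip_map_unique_left[OF b s(1)] s e by (intro bdry[where ?q0.0 = "Complex 0 s"]) (auto simp: z)
      then show ?thesis by simp
    qed
    show "eventually (\<lambda>w. Re (H w) < b * pi + e) (at (Complex (b * pi) y) within ?D)" if y: "y < 0" and e: "e > 0" for y e
    proof -
      \<comment> \<open>The right edge corresponds to z in (-1, 0), where C(z) is real, so the width
        is at most pi.\<close>
      obtain s where s: "0 < s" "strip_map b (Complex pi s) = Complex (b * pi) y" using strip_map_right_edge[OF b y] .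
      have z: "exp (\<i> * Complex pi s) = - of_real (exp (- s))"
      proof -
        have "\<i> * Complex pi s = \<i> * of_real pi + of_real (- s)" by (simp add: complex_eq_iff)
        then show ?thesis by (simp only: exp_add exp_of_real exp_pi_i') simp
      qed
      have zb: "- complex_of_real (exp (- s)) \<in> ball 0 1" using s by simp
      have "- complex_of_real (exp (- s)) \<in> \<real>" by (intro Reals_minus Reals_of_real)
      then have "f (- of_real (exp (- s))) \<in> \<real>" using f zb unfolding typically_real_def by blast
      then have "C (exp (\<i> * Complex pi s)) \<in> \<real>" unfolding z C_def by (intro Reals_add Reals_divide Reals_mult) auto
      then have "b * confocal_width (C (exp (\<i> * Complex pi s))) \<le> b * pi"
        using confocal_width_real_le b by simp
      then show ?thesis
        using strip_map_unique_right[OF b s(1)] s e zb by (intro bdry[where ?q0.0 = "Complex pi s"]) (auto simp: z)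
    qed
  qed
  then have "pi * (c1 + b * c0) \<le> pi * 0" by (simp add: algebra_simps)
  \<comment> \<open>Written out, this is D + 2bA - 3b^2/2 - 1 + b^2 ln(b/2) <= 0 with A = k(0) and D
    = k'(0).\<close>
  then have "c1 + b * c0 \<le> 0" by (simp only: mult_le_cancel_left_pos[OF pi_gt_zero])
  then show ?thesis by (simp add: c0_def c1_def power2_eq_square algebra_simps)
qed

section \<open>The extremal functions\<close>

text \<open>Meaningful only for \<open>q\<close> in the closed half-strip with positive imaginary part; edges go to edges.\<close>

definition strip_lift :: "real \<Rightarrow> complex \<Rightarrow> complex" where
  "strip_lift b q = (SOME p. p \<in> closed_half_strip \<and> 0 < Im p \<and> strip_map 2 p = of_real (2 / b) * strip_map b q
     \<and> (Re q = 0 \<longrightarrow> Re p = 0) \<and> (Re q = pi \<longrightarrow> Re p = pi) \<and> (q \<in> half_strip \<longrightarrow> p \<in> half_strip))"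

text \<open>On a vertical edge \<open>p\<close> is found on the corresponding target edge. For
  interior \<open>q\<close> the scaled point lies in the closure of the step domain but on no image
  of an edge, which forces \<open>p\<close> into the interior.\<close>

lemma strip_lift:
  assumes b: "0 < b" "b \<le> 2" and q: "q \<in> closed_half_strip" "0 < Im q"
  shows "strip_lift b q \<in> closed_half_strip" "0 < Im (strip_lift b q)"
    and "strip_map 2 (strip_lift b q) = of_real (2 / b) * strip_map b q"
    and "Re q = 0 \<Longrightarrow> Re (strip_lift b q) = 0" "Re q = pi \<Longrightarrow> Re (strip_lift b q) = pi"
    and "q \<in> half_strip \<Longrightarrow> strip_lift b q \<in> half_strip"
proof -
  define w where "w = of_real (2 / b) * strip_map b q"
  have w: "Re w = 2 / b * Re (strip_map b q)" "Im w = 2 / b * Im (strip_map b q)" by (simp_all add: w_def)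
  consider "Re q = 0" | "Re q = pi" | "q \<in> half_strip" using q by (force simp: closed_half_strip_def half_strip_def)
  then have "\<exists>p. p \<in> closed_half_strip \<and> 0 < Im p \<and> strip_map 2 p = w
     \<and> (Re q = 0 \<longrightarrow> Re p = 0) \<and> (Re q = pi \<longrightarrow> Re p = pi) \<and> (q \<in> half_strip \<longrightarrow> p \<in> half_strip)"
  proof cases
    case 1
    have "0 < Im w" using 1 q b by (simp add: w strip_map_Re_Im add_pos_pos)
    then obtain s where s: "0 < s" "strip_map 2 (Complex 0 s) = Complex 0 (Im w)"
      using strip_map_left_edge[of 2 "Im w"] by auto
    moreover have "w = Complex 0 (Im w)" using 1 by (simp add: complex_eq_iff w strip_map_Re_Im)
    ultimately show ?thesis using 1 by (intro exI[of _ "Complex 0 s"]) (auto simp: closed_half_strip_def half_strip_def)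
  next
    case 2
    have "b * Im q \<le> 2 * Im q" using b q by (intro mult_right_mono) auto
    then have "Im (strip_map b q) < 0" using less_sinh[OF q(2)] 2 by (simp add: strip_map_Re_Im)
    then have "Im w < 0" using b by (simp add: w divide_less_0_iff)
    then obtain s where s: "0 < s" "strip_map 2 (Complex pi s) = Complex (2 * pi) (Im w)"
      using strip_map_right_edge[of 2 "Im w"] by auto
    moreover have "w = Complex (2 * pi) (Im w)" using 2 b by (simp add: complex_eq_iff w strip_map_Re_Im)
    ultimately show ?thesis using 2 by (intro exI[of _ "Complex pi s"]) (auto simp: closed_half_strip_def half_strip_def)
  next
    case 3
    have pos: "0 < Re w" using strip_map_Re_pos[OF b(1) 3] b by (simp add: w)
    have right: "2 * pi < Re w" if "Im w \<le> 0"
    proof -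
      have "Im (strip_map b q) \<le> 0" using that b by (simp add: w mult_le_0_iff divide_le_0_iff)
      then have "b * pi < Re (strip_map b q)" using strip_map_right_of_step[OF b, of q] 3 by (simp add: half_strip_def)
      then show ?thesis using b by (simp add: w field_simps)
    qed
    \<comment> \<open>The closure is taken because \<open>w\<close> may lie on the real ray that
      \<open>step_domain\<close> omits.\<close>
    have "w \<in> closure (step_domain (2 * pi))"
      using Complex_in_closure_step_domain[of "2 * pi" "Re w" "Im w"] pos right
      by (cases "0 \<le> Im w") (auto simp: complex_surj)
    then obtain p where p: "p \<in> closed_half_strip" "strip_map 2 p = w"
      using closure_step_domain_subset[of 2] by auto
    have "Re p \<noteq> 0" using pos p(2) by (auto simp: strip_map_Re_Im)
    moreover have "Re p \<noteq> pi"
    proof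
      assume pi: "Re p = pi"
      have "Im p \<le> sinh (Im p)" using p(1) less_sinh[of "Im p"] by (cases "Im p = 0") (auto simp: closed_half_strip_def)
      then have "Im w \<le> 0" "Re w = 2 * pi" using pi by (simp_all add: p(2)[symmetric] strip_map_Re_Im)
      then show False using right by simp
    qed
    moreover have "Im p \<noteq> 0"
    proof
      assume 0: "Im p = 0"
      have "sin (Re p) \<le> pi - Re p" using sin_x_le_x[of "pi - Re p"] p(1) by (simp add: closed_half_strip_def)
      then have "Im w \<le> 0" "Re w \<le> 2 * pi" using 0 by (simp_all add: p(2)[symmetric] strip_map_Re_Im)
      then show False using right by simp
    qed
    ultimately have "p \<in> half_strip" using p(1) by (auto simp: closed_half_strip_def half_strip_def)
    then show ?thesis using p 3 by (intro exI[of _ p]) (auto simp: half_strip_def)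
  qed
  then show "strip_lift b q \<in> closed_half_strip" "0 < Im (strip_lift b q)"
    and "strip_map 2 (strip_lift b q) = of_real (2 / b) * strip_map b q"
    and "Re q = 0 \<Longrightarrow> Re (strip_lift b q) = 0" "Re q = pi \<Longrightarrow> Re (strip_lift b q) = pi"
    and "q \<in> half_strip \<Longrightarrow> strip_lift b q \<in> half_strip"
    unfolding strip_lift_def w_def by (rule someI2_ex, blast)+
qed

text \<open>If Im p stayed below \<open>M\<close>, then the value of \<open>strip_map 2\<close> at p
  would be bounded by \<open>R\<close>; so would that of \<open>strip_map b\<close> at q, because
  2/b >= 1, and Im q would be bounded as well.\<close>

lemma strip_lift_Im_large:
  assumes b: "0 < b" "b \<le> 2"
  shows "\<exists>s. \<forall>q\<in>closed_half_strip. 0 < Im q \<longrightarrow> s \<le> Im q \<longrightarrow> M \<le> Im (strip_lift b q)"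
proof -
  define R where "R = 2 * exp M + 2 * (pi + M)"
  have "M \<le> Im (strip_lift b q)" if q: "q \<in> closed_half_strip" "0 < Im q" "5 + R + 2 * pi \<le> Im q" for q
  proof (rule ccontr)
    assume "\<not> M \<le> Im (strip_lift b q)"
    then have lt: "Im (strip_lift b q) < M" by simp
    then have "exp (Im (strip_lift b q)) < exp M" by simp
    moreover have "cmod (strip_map 2 (strip_lift b q)) \<le> 2 * exp (Im (strip_lift b q)) + 2 * (pi + Im (strip_lift b q))"
      by (rule strip_map_norm_le) (use strip_lift(1)[OF b q(1,2)] in auto)
    ultimately have le: "cmod (strip_map 2 (strip_lift b q)) \<le> R"
      using lt unfolding R_def distrib_left by linarith
    have "cmod (strip_map 2 (strip_lift b q)) = (2 / b) * cmod (strip_map b q)"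
      using b by (simp add: strip_lift(3)[OF b q(1,2)] norm_mult norm_divide)
    moreover have "1 * cmod (strip_map b q) \<le> (2 / b) * cmod (strip_map b q)"
      using b by (intro mult_right_mono) auto
    ultimately have "cmod (strip_map b q) \<le> R" using le by simp
    then show False using strip_map_Im_bound[OF b q(1)] q(3) by fastforce
  qed
  then show ?thesis by blast
qed

lemma strip_lift_inj:
  assumes b: "0 < b" "b \<le> 2" and p: "p \<in> closed_half_strip" "0 < Im p" and q: "q \<in> closed_half_strip" "0 < Im q"
    and eq: "strip_lift b p = strip_lift b q"
  shows "p = q"
proof -
  have "of_real (2 / b) * strip_map b p = of_real (2 / b) * strip_map b q"
    by (simp only: strip_lift(3)[OF b p, symmetric] strip_lift(3)[OF b q, symmetric] eq)
  then have e: "strip_map b p = strip_map b q" using b by auto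
  note P = strip_lift[OF b p] and Q = strip_lift[OF b q]
  consider "Re q = 0" | "Re q = pi" | "q \<in> half_strip" using q by (force simp: closed_half_strip_def half_strip_def)
  then show ?thesis
  proof cases
    case 1
    then have "q = Complex 0 (Im q)" by (simp add: complex_eq_iff)
    then show ?thesis using strip_map_unique_left[OF b q(2) p(1)] e by simp
  next
    case 2
    then have "q = Complex pi (Im q)" by (simp add: complex_eq_iff)
    then show ?thesis using strip_map_unique_right[OF b q(2) p(1)] e by simp
  next
    case 3
    have "strip_lift b q \<in> half_strip" by (rule Q(6)[OF 3])
    then have "Re p \<noteq> 0" "Re p \<noteq> pi" using P(4,5) eq by (auto simp: half_strip_def)
    then have "p \<in> half_strip" using p by (auto simp: half_strip_def closed_half_strip_def)
    then show ?thesis using inj_onD[OF inj_on_strip_map e] 3 by blast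
  qed
qed

lemma strip_lift_holomorphic:
  assumes b: "0 < b" "b \<le> 2" shows "strip_lift b holomorphic_on half_strip"
proof -
  have H: "q \<in> closed_half_strip" "0 < Im q" if "q \<in> half_strip" for q
    using that half_strip_subset by (auto simp: half_strip_def)
  obtain g where g: "g holomorphic_on (strip_map 2 ` half_strip)" "\<And>q. q \<in> half_strip \<Longrightarrow> g (strip_map 2 q) = q"
    using holomorphic_has_inverse[OF strip_map_holomorphic open_half_strip inj_on_strip_map] by metis
  have eq: "strip_lift b q = g (of_real (2 / b) * strip_map b q)"
    and im: "of_real (2 / b) * strip_map b q \<in> strip_map 2 ` half_strip" if q: "q \<in> half_strip" for q
    using strip_lift(3)[OF b H[OF q]] strip_lift(6)[OF b H[OF q] q] g(2) by (metis, metis image_eqI)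
  have hol1: "(\<lambda>q. of_real (2 / b) * strip_map b q) holomorphic_on half_strip"
    by (intro holomorphic_intros strip_map_holomorphic)
  have "(\<lambda>q. g (of_real (2 / b) * strip_map b q)) holomorphic_on half_strip"
    using holomorphic_on_compose_gen[OF hol1 g(1)] im by (auto simp: o_def image_subset_iff)
  then show ?thesis by (rule holomorphic_transform) (simp add: eq)
qed

text \<open>On the vertical edges continuity comes from properness of \<open>strip_map 2\<close> and
  its one-point fibres there; inside the half-strip from holomorphy.\<close>

lemma strip_lift_continuous:
  assumes b: "0 < b" "b \<le> 2" shows "continuous_on {q\<in>closed_half_strip. 0 < Im q} (strip_lift b)"
  unfolding continuous_on
proof
  fix q0 assume "q0 \<in> {q\<in>closed_half_strip. 0 < Im q}"
  then have q0: "q0 \<in> closed_half_strip" "0 < Im q0" by auto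
  let ?K = "{q\<in>closed_half_strip. 0 < Im q}"
  show "(strip_lift b \<longlongrightarrow> strip_lift b q0) (at q0 within ?K)"
  proof (cases "q0 \<in> half_strip")
    case True
    then have "isCont (strip_lift b) q0"
      using strip_lift_holomorphic[OF b] holomorphic_on_imp_continuous_on continuous_on_eq_continuous_at open_half_strip by blast
    then show ?thesis using continuous_at_imp_continuous_at_within continuous_within by blast
  next
    case False
    have evK: "eventually (\<lambda>q. q \<in> ?K) (at q0 within ?K)" by (simp add: eventually_at_filter)
    show ?thesis
    proof (rule proper_map_inverse_tendsto[OF closed_closed_half_strip
            holomorphic_on_imp_continuous_on[OF strip_map_holomorphic] strip_map_proper])
      show "(0::real) < 2" "(2::real) \<le> 2" by auto
      show "q = strip_lift b q0" if q: "q \<in> closed_half_strip" "strip_map 2 q = strip_map 2 (strip_lift b q0)" for q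
      proof -
        let ?p = "strip_lift b q0"
        have "Re q0 = 0 \<or> Re q0 = pi" using q0 False by (auto simp: half_strip_def closed_half_strip_def)
        then have "?p = Complex 0 (Im ?p) \<or> ?p = Complex pi (Im ?p)"
          using strip_lift(4,5)[OF b q0] by (auto simp: complex_eq_iff)
        then show ?thesis
          using strip_map_unique_left[of 2 "Im ?p" q] strip_map_unique_right[of 2 "Im ?p" q] strip_lift(2)[OF b q0] q by auto
      qed
      have "isCont (strip_map b) q0"
        using holomorphic_on_imp_continuous_on[OF strip_map_holomorphic[of b UNIV]] continuous_on_eq_continuous_at open_UNIV by blast
      then have "(strip_map b \<longlongrightarrow> strip_map b q0) (at q0 within ?K)"
        using continuous_at_imp_continuous_at_within continuous_within by blast
      then have "((\<lambda>q. of_real (2 / b) * strip_map b q) \<longlongrightarrow> of_real (2 / b) * strip_map b q0) (at q0 within ?K)"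
        by (intro tendsto_intros)
      then have "((\<lambda>q. of_real (2 / b) * strip_map b q) \<longlongrightarrow> strip_map 2 (strip_lift b q0)) (at q0 within ?K)"
        by (simp only: strip_lift(3)[OF b q0])
      then show "((\<lambda>q. strip_map 2 (strip_lift b q)) \<longlongrightarrow> strip_map 2 (strip_lift b q0)) (at q0 within ?K)"
      proof (rule Lim_transform_eventually)
        show "eventually (\<lambda>q. of_real (2 / b) * strip_map b q = strip_map 2 (strip_lift b q)) (at q0 within ?K)"
          using evK by eventually_elim (use strip_lift(3)[OF b] in auto)
      qed
      show "eventually (\<lambda>q. strip_lift b q \<in> closed_half_strip) (at q0 within ?K)"
        using evK by eventually_elim (use strip_lift(1)[OF b] in auto)
    qed
  qed
qed

text \<open>An inverse of q -> exp(iq). The rotation by -i moves the cut of the logarithm to the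
  negative imaginary axis, away from the closed upper half-disc.\<close>

definition strip_coord :: "complex \<Rightarrow> complex" where
  "strip_coord z = pi / 2 - \<i> * Ln (- \<i> * z)"

lemma strip_coord:
  assumes z: "z \<noteq> 0" "0 \<le> Im z" "cmod z < 1"
  shows "strip_coord z \<in> closed_half_strip" "0 < Im (strip_coord z)" "exp (\<i> * strip_coord z) = z" "Im (strip_coord z) = - ln (cmod z)"
    and "0 < Im z \<Longrightarrow> strip_coord z \<in> half_strip" "Im z = 0 \<Longrightarrow> Re (strip_coord z) = 0 \<or> Re (strip_coord z) = pi"
proof -
  have nz: "- \<i> * z \<noteq> 0" using z by simp
  have Re: "Re (strip_coord z) = pi / 2 + Im (Ln (- \<i> * z))" by (simp add: strip_coord_def)
  show Im: "Im (strip_coord z) = - ln (cmod z)"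
    using nz by (simp add: strip_coord_def norm_mult)
  then show Imp: "0 < Im (strip_coord z)" using z by simp
  have "\<bar>Im (Ln (- \<i> * z))\<bar> \<le> pi / 2" using Re_Ln_pos_le[OF nz] z(2) by simp
  then show cl: "strip_coord z \<in> closed_half_strip" using Re Imp by (auto simp: closed_half_strip_def)
  have "exp (\<i> * strip_coord z) = exp (\<i> * of_real (pi / 2)) * exp (Ln (- \<i> * z))"
    by (simp add: strip_coord_def exp_add[symmetric] algebra_simps)
  also have "exp (\<i> * of_real (pi / 2)) = \<i>" by (simp add: exp_eq_polar cis_pi_half)
  finally show e: "exp (\<i> * strip_coord z) = z" using nz by simp
  show "strip_coord z \<in> half_strip" if "0 < Im z"
  proof -
    have "\<bar>Im (Ln (- \<i> * z))\<bar> < pi / 2" using Re_Ln_pos_lt[OF nz] that by simp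
    then show ?thesis using Re Imp by (auto simp: half_strip_def)
  qed
  show "Re (strip_coord z) = 0 \<or> Re (strip_coord z) = pi" if "Im z = 0"
  proof (rule ccontr)
    assume "\<not> ?thesis"
    then have "strip_coord z \<in> half_strip" using cl Imp by (auto simp: half_strip_def closed_half_strip_def)
    then show False using exp_half_strip(2)[of "strip_coord z"] e that by simp
  qed
qed

lemma half_strip_end_not_bot: "half_strip_end \<noteq> bot"
proof
  assume "half_strip_end = bot"
  then have "eventually (\<lambda>_. False) half_strip_end" by simp
  then obtain s where s: "\<forall>q\<in>half_strip. s \<le> Im q \<longrightarrow> False" unfolding eventually_half_strip_end by blast
  have "Complex (pi / 2) (max 1 s) \<in> half_strip" by (simp add: half_strip_def)
  with s show False by fastforce
qed

lemma eventually_in_half_strip_end: "eventually (\<lambda>q. q \<in> half_strip) half_strip_end"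
  unfolding eventually_half_strip_end by auto

text \<open>The equation cos p = 1 + 1/(b f) solved for f.\<close>

definition strip_pole :: "real \<Rightarrow> complex \<Rightarrow> complex" where
  "strip_pole b q = 1 / (of_real b * (cos (strip_lift b q) - 1))"

lemma strip_lift_half_strip_end:
  assumes b: "0 < b" "b \<le> 2" shows "filterlim (strip_lift b) half_strip_end half_strip_end"
proof -
  have H: "q \<in> closed_half_strip" "0 < Im q" if "q \<in> half_strip" for q
    using that half_strip_subset by (auto simp: half_strip_def)
  have "eventually (\<lambda>q. Q (strip_lift b q)) half_strip_end" if "eventually Q half_strip_end" for Q
  proof -
    obtain M where M: "\<forall>q\<in>half_strip. M \<le> Im q \<longrightarrow> Q q" using \<open>eventually Q half_strip_end\<close> unfolding eventually_half_strip_end by blast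
    obtain s where s: "\<forall>q\<in>closed_half_strip. 0 < Im q \<longrightarrow> s \<le> Im q \<longrightarrow> M \<le> Im (strip_lift b q)"
      using strip_lift_Im_large[OF b] by blast
    show ?thesis unfolding eventually_half_strip_end
      using M s strip_lift(6)[OF b H] H by (intro exI[of _ s]) blast
  qed
  then show ?thesis by (simp add: filterlim_iff)
qed

text \<open>The normalisation f'(0) = 1. With p the lift of q, (cos p - 1) exp(ip) tends to 1/2, and
  exp(iq)/exp(ip) tends to 2/b because the two natural parameters have ratio b/2 while both become i
  after multiplication by the exponential.\<close>

lemma strip_pole_asymp:
  assumes b: "0 < b" "b \<le> 2"
  shows "((\<lambda>q. strip_pole b q / exp (\<i> * q)) \<longlongrightarrow> 1) half_strip_end"
proof -
  have H: "q \<in> closed_half_strip" "0 < Im q" if "q \<in> half_strip" for q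
    using that half_strip_subset by (auto simp: half_strip_def)
  define E where "E = (\<lambda>q. exp (\<i> * q))"
  let ?p = "strip_lift b"
  have e0: "((\<lambda>q. E (?p q)) \<longlongrightarrow> 0) half_strip_end"
    using filterlim_compose[OF exp_mult_half_strip_end(1) strip_lift_half_strip_end[OF b]] by (simp add: filterlim_at E_def)
  have c: "((\<lambda>q. (cos (?p q) - 1) * E (?p q)) \<longlongrightarrow> 1 / 2) half_strip_end"
  proof -
    have "((\<lambda>q. (E (?p q) * E (?p q) + 1) / 2 - E (?p q)) \<longlongrightarrow> (0 * 0 + 1) / 2 - 0) half_strip_end"
      by (intro tendsto_intros e0) auto
    moreover have "(E p * E p + 1) / 2 - E p = (cos p - 1) * E p" for p
      by (simp add: E_def cos_exp_eq exp_minus field_simps)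
    ultimately show ?thesis by simp
  qed
  have 2: "((\<lambda>q. strip_map 2 (?p q) * E (?p q)) \<longlongrightarrow> \<i>) half_strip_end"
    using filterlim_compose[OF strip_map_exp_tendsto strip_lift_half_strip_end[OF b]] by (simp add: E_def)
  have 1: "((\<lambda>q. strip_map b q * E q) \<longlongrightarrow> \<i>) half_strip_end"
    using strip_map_exp_tendsto by (simp add: E_def)
  have ratio: "((\<lambda>q. E q / E (?p q)) \<longlongrightarrow> 2 / of_real b) half_strip_end"
  proof -
    have "((\<lambda>q. (strip_map b q * E q) / (of_real (b / 2) * (strip_map 2 (?p q) * E (?p q)))) \<longlongrightarrow> \<i> / (of_real (b / 2) * \<i>)) half_strip_end"
      using b by (intro tendsto_intros 1 2) auto
    moreover have "\<i> / (of_real (b / 2) * \<i>) = 2 / of_real b" using b by (simp add: field_simps)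
    ultimately have l: "((\<lambda>q. (strip_map b q * E q) / (of_real (b / 2) * (strip_map 2 (?p q) * E (?p q)))) \<longlongrightarrow> 2 / of_real b) half_strip_end"
      by simp
    show ?thesis
    proof (rule Lim_transform_eventually[OF l])
      show "eventually (\<lambda>q. (strip_map b q * E q) / (of_real (b / 2) * (strip_map 2 (?p q) * E (?p q))) = E q / E (?p q)) half_strip_end"
        using eventually_in_half_strip_end
      proof eventually_elim
        case (elim q)
        have "of_real (b / 2) * strip_map 2 (?p q) = strip_map b q"
          using b by (simp add: strip_lift(3)[OF b H[OF elim]])
        moreover have "strip_map b q \<noteq> 0" using strip_map_Re_pos[OF b(1) elim] by auto
        ultimately show ?case by (metis mult.assoc mult_divide_mult_cancel_left)
      qed
    qed
  qed
  have "((\<lambda>q. 1 / (of_real b * ((cos (?p q) - 1) * E (?p q)) * (E q / E (?p q)))) \<longlongrightarrow> 1 / (of_real b * (1 / 2) * (2 / of_real b))) half_strip_end"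
    using b by (intro tendsto_intros c ratio) auto
  moreover have "1 / (of_real b * (1 / 2) * (2 / of_real b)) = (1::complex)" using b by simp
  moreover have "1 / (of_real b * ((cos (?p q) - 1) * E (?p q)) * (E q / E (?p q))) = strip_pole b q / exp (\<i> * q)" for q
    by (simp add: strip_pole_def E_def)
  ultimately show ?thesis by simp
qed

section \<open>The extremal function on the disc by reflection\<close>

definition slit_half :: "real \<Rightarrow> complex \<Rightarrow> complex" where
  "slit_half b z = strip_pole b (strip_coord z)"

text \<open>The conjugate branch is the Schwarz reflection of \<open>slit_half\<close> across the diameter.\<close>

definition slit_map :: "real \<Rightarrow> complex \<Rightarrow> complex" where
  "slit_map b z = (if z = 0 then 0 else if 0 \<le> Im z then slit_half b z else cnj (slit_half b (cnj z)))"

context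
  fixes b :: real
  assumes b: "0 < b" "b \<le> 2"
begin

abbreviation (input) "half_disc \<equiv> {z. z \<noteq> 0 \<and> 0 \<le> Im z \<and> cmod z < 1}"

lemma cos_strip_lift_ne_1:
  assumes "q \<in> closed_half_strip" "0 < Im q" shows "cos (strip_lift b q) \<noteq> 1"
proof -
  note L = strip_lift[OF b assms]
  consider "strip_lift b q \<in> half_strip" | "Re (strip_lift b q) = 0" | "Re (strip_lift b q) = pi"
    using L(1,2) by (force simp: half_strip_def closed_half_strip_def)
  then show ?thesis
  proof cases
    case 1
    then show ?thesis using Im_cos_half_strip by fastforce
  next
    case 2
    then have "Re (cos (strip_lift b q)) = cosh (Im (strip_lift b q))" by (simp add: Re_cos_cosh)
    then show ?thesis using cosh_real_strict_mono[of 0 "Im (strip_lift b q)"] L(2) by auto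
  next
    case 3
    then have "Re (cos (strip_lift b q)) = - cosh (Im (strip_lift b q))" by (simp add: Re_cos_cosh)
    then show ?thesis using cosh_real_pos[of "Im (strip_lift b q)"] by (metis neg_0_less_iff_less not_less_iff_gr_or_eq one_complex.sel(1) zero_less_one)
  qed
qed

lemma slit_half_nonzero: "z \<in> half_disc \<Longrightarrow> slit_half b z \<noteq> 0"
  using strip_coord cos_strip_lift_ne_1 b by (auto simp: slit_half_def strip_pole_def)

lemma slit_half_real:
  assumes "z \<in> half_disc" "Im z = 0" shows "slit_half b z \<in> \<real>"
proof -
  let ?q = "strip_coord z"
  have q: "?q \<in> closed_half_strip" "0 < Im ?q" "Re ?q = 0 \<or> Re ?q = pi" using strip_coord assms by auto
  have "Re (strip_lift b ?q) = 0 \<or> Re (strip_lift b ?q) = pi" using strip_lift(4,5)[OF b q(1,2)] q(3) by auto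
  then have "cos (strip_lift b ?q) \<in> \<real>" by (auto simp: complex_is_Real_iff Im_cos_sinh)
  then show ?thesis unfolding slit_half_def strip_pole_def by (intro Reals_divide Reals_mult Reals_diff) auto
qed

lemma slit_half_Im_pos:
  assumes "z \<in> half_disc" "0 < Im z" shows "0 < Im (slit_half b z)"
proof -
  have "strip_coord z \<in> half_strip" using strip_coord assms by auto
  then have "strip_lift b (strip_coord z) \<in> half_strip" using strip_lift(6)[OF b] half_strip_subset by (auto simp: half_strip_def)
  then have neg: "Im (of_real b * (cos (strip_lift b (strip_coord z)) - 1)) < 0"
    using Im_cos_half_strip b by (simp add: mult_less_0_iff)
  have "0 < Im (1 / w)" if "Im w < 0" for w
  proof -
    have "0 < (Re w)\<^sup>2 + (Im w)\<^sup>2" using that by (simp add: sum_power2_gt_zero_iff)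
    then show ?thesis using that by (simp add: Im_divide divide_less_0_iff)
  qed
  from this[OF neg] show ?thesis by (simp add: slit_half_def strip_pole_def)
qed

lemma slit_half_inj: "inj_on (slit_half b) half_disc"
proof (rule inj_onI)
  fix z w assume zw: "z \<in> half_disc" "w \<in> half_disc" "slit_half b z = slit_half b w"
  let ?p = "strip_coord z" and ?q = "strip_coord w"
  have p: "?p \<in> closed_half_strip" "0 < Im ?p" "exp (\<i> * ?p) = z" using strip_coord zw by auto
  have q: "?q \<in> closed_half_strip" "0 < Im ?q" "exp (\<i> * ?q) = w" using strip_coord zw by auto
  have "cos (strip_lift b ?p) = cos (strip_lift b ?q)"
  proof -
    have "1 / slit_half b z = 1 / slit_half b w" using zw(3) by simp
    then have "of_real b * (cos (strip_lift b ?p) - 1) = of_real b * (cos (strip_lift b ?q) - 1)"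
      by (simp add: slit_half_def strip_pole_def)
    then show ?thesis using b by simp
  qed
  then have "strip_lift b ?p = strip_lift b ?q"
    using strip_lift(1,2)[OF b p(1,2)] strip_lift(1,2)[OF b q(1,2)] unfolding closed_half_strip_def
    by (elim CollectE conjE) (rule cos_inj_half_strip)
  then have "?p = ?q" by (rule strip_lift_inj[OF b p(1,2) q(1,2)])
  then show "z = w" using p(3) q(3) by metis
qed

lemma slit_half_continuous: "continuous_on half_disc (slit_half b)"
proof -
  have c: "continuous_on half_disc strip_coord"
    unfolding strip_coord_def by (intro continuous_intros) (auto simp: complex_nonpos_Reals_iff complex_eq_iff)
  have "continuous_on half_disc (\<lambda>z. strip_lift b (strip_coord z))"
    by (rule continuous_on_compose2[OF strip_lift_continuous[OF b] c]) (use strip_coord in auto)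
  then show ?thesis
    unfolding slit_half_def strip_pole_def using cos_strip_lift_ne_1 strip_coord b
    by (intro continuous_intros) auto
qed

lemma slit_half_holomorphic: "slit_half b holomorphic_on {z. cmod z < 1 \<and> 0 < Im z}"
proof -
  let ?U = "{z. cmod z < 1 \<and> 0 < Im z}"
  have sub: "strip_coord z \<in> half_strip" if "z \<in> ?U" for z
  proof -
    have "z \<noteq> 0" using that by auto
    then show ?thesis using strip_coord(5)[of z] that by simp
  qed
  have c: "strip_coord holomorphic_on ?U"
    unfolding strip_coord_def by (intro holomorphic_intros) (auto simp: complex_nonpos_Reals_iff)
  have l: "(\<lambda>z. strip_lift b (strip_coord z)) holomorphic_on ?U"
    using holomorphic_on_compose_gen[OF c strip_lift_holomorphic[OF b]] sub by (auto simp: o_def)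
  have ne: "cos (strip_lift b (strip_coord z)) \<noteq> 1" if "z \<in> ?U" for z
    using cos_strip_lift_ne_1 sub[OF that] half_strip_subset by (auto simp: half_strip_def)
  show ?thesis
    unfolding slit_half_def strip_pole_def using ne b by (intro holomorphic_intros l) auto
qed

lemma slit_half_tendsto_0:
  assumes "e > 0" shows "\<exists>d>0. \<forall>z\<in>half_disc. cmod z < d \<longrightarrow> cmod (slit_half b z) < e"
proof -
  \<comment> \<open>One unit of the 2 is spent on |cos p - 1| >= |cos p| - 1, the other makes the
    inequality strict.\<close>
  define M where "M = 2 + 1 / (b * e)"
  obtain s where s: "\<forall>q\<in>closed_half_strip. 0 < Im q \<longrightarrow> s \<le> Im q \<longrightarrow> M \<le> Im (strip_lift b q)"
    using strip_lift_Im_large[OF b] by blast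
  show ?thesis
  proof (intro exI conjI ballI impI)
    show "0 < exp (- s)" by simp
    fix z assume z: "z \<in> half_disc" "cmod z < exp (- s)"
    let ?q = "strip_coord z" and ?p = "strip_lift b (strip_coord z)"
    have q: "?q \<in> closed_half_strip" "0 < Im ?q" "Im ?q = - ln (cmod z)" using strip_coord z by auto
    have "ln (cmod z) < - s" using z ln_less_cancel_iff[of "cmod z" "exp (- s)"] by simp
    then have "M \<le> Im ?p" using s q by auto
    moreover have "Im ?p \<le> sinh (Im ?p)" using less_sinh strip_lift(2)[OF b q(1,2)] by force
    moreover have "sinh (Im ?p) \<le> cmod (cos ?p)"
    proof (rule power2_le_imp_le)
      have "(cmod (cos ?p))\<^sup>2 = (cos (Re ?p))\<^sup>2 * (cosh (Im ?p))\<^sup>2 + (sin (Re ?p))\<^sup>2 * (sinh (Im ?p))\<^sup>2"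
        by (simp add: cmod_power2 Re_cos_cosh Im_cos_sinh power_mult_distrib)
      also have "\<dots> = (cos (Re ?p))\<^sup>2 + (sinh (Im ?p))\<^sup>2" by (simp add: cosh_square_eq sin_squared_eq algebra_simps)
      finally show "(sinh (Im ?p))\<^sup>2 \<le> (cmod (cos ?p))\<^sup>2" by simp
    qed simp
    ultimately have "1 / (b * e) + 1 \<le> cmod (cos ?p - 1)"
      using norm_triangle_ineq2[of "cos ?p" 1] by (simp add: M_def)
    then have 1: "1 / (b * e) < cmod (cos ?p - 1)" by linarith
    moreover have "0 < 1 / (b * e)" using b assms by simp
    ultimately have pos: "0 < cmod (cos ?p - 1)" by linarith
    have "1 < b * e * cmod (cos ?p - 1)" using 1 b assms by (simp add: divide_less_eq mult.commute)
    then have "1 / (b * cmod (cos ?p - 1)) < e" using pos b by (simp add: divide_less_eq algebra_simps)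
    then show "cmod (slit_half b z) < e" using b by (simp add: slit_half_def strip_pole_def norm_divide norm_mult)
  qed
qed

lemma slit_map_holomorphic: "slit_map b holomorphic_on ball 0 1"
proof -
  \<comment> \<open>Reflection is carried out on the punctured disc because
    \<open>strip_coord\<close> has a logarithmic singularity at 0; continuity then removes the
    puncture.\<close>
  let ?S = "ball (0::complex) 1 - {0}"
  let ?F = "\<lambda>z. if 0 \<le> Im z then slit_half b z else cnj (slit_half b (cnj z))"
  have hol: "?F holomorphic_on ?S"
  proof (rule Schwarz_reflection)
    show "open ?S" by (simp add: open_delete)
    show "cnj ` ?S \<subseteq> ?S" by auto
    have "?S \<inter> {z. 0 < Im z} = {z. cmod z < 1 \<and> 0 < Im z}" by auto
    then show "slit_half b holomorphic_on ?S \<inter> {z. 0 < Im z}" using slit_half_holomorphic by simp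
    have "?S \<inter> {z. 0 \<le> Im z} = half_disc" by auto
    then show "continuous_on (?S \<inter> {z. 0 \<le> Im z}) (slit_half b)" using slit_half_continuous by simp
    show "slit_half b z \<in> \<real>" if "z \<in> ?S" "z \<in> \<real>" for z
      using slit_half_real[of z] that by (auto simp: complex_is_Real_iff)
  qed
  then have hol': "slit_map b holomorphic_on ball 0 1 - {0}"
    by (rule holomorphic_transform) (simp add: slit_map_def)
  moreover have "continuous_on (ball 0 1) (slit_map b)"
    unfolding continuous_on_eq_continuous_within
  proof
    fix z :: complex assume z: "z \<in> ball 0 1"
    show "continuous (at z within ball 0 1) (slit_map b)"
    proof (cases "z = 0")
      case False
      have "open (ball (0::complex) 1 - {0})" by (simp add: open_delete)
      then have "isCont (slit_map b) z"
        using holomorphic_on_imp_continuous_on[OF hol'] False z by (simp add: continuous_on_eq_continuous_at)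
      then show ?thesis by (rule continuous_at_imp_continuous_at_within)
    next
      case True
      have "(slit_map b \<longlongrightarrow> 0) (at 0)"
      proof (rule tendstoI)
        fix e :: real assume "e > 0"
        then obtain d where d: "d > 0" "\<forall>z\<in>half_disc. cmod z < d \<longrightarrow> cmod (slit_half b z) < e"
          using slit_half_tendsto_0 by blast
        show "eventually (\<lambda>z. dist (slit_map b z) 0 < e) (at 0)"
          unfolding eventually_at
        proof (intro exI conjI ballI impI)
          show "0 < min d 1" using d by simp
          fix z :: complex assume z: "z \<noteq> 0 \<and> dist z 0 < min d 1"
          show "dist (slit_map b z) 0 < e"
            using bspec[OF d(2), of z] bspec[OF d(2), of "cnj z"] z by (auto simp: slit_map_def)
        qed
      qed
      then have "(slit_map b \<longlongrightarrow> 0) (at 0 within ball 0 1)" by (rule tendsto_within_subset) simp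
      moreover have "slit_map b 0 = 0" by (simp add: slit_map_def)
      ultimately show ?thesis using True by (simp add: continuous_within)
    qed
  qed
  ultimately show ?thesis using no_isolated_singularity[of "ball 0 1" "slit_map b" "{0}"] by simp
qed

lemma slit_map_Im_sign:
  assumes "z \<in> ball 0 1"
  shows "Im z = 0 \<Longrightarrow> Im (slit_map b z) = 0" "0 < Im z \<Longrightarrow> 0 < Im (slit_map b z)" "Im z < 0 \<Longrightarrow> Im (slit_map b z) < 0"
    "z \<noteq> 0 \<Longrightarrow> slit_map b z \<noteq> 0"
  using assms slit_half_real[of z] slit_half_Im_pos[of z] slit_half_Im_pos[of "cnj z"]
    slit_half_nonzero[of z] slit_half_nonzero[of "cnj z"]
  by (auto simp: slit_map_def complex_is_Real_iff)

lemma slit_map_inj: "inj_on (slit_map b) (ball 0 1)"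
proof (rule inj_onI)
  fix z w :: complex assume zw: "z \<in> ball 0 1" "w \<in> ball 0 1" "slit_map b z = slit_map b w"
  note z = slit_map_Im_sign[OF zw(1)] and w = slit_map_Im_sign[OF zw(2)]
  \<comment> \<open>The map preserves the sign of the imaginary part, so points of different halves
    cannot collide and injectivity reduces to \<open>slit_half\<close>.\<close>
  have sgn: "0 \<le> Im z \<longleftrightarrow> 0 \<le> Im w"
    using z(1-3) w(1-3) zw(3) by (metis less_irrefl less_le not_le order_less_trans)
  show "z = w"
  proof (cases "z = 0 \<or> w = 0")
    case True
    moreover have "slit_map b 0 = 0" by (simp add: slit_map_def)
    ultimately show ?thesis using z(4) w(4) zw(3) by metis
  next
    case False
    show ?thesis
    proof (cases "0 \<le> Im z")
      case True
      then show ?thesis using inj_onD[OF slit_half_inj, of z w] zw sgn False by (auto simp: slit_map_def)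
    next
      case neg: False
      then have "slit_half b (cnj z) = slit_half b (cnj w)" using zw sgn False by (auto simp: slit_map_def)
      then have "cnj z = cnj w" using inj_onD[OF slit_half_inj, of "cnj z" "cnj w"] zw sgn False neg by auto
      then show ?thesis by simp
    qed
  qed
qed

lemma slit_map_exp: "q \<in> half_strip \<Longrightarrow> slit_map b (exp (\<i> * q)) = strip_pole b q"
proof -
  assume q: "q \<in> half_strip"
  let ?z = "exp (\<i> * q)"
  have z: "?z \<noteq> 0" "0 < Im ?z" "cmod ?z < 1" using exp_half_strip[OF q] by auto
  have "strip_coord ?z \<in> half_strip" "exp (\<i> * strip_coord ?z) = ?z"
    using strip_coord(3,5)[of ?z] z by auto
  then have "strip_coord ?z = q" using inj_onD[OF inj_on_exp_half_strip] q by blast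
  then show ?thesis using z by (simp add: slit_map_def slit_half_def)
qed

text \<open>Holomorphy makes the derivative exist, so the single approach through the end of the
  half-strip determines it.\<close>

lemma slit_map_deriv: "deriv (slit_map b) 0 = 1"
proof -
  have "((slit_map b) has_field_derivative deriv (slit_map b) 0) (at 0)"
    using slit_map_holomorphic by (simp add: holomorphic_derivI)
  then have "((\<lambda>z. slit_map b z / z) \<longlongrightarrow> deriv (slit_map b) 0) (at 0)" by (simp add: DERIV_def slit_map_def)
  from filterlim_compose[OF this exp_mult_half_strip_end(1)]
  have l: "((\<lambda>q. slit_map b (exp (\<i> * q)) / exp (\<i> * q)) \<longlongrightarrow> deriv (slit_map b) 0) half_strip_end" .
  have "((\<lambda>q. slit_map b (exp (\<i> * q)) / exp (\<i> * q)) \<longlongrightarrow> 1) half_strip_end"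
  proof (rule Lim_transform_eventually[OF strip_pole_asymp[OF b]])
    show "eventually (\<lambda>q. strip_pole b q / exp (\<i> * q) = slit_map b (exp (\<i> * q)) / exp (\<i> * q)) half_strip_end"
      using eventually_in_half_strip_end by eventually_elim (simp add: slit_map_exp)
  qed
  then show ?thesis by (rule tendsto_unique[OF half_strip_end_not_bot l])
qed

lemma slit_map_mem: "slit_map b \<in> schlicht \<inter> typically_real"
proof -
  have "slit_map b z \<in> \<real>" if "z \<in> ball 0 1" "z \<in> \<real>" for z
    using slit_map_Im_sign(1)[OF that(1)] that(2) by (simp add: complex_is_Real_iff)
  moreover have "Im (slit_map b z) * Im z > 0" if "z \<in> ball 0 1" "z \<notin> \<real>" for z
    using slit_map_Im_sign(2,3)[OF that(1)] that(2)
    by (cases "0 < Im z") (auto simp: complex_is_Real_iff mult_neg_neg)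
  ultimately show ?thesis
    using slit_map_holomorphic slit_map_inj slit_map_deriv
    by (simp add: schlicht_def typically_real_def slit_map_def[of b 0])
qed

text \<open>The lift satisfies b(sin p + p) = 2 sin q + bq, so the kernel vanishes at every exp(iq).
  Hence its value and its derivative at 0 vanish, and these two equations determine k(0) and
  k'(0).\<close>

theorem slit_map_coefficients:
  assumes k: "k holomorphic_on ball 0 1" "\<And>z. z \<in> ball 0 1 \<Longrightarrow> z \<noteq> 0 \<Longrightarrow> k z = 1 / z - 1 / slit_map b z"
  shows "k 0 = of_real (b - b * ln (b / 2))" "deriv k 0 = of_real (1 + b\<^sup>2 / 2 - b * (b - b * ln (b / 2)))"
proof -
  let ?f = "slit_map b"
  have df: "(?f has_field_derivative 1) (at 0)"
    using holomorphic_derivI[OF slit_map_holomorphic, of 0] slit_map_deriv by simp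
  have dk: "(k has_field_derivative deriv k 0) (at 0)" using holomorphic_derivI[OF k(1), of 0] by simp
  have f0: "?f 0 = 0" by (simp add: slit_map_def)
  define \<kappa> where "\<kappa> = strip_kernel b k ?f"
  note K = strip_kernel_at_0[OF b(1) f0 df dk, folded \<kappa>_def]
  have zero: "\<kappa> (exp (\<i> * q)) = 0" if q: "q \<in> half_strip" for q
  proof -
    have qc: "q \<in> closed_half_strip" "0 < Im q" using q half_strip_subset by (auto simp: half_strip_def)
    have zb: "exp (\<i> * q) \<in> ball 0 1" using exp_half_strip[OF q] by simp
    have "of_real b * (sin (strip_lift b q) + strip_lift b q) - strip_map b q = - (\<i> * \<kappa> (exp (\<i> * q)))"
      unfolding \<kappa>_def
    proof (rule strip_map_diff_eq_kernel[OF b(1) strip_lift(6)[OF b qc q] q refl])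
      show "Im (slit_map b (exp (\<i> * q))) \<noteq> 0"
        using slit_map_Im_sign(2)[OF zb] exp_half_strip[OF q] by simp
      show "cos (strip_lift b q) = 1 + 1 / (of_real b * slit_map b (exp (\<i> * q)))"
        using b by (simp add: slit_map_exp[OF q] strip_pole_def)
      show "k (exp (\<i> * q)) = 1 / exp (\<i> * q) - 1 / slit_map b (exp (\<i> * q))" using k(2)[OF zb] by simp
    qed
    moreover have "of_real b * (sin (strip_lift b q) + strip_lift b q) = of_real (b / 2) * strip_map 2 (strip_lift b q)"
      by (simp add: strip_map_def algebra_simps)
    moreover have "\<dots> = strip_map b q" using b by (simp add: strip_lift(3)[OF b qc])
    ultimately show ?thesis by simp
  qed
  have ev0: "((\<lambda>q. \<kappa> (exp (\<i> * q))) \<longlongrightarrow> 0) half_strip_end"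
    by (rule tendsto_eventually) (use eventually_in_half_strip_end in \<open>eventually_elim, simp add: zero\<close>)
  have "(\<kappa> \<longlongrightarrow> \<kappa> 0) (at 0)" using DERIV_isCont[OF K(2)] by (simp add: isCont_def)
  from filterlim_compose[OF this exp_mult_half_strip_end(1)]
  have \<kappa>0: "\<kappa> 0 = 0" using tendsto_unique[OF half_strip_end_not_bot _ ev0] by blast
  have ev1: "((\<lambda>q. (\<kappa> (exp (\<i> * q)) - \<kappa> 0) / exp (\<i> * q)) \<longlongrightarrow> 0) half_strip_end"
    by (rule tendsto_eventually) (use eventually_in_half_strip_end in \<open>eventually_elim, simp add: zero \<kappa>0\<close>)
  have "((\<lambda>z. (\<kappa> z - \<kappa> 0) / z) \<longlongrightarrow> deriv k 0 + of_real b * k 0 - (of_real b)\<^sup>2 / 2 - 1) (at 0)"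
    using K(2) by (simp add: DERIV_def)
  from filterlim_compose[OF this exp_mult_half_strip_end(1)]
  have "deriv k 0 + of_real b * k 0 - (of_real b)\<^sup>2 / 2 - 1 = 0"
    using tendsto_unique[OF half_strip_end_not_bot _ ev1] by blast
  then have D: "deriv k 0 = 1 + (of_real b)\<^sup>2 / 2 - of_real b * k 0" by (simp add: algebra_simps)
  show A: "k 0 = of_real (b - b * ln (b / 2))" using K(1) \<kappa>0 by (simp add: algebra_simps)
  show "deriv k 0 = of_real (1 + b\<^sup>2 / 2 - b * (b - b * ln (b / 2)))" unfolding D A by simp
qed

end

section \<open>Maximizing over the parameter\<close>

definition crit :: "real \<Rightarrow> real" where
  "crit l = 4 * exp (-2 * l) * (l^2 - l^3) - 3 * l + 1"

definition extremal_value :: "real \<Rightarrow> real" where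
  "extremal_value l = 2 * l^4 * exp (-4 * l) + (3 * l^2 + 2 * l + 1) * exp (-2 * l) - 1"

lemma crit_strict_antimono:
  assumes "0 \<le> x" "x < y" shows "crit y < crit x"
proof (rule DERIV_neg_imp_decreasing_open[OF assms(2)])
  fix l assume "x < l" "l < y"
  then have l: "0 \<le> l" using assms by simp
  have d: "(crit has_real_derivative (4 * exp (-2 * l) * (2 * l^3 - 5 * l^2 + 2 * l) - 3)) (at l)"
    unfolding crit_def by (auto intro!: derivative_eq_intros) (simp add: algebra_simps power2_eq_square power3_eq_cube)
  \<comment> \<open>The difference of the two sides of the next inequality is this sum of squares plus 50/17.\<close>
  have "0 \<le> l^2 * (3/4 * (l - 10/3)^2 + 2/3) + 17 * (l - 1/17)^2" by simp
  then have "4 * (2 * l^3 - 5 * l^2 + 2 * l) < 3 * (1 + l + l^2 / 2)^2"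
    by (simp add: power2_eq_square power3_eq_cube algebra_simps)
  also have "\<dots> \<le> 3 * (exp l)^2"
    using exp_lower_Taylor_quadratic[OF l] l by (intro mult_left_mono power_mono) auto
  also have "(exp l)^2 = exp (2 * l)" by (simp add: exp_double)
  finally have "4 * exp (-2 * l) * (2 * l^3 - 5 * l^2 + 2 * l) < 3"
    by (simp add: exp_minus field_simps)
  then show "\<exists>D. (crit has_real_derivative D) (at l) \<and> D < 0" using d by (intro exI conjI) auto
next
  show "continuous_on {x..y} crit" unfolding crit_def by (intro continuous_intros)
qed

lemma extremal_value_deriv:
  "(extremal_value has_real_derivative (2 * l * exp (-2 * l) * crit l)) (at l)"
proof -
  have "(extremal_value has_real_derivative
     (8 * l^3 * exp (-4 * l) - 8 * l^4 * exp (-4 * l) + (6 * l + 2) * exp (-2 * l) - 2 * (3 * l^2 + 2 * l + 1) * exp (-2 * l))) (at l)"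
    unfolding extremal_value_def by (auto intro!: derivative_eq_intros)
  moreover have "exp (-4 * l) = exp (-2 * l) * exp (-2 * l)" by (simp add: exp_add[symmetric])
  ultimately show ?thesis by (simp add: crit_def algebra_simps power2_eq_square power3_eq_cube power4_eq_xxxx)
qed

lemma crit_unique_zero: "\<exists>!l. 0 \<le> l \<and> crit l = 0"
proof -
  have "continuous_on {0..1} crit" unfolding crit_def by (intro continuous_intros)
  then obtain l where l: "0 \<le> l" "l \<le> 1" "crit l = 0"
    using IVT2'[of crit 1 0 0] by (auto simp: crit_def)
  show ?thesis
  proof (rule ex1I[of _ l])
    fix x assume "0 \<le> x \<and> crit x = 0"
    then show "x = l" using crit_strict_antimono[of x l] crit_strict_antimono[of l x] l by (cases x l rule: linorder_cases) auto
  qed (use l in simp)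
qed

lemma extremal_value_le:
  assumes l0: "0 \<le> l0" "crit l0 = 0" and l: "0 \<le> l"
  shows "extremal_value l \<le> extremal_value l0"
proof (cases "l \<le> l0")
  case True
  show ?thesis
  proof (rule DERIV_nonneg_imp_nondecreasing[OF True])
    fix x assume x: "l \<le> x" "x \<le> l0"
    then have "0 \<le> crit x" using crit_strict_antimono[of x l0] l l0 by (cases "x = l0") auto
    then show "\<exists>D. (extremal_value has_real_derivative D) (at x) \<and> 0 \<le> D"
      using extremal_value_deriv[of x] x l by (intro exI[of _ "2 * x * exp (-2 * x) * crit x"]) auto
  qed
next
  case False
  show ?thesis
  proof (rule DERIV_nonpos_imp_nonincreasing[of l0 l])
    show "l0 \<le> l" using False by simp
    fix x assume x: "l0 \<le> x" "x \<le> l"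
    then have "crit x \<le> 0" using crit_strict_antimono[of l0 x] l0 by (cases "x = l0") auto
    then show "\<exists>D. (extremal_value has_real_derivative D) (at x) \<and> D \<le> 0"
      using extremal_value_deriv[of x] x l0
      by (intro exI[of _ "2 * x * exp (-2 * x) * crit x"]) (auto simp: mult_nonneg_nonpos)
  qed
qed

section \<open>Numerical bounds for the critical parameter and the maximum\<close>

lemma exp_neg_Taylor_bounds:
  fixes x :: real assumes "0 \<le> x" "x \<le> 1"
  shows "\<bar>exp (- x) - (\<Sum>m<14. (- x) ^ m / fact m)\<bar> \<le> 3 / fact 14"
proof -
  obtain t where t: "\<bar>t\<bar> \<le> \<bar>- x\<bar>" "exp (- x) = (\<Sum>m<14. (- x) ^ m / fact m) + exp t / fact 14 * (- x) ^ 14"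
    using Maclaurin_exp_le[of "- x" 14] by auto
  have "exp t \<le> exp 1" using t(1) assms by simp
  also have "exp 1 \<le> (3::real)" by (rule exp_le)
  finally have "exp t \<le> 3" .
  moreover have "x ^ 14 \<le> 1" using assms by (simp add: power_le_one)
  ultimately have "exp t * x ^ 14 \<le> 3 * 1" using assms by (intro mult_mono) auto
  moreover have "exp (- x) - (\<Sum>m<14. (- x) ^ m / fact m) = exp t * x ^ 14 / fact 14"
    unfolding t(2) by simp
  moreover have "0 \<le> exp t * x ^ 14" using assms by simp
  ultimately show ?thesis by (simp add: divide_right_mono)
qed

lemma exp_neg_approx:
  fixes x c :: real
  assumes x: "0 \<le> x" "x \<le> 1" and c: "\<bar>(\<Sum>m<14. (- x) ^ m / fact m) - c\<bar> \<le> 1 / 10^11"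
  shows "\<bar>exp (- x) - c\<bar> \<le> 1 / 10^10"
proof -
  \<comment> \<open>The Taylor remainder takes at most 9/10^11 of the tolerance 1/10^10; the rest is
    for rounding the polynomial.\<close>
  have "3 / fact 14 \<le> (9 / 10^11 :: real)" by (simp add: fact_numeral)
  moreover have "(1 / 10^10 :: real) = 9 / 10^11 + 1 / 10^11" by simp
  ultimately show ?thesis using exp_neg_Taylor_bounds[OF x] c by linarith
qed

lemma exp_lower_endpoint: "\<bar>exp (-2 * 0.39004568) - (0.45836413325::real)\<bar> \<le> 1 / 10^10"
  using exp_neg_approx[of "2 * 0.39004568" "0.45836413325"]
  by (simp add: lessThan_nat_numeral fact_numeral power_divide)

lemma exp_upper_endpoint: "\<bar>exp (-2 * 0.39004569) - (0.45836412408::real)\<bar> \<le> 1 / 10^10"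
  using exp_neg_approx[of "2 * 0.39004569" "0.45836412408"]
  by (simp add: lessThan_nat_numeral fact_numeral power_divide)

lemma crit_zero_bounds:
  assumes "0 \<le> l0" "crit l0 = 0"
  shows "0.39004568 \<le> l0" "l0 < 0.39004569"
proof -
  have "0 \<le> crit 0.39004568"
    using exp_lower_endpoint unfolding crit_def abs_le_iff by (simp add: field_simps)
  then show "0.39004568 \<le> l0"
    using crit_strict_antimono[of l0 "0.39004568"] assms by (cases "l0 < 0.39004568") auto
  have "crit 0.39004569 < 0"
    using exp_upper_endpoint unfolding crit_def abs_le_iff by (simp add: field_simps)
  then show "l0 < 0.39004569"
    using crit_strict_antimono[of "0.39004569" l0] assms by (cases "l0 = 0.39004569"; cases "0.39004569 < l0") auto
qed

text \<open>The left end a of the enclosing interval bounds the maximum from below by maximality.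
  Above, the mean value theorem gives an excess of at most 10^-8 times 10^-2, as the derivative is
  at most 1/100 between a and l0.\<close>

lemma extremal_value_approx:
  assumes l0: "0 \<le> l0" "crit l0 = 0"
  shows "\<bar>extremal_value l0 - 0.03485611\<bar> \<le> 5 / 10^9"
proof -
  let ?a = "0.39004568 :: real"
  note B = crit_zero_bounds[OF l0]
  define u where "u = exp (-2 * ?a)"
  have u: "0.45836413325 - 1 / 10^10 \<le> u" "u \<le> 0.45836413325 + 1 / 10^10"
    using exp_lower_endpoint unfolding u_def abs_le_iff by (simp_all add: algebra_simps)
  have "exp (-4 * ?a) = u * u" by (simp add: u_def exp_add[symmetric])
  then have Va: "extremal_value ?a = 2 * ?a^4 * (u * u) + (3 * ?a^2 + 2 * ?a + 1) * u - 1"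
    by (simp only: extremal_value_def u_def)
  have uu: "(0.45836413325 - 1 / 10^10) * (0.45836413325 - 1 / 10^10) \<le> u * u" "u * u \<le> (0.45836413325 + 1 / 10^10) * (0.45836413325 + 1 / 10^10)"
    using u by (intro mult_mono; simp)+
  have a: "0.0348561095 \<le> extremal_value ?a" "extremal_value ?a \<le> 0.0348561135"
    unfolding Va using u uu by (simp_all add: field_simps)
  have low: "extremal_value ?a \<le> extremal_value l0" by (rule extremal_value_le[OF l0]) simp
  have "extremal_value l0 \<le> extremal_value ?a + 1 / 10^9"
  proof (cases "?a < l0")
    case True
    obtain z where z: "?a < z" "z < l0" "extremal_value l0 - extremal_value ?a = (l0 - ?a) * (2 * z * exp (-2 * z) * crit z)"
      using MVT2[OF True extremal_value_deriv] by blast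
    have "crit z < crit ?a" using crit_strict_antimono[of ?a z] z by simp
    moreover have "crit ?a \<le> 1 / 100"
      using exp_lower_endpoint unfolding crit_def abs_le_iff by (simp add: field_simps)
    ultimately have c: "crit z \<le> 1 / 100" by simp
    have "2 * z * exp (-2 * z) \<le> 1 * 1" using z B by (intro mult_mono) auto
    then have "2 * z * exp (-2 * z) * crit z \<le> 1 * (1 / 100)"
    proof -
      assume "2 * z * exp (-2 * z) \<le> 1 * 1"
      have "0 \<le> crit z" using crit_strict_antimono[of z l0] z l0 by simp
      then show ?thesis using c \<open>2 * z * exp (-2 * z) \<le> 1 * 1\<close> z by (intro mult_mono) auto
    qed
    moreover have "0 \<le> l0 - ?a" "l0 - ?a \<le> 1 / 10^8" using B by simp_all
    ultimately have "(l0 - ?a) * (2 * z * exp (-2 * z) * crit z) \<le> (1 / 10^8) * (1 / 100)"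
      using z crit_strict_antimono[of z l0] l0 by (intro mult_mono) (auto intro!: mult_nonneg_nonneg)
    then show ?thesis using z(3) by simp
  next
    case False
    then have "l0 = ?a" using B by simp
    then have "extremal_value l0 = extremal_value ?a" by (rule arg_cong)
    moreover have "0 \<le> 1 / (10::real)^9" by simp
    ultimately show ?thesis by linarith
  qed
  then have "extremal_value l0 - 0.03485611 \<le> 5 / 10^9" using a by simp
  moreover have "- (extremal_value l0 - 0.03485611) \<le> 5 / 10^9" using a low by simp
  ultimately show ?thesis by (rule abs_leI)
qed

section \<open>Reflection z -> -z and optimisation over b\<close>

lemma holomorphic_on_reflect:
  fixes f :: "complex \<Rightarrow> complex"
  assumes "f holomorphic_on ball 0 r" shows "(\<lambda>z. f (- z)) holomorphic_on ball 0 r"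
proof -
  have "(\<lambda>z. - z) holomorphic_on ball (0::complex) r" by (intro holomorphic_intros)
  moreover have "(\<lambda>z. - z) ` ball (0::complex) r \<subseteq> ball 0 r" by auto
  ultimately show ?thesis
    using holomorphic_on_compose_gen[OF _ assms] unfolding o_def by blast
qed

lemma reflect_schlicht_typically_real:
  assumes f: "f \<in> schlicht \<inter> typically_real"
  shows "(\<lambda>z. - f (- z)) \<in> schlicht \<inter> typically_real"
proof -
  let ?g = "\<lambda>z. - f (- z)"
  have hf: "f holomorphic_on ball 0 1" "inj_on f (ball 0 1)" "f 0 = 0" "deriv f 0 = 1"
    using f by (auto simp: schlicht_def)
  have hol: "?g holomorphic_on ball 0 1" by (intro holomorphic_on_minus holomorphic_on_reflect hf(1))
  have inj: "inj_on ?g (ball 0 1)"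
  proof (rule inj_onI)
    fix z w :: complex assume "z \<in> ball 0 1" "w \<in> ball 0 1" "- f (- z) = - f (- w)"
    then have "- z = - w" using inj_onD[OF hf(2), of "- z" "- w"] by simp
    then show "z = w" by simp
  qed
  have "(f has_field_derivative 1) (at (- 0))" using holomorphic_derivI[OF hf(1), of 0] hf(4) by simp
  then have "((\<lambda>z. f (- z)) has_field_derivative 1 * (- 1)) (at 0)"
    by (rule DERIV_chain2) (auto intro!: derivative_eq_intros)
  then have "(?g has_field_derivative 1) (at 0)" using DERIV_minus by fastforce
  then have d: "deriv ?g 0 = 1" by (rule DERIV_imp_deriv)
  have "?g z \<in> \<real>" if "z \<in> ball 0 1" "z \<in> \<real>" for z
  proof -
    have "f (- z) \<in> \<real>" using f that unfolding typically_real_def by auto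
    then show ?thesis by simp
  qed
  moreover have "Im (?g z) * Im z > 0" if "z \<in> ball 0 1" "z \<notin> \<real>" for z
  proof -
    have "- z \<in> ball 0 1" "- z \<notin> \<real>" using that by simp_all
    then have "Im (f (- z)) * Im (- z) > 0" using f unfolding typically_real_def by blast
    then show ?thesis by simp
  qed
  ultimately show ?thesis using hol inj d hf(3) by (simp add: schlicht_def typically_real_def)
qed

text \<open>Passing to -f(-z) replaces k(z) by -k(-z), which changes the sign of k(0) and keeps
  k'(0).\<close>

lemma real_univalent_coefficient_inequality_abs:
  assumes f: "f \<in> schlicht \<inter> typically_real"
    and k: "k holomorphic_on ball 0 1" "\<And>z. z \<in> ball 0 1 \<Longrightarrow> z \<noteq> 0 \<Longrightarrow> k z = 1 / z - 1 / f z"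
    and b: "0 < b" "b \<le> 2"
  shows "Re (deriv k 0) + 2 * b * \<bar>Re (k 0)\<bar> \<le> 1 + 3 * b\<^sup>2 / 2 - b\<^sup>2 * ln (b / 2)"
proof -
  let ?k = "\<lambda>z. - k (- z)"
  have hol: "?k holomorphic_on ball 0 1" by (intro holomorphic_on_minus holomorphic_on_reflect k(1))
  have "(k has_field_derivative deriv k 0) (at (- 0))" using holomorphic_derivI[OF k(1), of 0] by simp
  then have "((\<lambda>z. k (- z)) has_field_derivative deriv k 0 * (- 1)) (at 0)"
    by (rule DERIV_chain2) (auto intro!: derivative_eq_intros)
  then have "(?k has_field_derivative deriv k 0) (at 0)" using DERIV_minus by fastforce
  then have d: "deriv ?k 0 = deriv k 0" by (rule DERIV_imp_deriv)
  have "?k z = 1 / z - 1 / (- f (- z))" if "z \<in> ball 0 1" "z \<noteq> 0" for z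
    using k(2)[of "- z"] that by simp
  from real_univalent_coefficient_inequality[OF reflect_schlicht_typically_real[OF f] hol this b]
  have "Re (deriv k 0) + 2 * b * (- Re (k 0)) \<le> 1 + 3 * b\<^sup>2 / 2 - b\<^sup>2 * ln (b / 2)" using d by simp
  with real_univalent_coefficient_inequality[OF f k b] show ?thesis by (simp add: abs_if)
qed

text \<open>The b-derivative of 1 + 3b^2/2 - b^2 ln(b/2) - 2b|A| vanishes when |A| = b(1 - ln(b/2));
  for b = 2 exp(-l) this is |A|/2 = (1 + l) exp(-l), the equation solved here with x =
  |A|/2.\<close>

lemma exists_mult_exp_neg:
  fixes x :: real assumes "0 < x" "x \<le> 1"
  obtains l where "0 \<le> l" "(1 + l) * exp (- l) = x"
proof -
  \<comment> \<open>Since exp L >= (1 + L) L/2, the value at L is at most 2/L = x, as the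
    intermediate value theorem requires.\<close>
  define L where "L = 2 / x"
  have L: "0 \<le> L" "L * x = 2" using assms by (simp_all add: L_def)
  have "(1 + L) * (L / 2) \<le> 1 + L + L\<^sup>2 / 2" using L(1) by (simp add: algebra_simps power2_eq_square)
  also have "\<dots> \<le> exp L" by (rule exp_lower_Taylor_quadratic[OF L(1)])
  finally have "(1 + L) * (L / 2) * exp (- L) * x \<le> exp L * exp (- L) * x"
    using assms by (intro mult_right_mono) auto
  moreover have "(1 + L) * (L / 2) * exp (- L) * x = (1 + L) * exp (- L) * (L * x / 2)" by (simp add: algebra_simps)
  moreover have "exp L * exp (- L) = 1" by (simp add: exp_add[symmetric])
  ultimately have "(1 + L) * exp (- L) * (2 / 2) \<le> 1 * x" by (simp only: L(2))
  then have "(1 + L) * exp (- L) \<le> x" by simp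
  moreover have "x \<le> (1 + 0) * exp (- 0)" using assms by simp
  moreover have "continuous_on {0..L} (\<lambda>l. (1 + l) * exp (- l))" by (intro continuous_intros)
  ultimately show ?thesis
    using IVT2'[of "\<lambda>l. (1 + l) * exp (- l)" L x 0] L(1) that by auto
qed

text \<open>The family \<open>up\<close> controls y = D + A^2/2 only from above. As y is squared, D
  >= -1 is what excludes large negative y.\<close>

lemma log_functional_le:
  fixes A D :: real
  assumes low: "- 1 \<le> D" and up: "\<And>b. 0 < b \<Longrightarrow> b \<le> 2 \<Longrightarrow> D + 2 * b * \<bar>A\<bar> \<le> 1 + 3 * b\<^sup>2 / 2 - b\<^sup>2 * ln (b / 2)"
    and l0: "0 \<le> l0" "crit l0 = 0"
  shows "A\<^sup>2 / 4 + (D + A\<^sup>2 / 2)\<^sup>2 / 2 - 3 / 2 \<le> extremal_value l0"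
proof -
  define y where "y = D + A\<^sup>2 / 2"
  \<comment> \<open>The member b = 2, where the logarithm vanishes; together with D >= -1 it gives
    |A| <= 2.\<close>
  have "D + 4 * \<bar>A\<bar> \<le> 7" using up[of 2] by simp
  then have A2: "\<bar>A\<bar> \<le> 2" using low by linarith
  then have Asq: "A\<^sup>2 \<le> 4" using power_mono[of "\<bar>A\<bar>" 2 2] by simp
  have y: "- 1 \<le> y" using low zero_le_power2[of A] unfolding y_def by linarith
  \<comment> \<open>\<open>extremal_value\<close> is 0 at 0, so the maximum is nonnegative. This
    settles |y| <= 1, where A^2/4 + y^2/2 <= 3/2.\<close>
  have V0: "0 \<le> extremal_value l0" using extremal_value_le[OF l0, of 0] by (simp add: extremal_value_def)
  consider "y \<le> 1" | "1 < y" "A = 0" | "1 < y" "A \<noteq> 0" by linarith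
  then have "A\<^sup>2 / 4 + y\<^sup>2 / 2 - 3 / 2 \<le> extremal_value l0"
  proof cases
    case 1
    then have "y\<^sup>2 \<le> 1" using y power_mono[of "\<bar>y\<bar>" 1 2] by simp
    then show ?thesis using Asq V0 by linarith
  next
    case 2
    \<comment> \<open>For A = 0 the stationary parameter would be infinite; l = 2 already gives y <=
      8/5, and (8/5)^2/2 < 3/2.\<close>
    have e: "exp (-2) \<le> (1 / 5 :: real)"
      using exp_lower_Taylor_quadratic[of "2::real"] by (simp add: exp_minus field_simps)
    define b where "b = 2 * exp (-2 :: real)"
    have b: "0 < b" "b \<le> 2" "b \<le> 2 / 5" using e by (simp_all add: b_def)
    have "ln (b / 2) = - 2" by (simp add: b_def)
    then have "y \<le> 1 + 7 / 2 * b\<^sup>2" using up[OF b(1,2)] 2 by (simp add: y_def)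
    moreover have "b\<^sup>2 \<le> (2 / 5)\<^sup>2" using b by (intro power_mono) auto
    ultimately have "y \<le> 8 / 5" by (simp add: power2_eq_square)
    then have "y\<^sup>2 \<le> (8 / 5)\<^sup>2" using 2 by (intro power_mono) auto
    then show ?thesis using V0 2 by (simp add: power2_eq_square)
  next
    case 3
    obtain l where l: "0 \<le> l" "(1 + l) * exp (- l) = \<bar>A\<bar> / 2"
      using exists_mult_exp_neg[of "\<bar>A\<bar> / 2"] 3 A2 by auto
    define u where "u = exp (- l)"
    have u: "0 < u" "u \<le> 1" using l by (auto simp: u_def)
    have lnu: "ln (2 * u / 2) = - l" by (simp add: u_def)
    have "\<bar>A\<bar> = 2 * ((1 + l) * exp (- l))" using l(2) by simp
    then have A: "\<bar>A\<bar> = 2 * u * (1 + l)" by (simp add: u_def algebra_simps)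
    then have Aq: "A\<^sup>2 = 4 * u\<^sup>2 * (1 + l)\<^sup>2" by (metis power2_abs power_mult_distrib four_x_squared)
    have "D + 2 * (2 * u) * (2 * u * (1 + l)) \<le> 1 + 3 * (2 * u)\<^sup>2 / 2 - (2 * u)\<^sup>2 * (- l)"
      using up[of "2 * u"] u unfolding lnu A by simp
    moreover have "y = D + 2 * u\<^sup>2 * (1 + l)\<^sup>2" by (simp add: y_def Aq)
    ultimately have "y \<le> 1 + 2 * l\<^sup>2 * u\<^sup>2" by (simp add: algebra_simps power2_eq_square)
    then have "y\<^sup>2 \<le> (1 + 2 * l\<^sup>2 * u\<^sup>2)\<^sup>2" using 3 by (intro power_mono) auto
    then have "A\<^sup>2 / 4 + y\<^sup>2 / 2 - 3 / 2 \<le> u\<^sup>2 * (1 + l)\<^sup>2 + (1 + 2 * l\<^sup>2 * u\<^sup>2)\<^sup>2 / 2 - 3 / 2"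
      by (simp add: Aq)
    also have "\<dots> = extremal_value l"
    proof -
      have "exp (-2 * l) = u\<^sup>2" "exp (-4 * l) = u\<^sup>2 * u\<^sup>2"
        by (simp_all add: u_def power2_eq_square exp_add[symmetric])
      then show ?thesis unfolding extremal_value_def by (simp add: algebra_simps power2_eq_square power4_eq_xxxx)
    qed
    also have "\<dots> \<le> extremal_value l0" by (rule extremal_value_le[OF l0 l(1)])
    finally show ?thesis .
  qed
  then show ?thesis by (simp add: y_def)
qed

lemma log_functional_eq:
  assumes f: "f \<in> schlicht \<inter> typically_real"
    and k: "k holomorphic_on ball 0 1" "\<And>z. z \<in> ball 0 1 \<Longrightarrow> z \<noteq> 0 \<Longrightarrow> k z = 1 / z - 1 / f z"
  shows "(cmod (log_coeff f 1))\<^sup>2 - 1 + 2 * (cmod (log_coeff f 2))\<^sup>2 - 1 / 2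
    = (Re (k 0))\<^sup>2 / 4 + (Re (deriv k 0) + (Re (k 0))\<^sup>2 / 2)\<^sup>2 / 2 - 3 / 2"
proof -
  obtain A D where AD: "k 0 = complex_of_real A" "deriv k 0 = complex_of_real D"
    using reciprocal_difference_real(1,2)[OF _ k] f by (metis IntD2 Reals_cases)
  have L: "log_coeff f 1 = of_real (A / 2)" "log_coeff f 2 = of_real ((D + A\<^sup>2 / 2) / 2)"
    using log_coeffs_reciprocal_difference[OF _ k] f by (simp_all add: AD)
  show ?thesis unfolding L norm_of_real AD by (simp add: power_divide)
qed

theorem theorem2:
  shows "(\<exists>!lam::real. 0 \<le> lam \<and> 0 = 4 * exp (-2 * lam) * (lam^2 - lam^3) - 3 * lam + 1) \<and>
    (\<forall>lam0::real. 0 \<le> lam0 \<and> 0 = 4 * exp (-2 * lam0) * (lam0^2 - lam0^3) - 3 * lam0 + 1 \<longrightarrow>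
      (let F = (\<lambda>f. (cmod (log_coeff f 1))^2 - 1 + 2 * (cmod (log_coeff f 2))^2 - 1/2);
           M = 2 * lam0^4 * exp (-4 * lam0) + (3 * lam0^2 + 2 * lam0 + 1) * exp (-2 * lam0) - 1
       in (\<exists>f \<in> schlicht \<inter> typically_real. F f = M) \<and>
          (\<forall>f \<in> schlicht \<inter> typically_real. F f \<le> M) \<and>
          0.39004568 \<le> lam0 \<and> lam0 < 0.39004569 \<and>
          \<bar>M - 0.03485611\<bar> \<le> 5 / 10^9))"
proof (intro conjI allI impI)
  show "\<exists>!lam::real. 0 \<le> lam \<and> 0 = 4 * exp (-2 * lam) * (lam^2 - lam^3) - 3 * lam + 1"
    using crit_unique_zero unfolding crit_def by (metis (no_types, lifting))
next
  fix lam0 :: real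
  assume "0 \<le> lam0 \<and> 0 = 4 * exp (-2 * lam0) * (lam0^2 - lam0^3) - 3 * lam0 + 1"
  then have l0: "0 \<le> lam0" "crit lam0 = 0" by (simp_all add: crit_def)
  have le: "(cmod (log_coeff f 1))\<^sup>2 - 1 + 2 * (cmod (log_coeff f 2))\<^sup>2 - 1 / 2 \<le> extremal_value lam0"
    if f: "f \<in> schlicht \<inter> typically_real" for f
  proof -
    obtain k where k: "k holomorphic_on ball 0 1" "\<And>z. z \<in> ball 0 1 \<Longrightarrow> z \<noteq> 0 \<Longrightarrow> k z = 1 / z - 1 / f z"
      using reciprocal_difference_extends f by blast
    have "(Re (k 0))\<^sup>2 / 4 + (Re (deriv k 0) + (Re (k 0))\<^sup>2 / 2)\<^sup>2 / 2 - 3 / 2 \<le> extremal_value lam0"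
      by (rule log_functional_le[OF reciprocal_difference_deriv_ge[OF f k] real_univalent_coefficient_inequality_abs[OF f k] l0])
    moreover have "(cmod (log_coeff f 1))\<^sup>2 - 1 + 2 * (cmod (log_coeff f 2))\<^sup>2 - 1 / 2
      = (Re (k 0))\<^sup>2 / 4 + (Re (deriv k 0) + (Re (k 0))\<^sup>2 / 2)\<^sup>2 / 2 - 3 / 2"
      by (rule log_functional_eq[OF f k])
    ultimately show ?thesis by (simp only:)
  qed
  \<comment> \<open>The substitution b = 2 exp(-l) at l = lam0. The coefficients of
    \<open>slit_map b\<close> turn every estimate in the last case of
    \<open>log_functional_le\<close> into an equality.\<close>
  define b where "b = 2 * exp (- lam0)"
  have b: "0 < b" "b \<le> 2" using l0 by (simp_all add: b_def)
  have lnb: "ln (b / 2) = - lam0" by (simp add: b_def)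
  have f: "slit_map b \<in> schlicht \<inter> typically_real" by (rule slit_map_mem[OF b])
  obtain k where k: "k holomorphic_on ball 0 1" "\<And>z. z \<in> ball 0 1 \<Longrightarrow> z \<noteq> 0 \<Longrightarrow> k z = 1 / z - 1 / slit_map b z"
    using reciprocal_difference_extends f by blast
  have "(cmod (log_coeff (slit_map b) 1))\<^sup>2 - 1 + 2 * (cmod (log_coeff (slit_map b) 2))\<^sup>2 - 1 / 2 = extremal_value lam0"
  proof -
    define u where "u = exp (- lam0)"
    have bu: "b = 2 * u" by (simp add: b_def u_def)
    have e: "exp (-2 * lam0) = u\<^sup>2" "exp (-4 * lam0) = u\<^sup>2 * u\<^sup>2"
      by (simp_all add: u_def power2_eq_square exp_add[symmetric])
    define A where "A = 2 * u * (1 + lam0)"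
    have c: "k 0 = of_real (b - b * ln (b / 2))" "deriv k 0 = of_real (1 + b\<^sup>2 / 2 - b * (b - b * ln (b / 2)))"
      by (rule slit_map_coefficients[OF b k]; assumption)+
    have "Re (k 0) = A" "Re (deriv k 0) = 1 + 2 * u\<^sup>2 - 2 * u * A"
      unfolding c Re_complex_of_real lnb by (simp_all add: bu A_def algebra_simps power2_eq_square)
    moreover have "1 + 2 * u\<^sup>2 - 2 * u * A + A\<^sup>2 / 2 = 1 + 2 * lam0\<^sup>2 * u\<^sup>2"
      by (simp add: A_def power2_eq_square algebra_simps)
    moreover have "A\<^sup>2 / 4 + (1 + 2 * lam0\<^sup>2 * u\<^sup>2)\<^sup>2 / 2 - 3 / 2 = extremal_value lam0"
      unfolding extremal_value_def e by (simp add: A_def power2_eq_square power4_eq_xxxx algebra_simps add_divide_distrib)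
    moreover have "(cmod (log_coeff (slit_map b) 1))\<^sup>2 - 1 + 2 * (cmod (log_coeff (slit_map b) 2))\<^sup>2 - 1 / 2
      = (Re (k 0))\<^sup>2 / 4 + (Re (deriv k 0) + (Re (k 0))\<^sup>2 / 2)\<^sup>2 / 2 - 3 / 2"
      by (rule log_functional_eq[OF f k])
    ultimately show ?thesis by (simp only:)
  qed
  then show "let F = (\<lambda>f. (cmod (log_coeff f 1))^2 - 1 + 2 * (cmod (log_coeff f 2))^2 - 1/2);
           M = 2 * lam0^4 * exp (-4 * lam0) + (3 * lam0^2 + 2 * lam0 + 1) * exp (-2 * lam0) - 1
       in (\<exists>f \<in> schlicht \<inter> typically_real. F f = M) \<and>
          (\<forall>f \<in> schlicht \<inter> typically_real. F f \<le> M) \<and>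
          0.39004568 \<le> lam0 \<and> lam0 < 0.39004569 \<and>
          \<bar>M - 0.03485611\<bar> \<le> 5 / 10^9"
    using le f crit_zero_bounds[OF l0] extremal_value_approx[OF l0]
    unfolding Let_def extremal_value_def by blast
qed

end
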